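(* Let $C$ be a bounded chain complex of $\underline{\mathbb Z/2}$-modules which in each degree is a finite direct sum of copies of $F$ and $H$. Then $C$ is isomorphic (as a chain complex) to a finite direct sum of shifts of the complexes $A_k$, $B_r$, $H(n)$ (for various $k,r\geq 0$ and $n\in\mathbb Z$) and the contractible complexes $\mathbb D(F)$ and $\mathbb D(H)$.
   Context: A $C_2$-Mackey functor $M$ consists of abelian groups $M_\Theta,M_\bullet$ and homomorphisms $t\colon M_\Theta\to M_\Theta$, $p^*\colon M_\bullet\to M_\Theta$, $p_*\colon M_\Theta\to M_\bullet$ with $tp^*=p^*$, $p_*t=p_*$, $t^2=1$, $p^*p_*=1+t$. A $\underline{\mathbb Z/2}$-module (module over the constant Mackey ring $\underline{\mathbb Z/2}$) is the same thing as a Mackey functor in which $M_\Theta,M_\bullet$ are $\mathbb F_2$-vector spaces and $p_*p^*=0$. Let $H=\underline{\mathbb Z/2}$ (both groups $\mathbb F_2$, $t=p^*=\mathrm{id}$, $p_*=0$) and let $F$ be the module with $F_\Theta=\mathbb F_2^2$, $t$ swapping the coordinates, $F_\bullet=\mathbb F_2$, $p_*(x,y)=x+y$, $p^*(z)=(z,z)$. The nonzero maps between these are: the unique nonzero map $p\colon F\to H$, the unique nonzero map $p\colon H\to F$, $\mathrm{id}_H$, and $1,t,u:=1+t\colon F\to F$. Chain complexes are homologically graded (differentials lower degree); $\Sigma$ denotes the shift $(\Sigma C)_i=C_{i-1}$. Define: for $k\geq 0$, $A_k$ is $F\xrightarrow{u}F\xrightarrow{u}\cdots\xrightarrow{u}F$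 with $F$ in degrees $k,\dots,0$; $H(0)$ is $H$ in degree $0$; for $n>0$, $H(-n)$ is $H\xrightarrow{p}F\xrightarrow{u}\cdots\xrightarrow{u}F$ with $H$ in degree $n$ and $F$ in degrees $n-1,\dots,0$; for $n>0$, $H(n)$ is $F\xrightarrow{u}\cdots\xrightarrow{u}F\xrightarrow{p}H$ with $F$ in degrees $0,\dots,-(n-1)$ and $H$ in degree $-n$; for $r\geq 0$, $B_r$ is $H\xrightarrow{p}F\xrightarrow{u}\cdots\xrightarrow{u}F\xrightarrow{p}H$ with $H$ in degree $0$, $F$ in degrees $-1,\dots,-(r+1)$, and $H$ in degree $-(r+2)$. For a module $P$, $\mathbb D(P)$ is the complex $P\xrightarrow{\mathrm{id}}P$ concentrated in degrees $1$ and $0$. *)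

theory Defs
  imports "Jordan_Normal_Form.Matrix" "HOL-Library.Z2"
begin

text \<open>A (finite) Z/2-module M: M_Theta = F_2^(mdT M), M_bullet = F_2^(mdB M);
  maps act on column vectors. mt : M_Theta -> M_Theta (the map t),
  mup : M_bullet -> M_Theta (the map p^*), mdn : M_Theta -> M_bullet (the map p_*).\<close>

record zmod =
  mdT :: nat
  mdB :: nat
  mt  :: "bit mat"
  mup :: "bit mat"
  mdn :: "bit mat"

definition is_zmod :: "zmod \<Rightarrow> bool" where
  "is_zmod M \<longleftrightarrow>
     mt M \<in> carrier_mat (mdT M) (mdT M) \<and>
     mup M \<in> carrier_mat (mdT M) (mdB M) \<and>
     mdn M \<in> carrier_mat (mdB M) (mdT M) \<and>
     mt M * mup M = mup M \<and>
     mdn M * mt M = mdn M \<and>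
     mt M * mt M = 1\<^sub>m (mdT M) \<and>
     mup M * mdn M = 1\<^sub>m (mdT M) + mt M \<and>
     mdn M * mup M = 0\<^sub>m (mdB M) (mdB M)"

record zhom =
  hT :: "bit mat"
  hB :: "bit mat"

definition is_zhom :: "zmod \<Rightarrow> zmod \<Rightarrow> zhom \<Rightarrow> bool" where
  "is_zhom M N f \<longleftrightarrow>
     hT f \<in> carrier_mat (mdT N) (mdT M) \<and>
     hB f \<in> carrier_mat (mdB N) (mdB M) \<and>
     hT f * mt M = mt N * hT f \<and>
     hT f * mup M = mup N * hB f \<and>
     hB f * mdn M = mdn N * hT f"

definition zcomp :: "zhom \<Rightarrow> zhom \<Rightarrow> zhom" where
  "zcomp g f = \<lparr>hT = hT g * hT f, hB = hB g * hB f\<rparr>"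

definition zid :: "zmod \<Rightarrow> zhom" where
  "zid M = \<lparr>hT = 1\<^sub>m (mdT M), hB = 1\<^sub>m (mdB M)\<rparr>"

definition zzero :: "zmod \<Rightarrow> zmod \<Rightarrow> zhom" where
  "zzero M N = \<lparr>hT = 0\<^sub>m (mdT N) (mdT M), hB = 0\<^sub>m (mdB N) (mdB M)\<rparr>"

definition is_ziso :: "zmod \<Rightarrow> zmod \<Rightarrow> zhom \<Rightarrow> bool" where
  "is_ziso M N f \<longleftrightarrow> is_zhom M N f \<and>
     (\<exists>g. is_zhom N M g \<and> zcomp g f = zid M \<and> zcomp f g = zid N)"

definition zmod_isomorphic :: "zmod \<Rightarrow> zmod \<Rightarrow> bool" where
  "zmod_isomorphic M N \<longleftrightarrow> (\<exists>f. is_ziso M N f)"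

definition zsum :: "zmod list \<Rightarrow> zmod" where
  "zsum Ms = \<lparr>mdT = sum_list (map mdT Ms), mdB = sum_list (map mdB Ms),
     mt = diag_block_mat (map mt Ms), mup = diag_block_mat (map mup Ms),
     mdn = diag_block_mat (map mdn Ms)\<rparr>"

definition zhsum :: "zhom list \<Rightarrow> zhom" where
  "zhsum fs = \<lparr>hT = diag_block_mat (map hT fs), hB = diag_block_mat (map hB fs)\<rparr>"

definition modH :: zmod where
  "modH = \<lparr>mdT = 1, mdB = 1,
     mt = mat_of_rows_list 1 [[1]],
     mup = mat_of_rows_list 1 [[1]],
     mdn = mat_of_rows_list 1 [[0]]\<rparr>"

definition modF :: zmod where
  "modF = \<lparr>mdT = 2, mdB = 1,
     mt = mat_of_rows_list 2 [[0, 1], [1, 0]],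
     mup = mat_of_rows_list 1 [[1], [1]],
     mdn = mat_of_rows_list 2 [[1, 1]]\<rparr>"

text \<open>The maps p : F -> H, p : H -> F, u = 1 + t : F -> F.\<close>

definition pFH :: zhom where
  "pFH = \<lparr>hT = mat_of_rows_list 2 [[1, 1]], hB = mat_of_rows_list 1 [[0]]\<rparr>"

definition pHF :: zhom where
  "pHF = \<lparr>hT = mat_of_rows_list 1 [[1], [1]], hB = mat_of_rows_list 1 [[1]]\<rparr>"

definition uFF :: zhom where
  "uFF = \<lparr>hT = mat_of_rows_list 2 [[1, 1], [1, 1]], hB = mat_of_rows_list 1 [[0]]\<rparr>"

record cx =
  cobj :: "int \<Rightarrow> zmod"
  cdif :: "int \<Rightarrow> zhom"

definition is_cx :: "cx \<Rightarrow> bool" where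
  "is_cx C \<longleftrightarrow> (\<forall>i. is_zmod (cobj C i) \<and>
      is_zhom (cobj C i) (cobj C (i - 1)) (cdif C i) \<and>
      zcomp (cdif C (i - 1)) (cdif C i) = zzero (cobj C i) (cobj C (i - 2)))"

definition bounded_cx :: "cx \<Rightarrow> bool" where
  "bounded_cx C \<longleftrightarrow> (\<exists>N::nat. \<forall>i. \<bar>i\<bar> > int N \<longrightarrow>
      mdT (cobj C i) = 0 \<and> mdB (cobj C i) = 0)"

definition is_chain_map :: "cx \<Rightarrow> cx \<Rightarrow> (int \<Rightarrow> zhom) \<Rightarrow> bool" where
  "is_chain_map C D f \<longleftrightarrow> (\<forall>i. is_zhom (cobj C i) (cobj D i) (f i) \<and>
      zcomp (f (i - 1)) (cdif C i) = zcomp (cdif D i) (f i))"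

text \<open>A chain isomorphism: a chain map which is degreewise an isomorphism
  (its degreewise inverse is then automatically a chain map).\<close>

definition cx_isomorphic :: "cx \<Rightarrow> cx \<Rightarrow> bool" where
  "cx_isomorphic C D \<longleftrightarrow>
     (\<exists>f. is_chain_map C D f \<and> (\<forall>i. is_ziso (cobj C i) (cobj D i) (f i)))"

text \<open>Shift: (Sigma^s C)_i = C_(i-s). No sign needed in characteristic 2.\<close>

definition cx_shift :: "int \<Rightarrow> cx \<Rightarrow> cx" where
  "cx_shift s C = \<lparr>cobj = (\<lambda>i. cobj C (i - s)), cdif = (\<lambda>i. cdif C (i - s))\<rparr>"

definition cx_sum :: "cx list \<Rightarrow> cx" where
  "cx_sum Cs = \<lparr>cobj = (\<lambda>i. zsum (map (\<lambda>C. cobj C i) Cs)),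
                cdif = (\<lambda>i. zhsum (map (\<lambda>C. cdif C i) Cs))\<rparr>"

text \<open>strip tp Ms fs: the complex with Ms!0 in degree tp, Ms!1 in degree tp-1, ...,
  and differential fs!j : Ms!j -> Ms!(j+1); zero elsewhere.\<close>

definition strip_obj :: "int \<Rightarrow> zmod list \<Rightarrow> int \<Rightarrow> zmod" where
  "strip_obj tp Ms i =
     (if tp - int (length Ms) < i \<and> i \<le> tp then Ms ! nat (tp - i) else zsum [])"

definition strip :: "int \<Rightarrow> zmod list \<Rightarrow> zhom list \<Rightarrow> cx" where
  "strip tp Ms fs = \<lparr>cobj = strip_obj tp Ms,
     cdif = (\<lambda>i. if tp - int (length Ms) + 1 < i \<and> i \<le> tp then fs ! nat (tp - i)
                 else zzero (strip_obj tp Ms i) (strip_obj tp Ms (i - 1)))\<rparr>"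

definition cxA :: "nat \<Rightarrow> cx" where
  "cxA k = strip (int k) (replicate (Suc k) modF) (replicate k uFF)"

definition cxH :: "int \<Rightarrow> cx" where
  "cxH n = (if n = 0 then strip 0 [modH] []
            else if n < 0 then
              strip (- n) (modH # replicate (nat (- n)) modF)
                          (pHF # replicate (nat (- n) - 1) uFF)
            else
              strip 0 (replicate (nat n) modF @ [modH])
                      (replicate (nat n - 1) uFF @ [pFH]))"

definition cxB :: "nat \<Rightarrow> cx" where
  "cxB r = strip 0 (modH # replicate (Suc r) modF @ [modH]) (pHF # replicate r uFF @ [pFH])"

definition cxD :: "zmod \<Rightarrow> cx" where
  "cxD P = strip 1 [P, P] [zid P]"

definition basic_cx :: "cx \<Rightarrow> bool" where
  "basic_cx X \<longleftrightarrow> (\<exists>k. X = cxA k) \<or> (\<exists>r. X = cxB r) \<or> (\<exists>n. X = cxH n)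
                    \<or> X = cxD modF \<or> X = cxD modH"

end

theory Submission
  imports Defs "HOL-Library.Function_Algebras"
begin

text \<open>For a sum of copies of \<open>F\<close> and \<open>H\<close>, the map \<open>p\<^sup>*\<close> identifies the group at \<open>\<bullet>\<close> with the
  \<open>t\<close>-fixed points of the group at \<open>\<Theta>\<close>, so the complex is determined by a bounded graded
  \<open>F\<^sub>2\<close>-vector space with two commuting square-zero operators: the differential \<open>d\<close>, of degree \<open>-1\<close>,
  and \<open>u = 1 + t\<close>, of degree \<open>0\<close>. Such an object is a sum of squares and zigzags. An \<open>x\<close> with
  \<open>u d x \<noteq> 0\<close> generates a square \<open>x, u x, d x, u d x\<close>, which is a copy of \<open>D(F)\<close> and a direct
  summand. If \<open>u d = 0\<close>, choose complements \<open>T\<^sub>i\<close> of \<open>ker u \<inter> ker d\<close>; decomposing the chain of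
  linear relations \<open>u x = d y\<close> between \<open>T\<^sub>i\<close> and \<open>T\<^sub>i\<^sub>+\<^sub>1\<close> by means of adapted bases yields the
  zigzags, and these are the remaining basic complexes.\<close>

section \<open>Adapted bases\<close>

text \<open>When \<open>u d = 0\<close>, both operators map into
  \<open>K = ker u \<inter> ker d\<close> and vanish on it. What remains are the maps
  \<open>u\<close> and \<open>d\<close> from the complements \<open>T\<close> to \<open>K\<close>: a
  diagram of type A with alternating arrows, whose indecomposables are intervals. The ends of an
  interval determine the complex. A top vector killed by \<open>u\<close> starts the strip with H,
  any other with F; a bottom vector not killed by \<open>d\<close> adds a final H; a vector of
  \<open>K\<close> outside both images is an H alone. Hence \<open>D(H)\<close> is an interval (one
  vector with \<open>u x = 0\<close> and \<open>d x \<noteq> 0\<close>), and only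
  \<open>D(F)\<close> needs squares. The obstacle is that an arbitrary basis of one complement
  cannot be continued upwards: which combinations extend, and how far, must be visible on single
  basis vectors. Flags carry this information down from the higher degrees. Maps are built from the
  strips to \<open>C\<close>, because a map out of F is a vector at \<open>\<Theta>\<close> and a
  map out of H is a fixed one; the resulting isomorphism is inverted at the end.\<close>

context vector_space
begin

text \<open>The representation of a vector over an independent set is unique, so its support lies in
  both subsets.\<close>

lemma span_Int_independent:
  assumes "independent S" "X \<subseteq> S" "Y \<subseteq> S"
  shows "span X \<inter> span Y = span (X \<inter> Y)"
proof
  have iX: "independent X" using assms independent_mono by blast
  show "span X \<inter> span Y \<subseteq> span (X \<inter> Y)"
  proof
    fix x assume x: "x \<in> span X \<inter> span Y"
    have eq: "representation X x = representation Y x"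
      using representation_extend[OF assms(1) _ assms(2), of x] representation_extend[OF assms(1) _ assms(3), of x] x
      by auto
    have "{b. representation X x b \<noteq> 0} \<subseteq> X \<inter> Y"
      using representation_ne_zero[of X x] representation_ne_zero[of Y x] unfolding eq[symmetric] by auto
    then have "(\<Sum>b | representation X x b \<noteq> 0. scale (representation X x b) b) \<in> span (X \<inter> Y)"
      by (intro span_sum span_scale span_base) auto
    then show "x \<in> span (X \<inter> Y)"
      using sum_nonzero_representation_eq[OF iX] x by auto
  qed
  show "span (X \<inter> Y) \<subseteq> span X \<inter> span Y"
    using span_mono[of "X \<inter> Y" X] span_mono[of "X \<inter> Y" Y] by auto
qed

lemma span_Int_disjoint:
  assumes "independent S" "X \<subseteq> S" "Y \<subseteq> S" "X \<inter> Y = {}" "v \<in> span X" "v \<in> span Y"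
  shows "v = 0"
  using span_Int_independent[OF assms(1-3)] assms(4-6) by auto

lemma independent_Un:
  assumes "independent X" "independent Y" "\<And>v. v \<in> span X \<Longrightarrow> v \<in> span Y \<Longrightarrow> v = 0"
  shows "independent (X \<union> Y)"
proof -
  have *: False
    if iX: "independent X" and 0: "\<And>v. v \<in> span X \<Longrightarrow> v \<in> span Y \<Longrightarrow> v = 0"
      and a: "a \<in> X" "a \<in> span (X \<union> Y - {a})" for X Y a
  proof -
    have "a \<in> span ((X - {a}) \<union> (Y - {a}))"
      using a(2) by (simp add: Un_Diff)
    then obtain p q where pq: "a = p + q" "p \<in> span (X - {a})" "q \<in> span (Y - {a})"
      unfolding span_Un by auto
    have "p \<in> span X" using pq(2) span_mono[of "X - {a}" X] by auto
    then have "q \<in> span X" using pq(1) a(1) by (metis add_diff_cancel_left' span_base span_diff)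
    moreover have "q \<in> span Y" using pq(3) span_mono[of "Y - {a}" Y] by auto
    ultimately have "q = 0" by (rule 0)
    then show False using pq iX a(1) by (auto simp: dependent_def)
  qed
  show ?thesis
  proof (unfold dependent_def, rule, elim bexE)
    fix a assume "a \<in> X \<union> Y" "a \<in> span (X \<union> Y - {a})"
    then show False using *[of X Y a] *[of Y X a] assms Un_commute[of X Y] by auto
  qed
qed

lemma extend_to_basis:
  assumes "independent X" "X \<subseteq> T" "subspace T"
  obtains Y where "X \<inter> Y = {}" "Y \<subseteq> T" "independent (X \<union> Y)" "span (X \<union> Y) = T"
proof -
  obtain B where B: "X \<subseteq> B" "B \<subseteq> T" "independent B" "T \<subseteq> span B"
    using maximal_independent_subset_extend[OF assms(2,1)] by auto
  show ?thesis
    using that[of "B - X"] B assms(3) span_subspace[OF B(2,4) assms(3)] by (auto simp: Un_absorb1)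
qed

text \<open>\<open>A\<close> is a prescribed part of the basis (later the lifted vectors),
  \<open>G\<close> the flag to be respected and \<open>Z\<close> a kernel that should be spanned by
  basis vectors outside \<open>A\<close>. The hypothesis \<open>sep\<close> says that the members of
  \<open>A\<close> entering at level \<open>Suc l\<close> are independent modulo
  \<open>G l + Z\<close>, so neither the flag nor the kernel forces a relation on them.\<close>

lemma adapted_extension:
  fixes G :: "nat \<Rightarrow> 'b set"
  assumes G: "\<And>l. subspace (G l)" "\<And>l. G l \<subseteq> G (Suc l)" "G 0 = {0}"
    and Z: "subspace Z" and A: "independent A"
    and sep: "\<And>l v g z. v \<in> span (A \<inter> G (Suc l) - G l) \<Longrightarrow> g \<in> G l \<Longrightarrow> z \<in> Z \<Longrightarrow> v = g + z \<Longrightarrow> v = 0"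
  shows "\<exists>N. N \<inter> A = {} \<and> N \<subseteq> G l \<and> independent (A \<inter> G l \<union> N) \<and>
    (\<forall>k\<le>l. G k \<subseteq> span ((A \<union> N) \<inter> G k)) \<and> Z \<inter> G l \<subseteq> span (N \<inter> Z)"
proof (induction l)
  case 0
  have "A \<inter> {0} = {}" using A dependent_zero by auto
  then show ?case by (intro exI[of _ "{}"]) (auto simp: G(3) span_zero independent_empty)
next
  case (Suc l)
  then obtain N where N: "N \<inter> A = {}" "N \<subseteq> G l" "independent (A \<inter> G l \<union> N)"
    "\<And>k. k \<le> l \<Longrightarrow> G k \<subseteq> span ((A \<union> N) \<inter> G k)" "Z \<inter> G l \<subseteq> span (N \<inter> Z)"
    by auto
  define X where "X = A \<inter> G l \<union> N"
  have X: "independent X" "X \<subseteq> G l" "span X = G l"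
  proof -
    show "independent X" "X \<subseteq> G l" using N X_def by auto
    have "(A \<union> N) \<inter> G l = X" using N(2) X_def by auto
    then show "span X = G l" using N(4)[of l] \<open>X \<subseteq> G l\<close> G(1) span_subspace by auto
  qed
  have ZN: "span (N \<inter> Z) = Z \<inter> G l"
    using N(2,5) Z G(1) by (intro span_subspace) (auto simp: subspace_inter)
  \<comment> \<open>Each level adds three layers: kernel vectors \<open>W\<close>, so that
    \<open>N\<close> keeps containing a basis of the kernel part; then the new members
    \<open>A'\<close> of \<open>A\<close>; then an arbitrary complement \<open>Y\<close>. Since
    \<open>span (X \<union> W)\<close> stays inside \<open>G l + Z\<close>, \<open>sep\<close>
    applies to \<open>A'\<close>.\<close>
  obtain W where W: "(N \<inter> Z) \<inter> W = {}" "W \<subseteq> Z \<inter> G (Suc l)" "independent ((N \<inter> Z) \<union> W)"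
    "span ((N \<inter> Z) \<union> W) = Z \<inter> G (Suc l)"
  proof (rule extend_to_basis)
    show "independent (N \<inter> Z)" by (rule independent_mono[OF N(3)]) auto
    show "N \<inter> Z \<subseteq> Z \<inter> G (Suc l)" using N(2) G(2)[of l] by auto
    show "subspace (Z \<inter> G (Suc l))" using Z G(1) by (rule subspace_inter)
  qed
  have iXW: "independent (X \<union> W)"
  proof (rule independent_Un[OF X(1)])
    show "independent W" using W(3) independent_mono by blast
    fix v assume v: "v \<in> span X" "v \<in> span W"
    have "v \<in> Z" using v(2) W(2) Z span_minimal[of W Z] by auto
    then have "v \<in> span (N \<inter> Z)" using v(1) X(3) ZN by auto
    then show "v = 0" using span_Int_disjoint[OF W(3) _ _ W(1)] v(2) by auto
  qed
  have XWsub: "span (X \<union> W) \<subseteq> {g + z |g z. g \<in> G l \<and> z \<in> Z}"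
    using X(3) W(2) Z span_minimal[of W Z] unfolding span_Un by blast
  define A' where "A' = A \<inter> G (Suc l) - G l"
  have iXWA: "independent ((X \<union> W) \<union> A')"
  proof (rule independent_Un[OF iXW])
    show "independent A'" by (rule independent_mono[OF A]) (auto simp: A'_def)
    fix v assume v: "v \<in> span (X \<union> W)" "v \<in> span A'"
    then obtain g z where "v = g + z" "g \<in> G l" "z \<in> Z" using XWsub by auto
    then show "v = 0" using sep[of v l g z] v(2) unfolding A'_def by simp
  qed
  have dWA: "W \<inter> A = {}"
  proof -
    have "w \<notin> A" if w: "w \<in> W" for w
    proof
      assume wA: "w \<in> A"
      have w0: "w \<noteq> 0" using wA A dependent_zero by auto
      show False
      proof (cases "w \<in> G l")
        case True
        then have "w \<in> span (N \<inter> Z)" using w W(2) ZN by auto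
        then show False using span_Int_disjoint[OF W(3) _ _ W(1), of w] w w0 span_base by auto
      next
        case False
        then have "w \<in> span A'" using w wA W(2) by (auto simp: A'_def intro: span_base)
        then show False using sep[of w l 0 w] w W(2) w0 G(1) subspace_0 unfolding A'_def by auto
      qed
    qed
    then show ?thesis by auto
  qed
  have sub: "(X \<union> W) \<union> A' \<subseteq> G (Suc l)"
    using X(2) W(2) G(2) A'_def by blast
  obtain Y where Y: "((X \<union> W) \<union> A') \<inter> Y = {}" "Y \<subseteq> G (Suc l)"
    "independent ((X \<union> W) \<union> A' \<union> Y)" "span ((X \<union> W) \<union> A' \<union> Y) = G (Suc l)"
    using extend_to_basis[OF iXWA sub G(1)] by auto
  define N' where "N' = N \<union> W \<union> Y"
  have eq: "A \<inter> G (Suc l) \<union> N' = (X \<union> W) \<union> A' \<union> Y"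
    using G(2)[of l] unfolding N'_def X_def A'_def by auto
  have N'sub: "N' \<subseteq> G (Suc l)"
    using N(2) W(2) Y(2) G(2)[of l] unfolding N'_def by auto
  show ?case
  proof (intro exI conjI allI impI)
    have "Y \<inter> A = {}" using Y(1,2) unfolding X_def A'_def by auto
    then show "N' \<inter> A = {}" using N(1) dWA unfolding N'_def by auto
    show "independent (A \<inter> G (Suc l) \<union> N')" using Y(3) eq by simp
    show "Z \<inter> G (Suc l) \<subseteq> span (N' \<inter> Z)"
    proof -
      have "N \<inter> Z \<union> W \<subseteq> N' \<inter> Z" using W(2) unfolding N'_def by auto
      then show ?thesis using W(4) span_mono by blast
    qed
    fix k assume k: "k \<le> Suc l"
    show "G k \<subseteq> span ((A \<union> N') \<inter> G k)"
    proof (cases "k \<le> l")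
      case True
      then have "G k \<subseteq> span ((A \<union> N) \<inter> G k)" by (rule N(4))
      also have "\<dots> \<subseteq> span ((A \<union> N') \<inter> G k)" by (intro span_mono) (auto simp: N'_def)
      finally show ?thesis .
    next
      case False
      then have [simp]: "k = Suc l" using k by simp
      have "(A \<union> N') \<inter> G k = (X \<union> W) \<union> A' \<union> Y" using eq N'sub by auto
      then show ?thesis using Y(4) by simp
    qed
  qed (fact N'sub)
qed

end

section \<open>Lifting adapted bases along the relation \<open>u x = d y\<close>\<close>

locale linear_endo_pair = vector_space scale
  for scale :: "'a::field \<Rightarrow> 'b::ab_group_add \<Rightarrow> 'b" +
  fixes d u :: "'b \<Rightarrow> 'b"
  assumes linear_d: "Vector_Spaces.linear scale scale d"
    and linear_u: "Vector_Spaces.linear scale scale u"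
begin

sublocale endo: vector_space_pair scale scale ..

sublocale d: Vector_Spaces.linear scale scale d by (rule linear_d)
sublocale u: Vector_Spaces.linear scale scale u by (rule linear_u)

text \<open>Lists instead of sets, because the basis vectors end up as columns of a matrix;
  distinctness then has to be demanded separately.\<close>

definition independent_list :: "'b list \<Rightarrow> bool" where
  "independent_list vs \<longleftrightarrow> distinct vs \<and> independent (set vs)"

definition basis_list :: "'b set \<Rightarrow> 'b list \<Rightarrow> bool" where
  "basis_list T vs \<longleftrightarrow> independent_list vs \<and> span (set vs) = T"

lemma basis_list_mset_cong: "mset vs = mset ws \<Longrightarrow> basis_list T vs \<longleftrightarrow> basis_list T ws"
  unfolding basis_list_def independent_list_def using mset_eq_setD[of vs ws] mset_eq_imp_distinct_iff[of vs ws] by auto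

text \<open>One step upwards, with \<open>T\<close> and \<open>T'\<close> the complements in two
  adjacent degrees. Each basis vector satisfying \<open>ext\<close> is lifted into the lowest
  possible member of the flag. A combination of lifts that drops to \<open>G l\<close> modulo
  \<open>ker d\<close> comes from a combination of basis vectors lying in \<open>P l\<close>, which
  adaptedness of \<open>B\<close> excludes unless it is zero; this is \<open>sep\<close>. The list
  \<open>ns\<close> completes the lifts and contains a basis of \<open>ker d\<close> on
  \<open>T'\<close>, whence the independence of the images.\<close>

lemma extend_level:
  assumes G: "\<And>l. subspace (G l)" "\<And>l. G l \<subseteq> G (Suc l)" "G 0 = {0}" "G L = T'" "\<And>l. G l \<subseteq> T'"
    and fin: "finite T'" and B: "basis_list T B"
    and P: "\<And>l. P l = {x \<in> T. \<exists>y\<in>G l. u x = d y}"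
    and adapted: "\<And>l. P l \<subseteq> span (set B \<inter> P l)"
    and ext: "\<And>x. ext x \<longleftrightarrow> u x \<noteq> 0 \<and> (\<exists>y\<in>T'. u x = d y)"
  obtains f ns where "\<And>x. ext x \<Longrightarrow> d (f x) = u x"
    "basis_list T' (map f (filter ext B) @ ns)"
    "\<And>l. G l \<subseteq> span (set (map f (filter ext B) @ ns) \<inter> G l)"
    "independent_list (map u (filter (\<lambda>x. u x \<noteq> 0) B) @ map d (filter (\<lambda>y. d y \<noteq> 0) ns))"
proof -
  have iB: "independent (set B)" and dB: "distinct B" and sB: "span (set B) = T"
    using B by (auto simp: basis_list_def independent_list_def)
  have sT': "subspace T'" using G(1)[of L] G(4) by simp
  have BT: "x \<in> T" if "x \<in> set B" for x using that sB span_base by auto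
  \<comment> \<open>A partner at the least level lies, by monotonicity, in every \<open>G l\<close>
    that contains any partner of \<open>x\<close>.\<close>
  have "\<exists>y. y \<in> T' \<and> d y = u x \<and> (\<forall>l. (\<exists>y\<in>G l. u x = d y) \<longrightarrow> y \<in> G l)" if x: "ext x" for x
  proof -
    define l where "l = (LEAST l. \<exists>y\<in>G l. u x = d y)"
    have "\<exists>y\<in>G L. u x = d y" using x ext G(4) by auto
    then have "\<exists>y\<in>G l. u x = d y" unfolding l_def by (rule LeastI)
    then obtain y where y: "y \<in> G l" "u x = d y" by auto
    have "y \<in> G k" if "\<exists>y\<in>G k. u x = d y" for k
    proof -
      have "l \<le> k" unfolding l_def using that by (rule Least_le)
      then show ?thesis using lift_Suc_mono_le[of G, OF G(2)] y(1) by blast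
    qed
    then show ?thesis using y G(5) by (intro exI[of _ y]) auto
  qed
  then obtain f where f: "\<And>x. ext x \<Longrightarrow> f x \<in> T'" "\<And>x. ext x \<Longrightarrow> d (f x) = u x"
    "\<And>x l y. ext x \<Longrightarrow> y \<in> G l \<Longrightarrow> u x = d y \<Longrightarrow> f x \<in> G l"
    by metis
  define E where "E = set (filter ext B)"
  have EB: "E \<subseteq> set B" and Eext: "\<And>x. x \<in> E \<Longrightarrow> ext x" by (auto simp: E_def)
  have iE: "independent E" using iB EB by (rule independent_mono)
  \<comment> \<open>\<open>f\<close> is chosen vector by vector; its linear extension
    \<open>g\<close> makes \<open>d (g w) = u w\<close> available for combinations \<open>w\<close>
    of liftable vectors.\<close>
  obtain g where g: "Vector_Spaces.linear scale scale g" "\<And>x. x \<in> E \<Longrightarrow> g x = f x"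
    using endo.linear_independent_extend[OF iE, of f] by auto
  interpret g: Vector_Spaces.linear scale scale g by (rule g(1))
  have dg: "d (g w) = u w" if "w \<in> span E" for w
  proof -
    have "Vector_Spaces.linear scale scale (\<lambda>x. d (g x))"
      using Vector_Spaces.linear_compose[OF g(1) linear_d] by (simp add: o_def)
    then show ?thesis
      using endo.linear_eq_on[of "\<lambda>x. d (g x)" u w E] linear_u that g(2) f(2) Eext by auto
  qed
  have P0: "P 0 = {x \<in> T. u x = 0}" unfolding P G(3) by auto
  \<comment> \<open>\<open>P 0\<close> is the kernel of \<open>u\<close> on \<open>T\<close>.
    Adaptedness at level 0 says that basis vectors span it, so the remaining ones have independent
    images under \<open>u\<close>.\<close>
  have inj0: "w = 0" if w: "w \<in> span X" "u w = 0" and X: "X \<subseteq> set B" "\<And>x. x \<in> X \<Longrightarrow> u x \<noteq> 0" for w X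
  proof -
    have "w \<in> T" using w(1) X(1) sB span_mono by blast
    then have "w \<in> span (set B \<inter> P 0)" using w(2) P0 adapted by blast
    moreover have "X \<inter> (set B \<inter> P 0) = {}" using X(2) P0 by auto
    ultimately show ?thesis using span_Int_disjoint[OF iB X(1), of "set B \<inter> P 0" w] w(1) by auto
  qed
  have ginj: "w = 0" if w: "w \<in> span E" "g w = 0" for w
    using inj0[OF w(1) _ EB] dg[OF w(1)] w(2) ext Eext d.zero by auto
  have g_inj_on: "inj_on g (span E)"
  proof (rule inj_onI)
    fix x y assume "x \<in> span E" "y \<in> span E" "g x = g y"
    then show "x = y" using ginj[of "x - y"] span_diff[of x E y] by (simp add: g.diff)
  qed
  define A where "A = f ` E"
  have Ag: "A = g ` E" using g(2) by (auto simp: A_def)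
  have iA: "independent A" unfolding Ag using g.independent_injective_image[OF iE g_inj_on] .
  define Z where "Z = {y \<in> T'. d y = 0}"
  have sZ: "subspace Z"
    unfolding Z_def using subspace_inter[OF sT' d.subspace_kernel] by (simp add: Collect_conj_eq)
  have sep: "v = 0"
    if v: "v \<in> span (A \<inter> G (Suc l) - G l)" and h: "h \<in> G l" "z \<in> Z" "v = h + z" for l v h z
  proof -
    define X where "X = {x \<in> E. f x \<in> G (Suc l) - G l}"
    have "A \<inter> G (Suc l) - G l = g ` X" unfolding A_def X_def using g(2) by (auto simp: image_iff)
    then obtain w where w: "w \<in> span X" "v = g w" using v g.span_image by auto
    have XE: "X \<subseteq> E" by (auto simp: X_def)
    have wE: "w \<in> span E" using w(1) span_mono[OF XE] by auto
    have "d v = d h" using h by (simp add: d.add Z_def)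
    then have "u w = d h" using dg[OF wE] w(2) by simp
    moreover have "w \<in> T" using wE span_mono[OF EB] sB by auto
    ultimately have "w \<in> span (set B \<inter> P l)" using adapted[of l] h(1) P by blast
    moreover have "X \<inter> (set B \<inter> P l) = {}"
    proof -
      have "x \<notin> P l" if "x \<in> X" for x
      proof
        assume "x \<in> P l"
        then obtain y where "y \<in> G l" "u x = d y" unfolding P by auto
        then have "f x \<in> G l" using f(3) Eext that X_def by auto
        then show False using that X_def by auto
      qed
      then show ?thesis by auto
    qed
    ultimately have "w = 0" using span_Int_disjoint[OF iB _ _ _ w(1), of "set B \<inter> P l"] XE EB by auto
    then show ?thesis using w(2) g.zero by simp
  qed
  obtain N where N: "N \<inter> A = {}" "N \<subseteq> G L" "independent (A \<inter> G L \<union> N)"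
    "\<And>k. k \<le> L \<Longrightarrow> G k \<subseteq> span ((A \<union> N) \<inter> G k)" "Z \<inter> G L \<subseteq> span (N \<inter> Z)"
  proof -
    have "\<exists>N. N \<inter> A = {} \<and> N \<subseteq> G L \<and> independent (A \<inter> G L \<union> N) \<and>
      (\<forall>k\<le>L. G k \<subseteq> span ((A \<union> N) \<inter> G k)) \<and> Z \<inter> G L \<subseteq> span (N \<inter> Z)"
      by (rule adapted_extension[OF G(1-3) sZ iA]) (rule sep)
    then show ?thesis using that by auto
  qed
  have AT: "A \<subseteq> T'" using f(1) Eext by (auto simp: A_def)
  have AN: "independent (A \<union> N)" using N(3) AT G(4) by (simp add: Int_absorb2)
  have ZN: "Z \<subseteq> span (N \<inter> Z)" using N(5) G(4) by (auto simp: Z_def)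
  have NT: "N \<subseteq> T'" using N(2) G(4) by simp
  have "finite N" using NT fin finite_subset by auto
  then obtain ns where ns: "set ns = N" "distinct ns" using finite_distinct_list by auto
  have setAN: "set (map f (filter ext B) @ ns) = A \<union> N"
    using ns by (auto simp: A_def E_def)
  have f_inj: "inj_on f E"
    using inj_on_subset[OF g_inj_on span_superset] g(2) by (simp add: inj_on_def)
  have distAN: "distinct (map f (filter ext B) @ ns)"
    using f_inj N(1) dB ns by (auto simp: distinct_map E_def A_def)
  have spanAN: "span (A \<union> N) = T'"
  proof (rule span_subspace[OF _ _ sT'])
    have "(A \<union> N) \<inter> G L = A \<union> N" using AT NT G(4) by auto
    then show "T' \<subseteq> span (A \<union> N)" using N(4)[of L] G(4) by simp
  qed (use AT NT in auto)
  have Gspan: "G l \<subseteq> span ((A \<union> N) \<inter> G l)" for l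
  proof (cases "l \<le> L")
    case False
    then have "G L \<subseteq> G l" using lift_Suc_mono_le[of G, OF G(2)] by auto
    then have "G l = T'" using G(4,5) by auto
    then show ?thesis using N(4)[of L] G(4) by auto
  qed (rule N(4))
  define B1 where "B1 = set (filter (\<lambda>x. u x \<noteq> 0) B)"
  define N1 where "N1 = set (filter (\<lambda>y. d y \<noteq> 0) ns)"
  have N1: "N1 \<subseteq> N" "N1 \<inter> (N \<inter> Z) = {}" by (auto simp: N1_def ns Z_def)
  have iN: "independent N" by (rule independent_mono[OF AN]) auto
  have u_inj: "inj_on u (span B1)"
  proof (rule inj_onI)
    fix x y assume xy: "x \<in> span B1" "y \<in> span B1" "u x = u y"
    have "x - y = 0"
    proof (rule inj0)
      show "x - y \<in> span B1" using xy by (simp add: span_diff)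
      show "u (x - y) = 0" using xy by (simp add: u.diff)
    qed (auto simp: B1_def)
    then show "x = y" by simp
  qed
  have d_inj: "inj_on d (span N1)"
  proof (rule inj_onI)
    fix x y assume xy: "x \<in> span N1" "y \<in> span N1" "d x = d y"
    then have w: "x - y \<in> span N1" "d (x - y) = 0" using span_diff by (auto simp: d.diff)
    have "x - y \<in> T'" using w(1) span_minimal[of N1 T'] sT' N1(1) NT by blast
    then have "x - y \<in> span (N \<inter> Z)" using ZN w(2) by (auto simp: Z_def)
    then have "x - y = 0" using span_Int_disjoint[OF iN N1(1) _ N1(2) w(1)] by blast
    then show "x = y" by simp
  qed
  have iB1: "independent B1" by (rule independent_mono[OF iB]) (auto simp: B1_def)
  have iN1: "independent N1" by (rule independent_mono[OF iN N1(1)])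
  \<comment> \<open>If \<open>u w = d y\<close>, then adaptedness at level \<open>L\<close>, where
    \<open>G L = T'\<close>, makes \<open>w\<close> a combination of liftable vectors. Subtracting
    its lift from \<open>y\<close> leaves a vector of \<open>Z\<close>, so \<open>y\<close> lies in
    the spans of two disjoint parts of one basis.\<close>
  have meet: "v = 0" if v: "v \<in> span (u ` B1)" "v \<in> span (d ` N1)" for v
  proof -
    obtain w where w: "w \<in> span B1" "v = u w" using v(1) u.span_image by auto
    obtain y where y: "y \<in> span N1" "v = d y" using v(2) d.span_image by auto
    have yT: "y \<in> T'" using y(1) span_minimal[of N1 T'] sT' N1(1) NT by blast
    have "w \<in> T" using w(1) span_mono[of B1 "set B"] sB by (auto simp: B1_def)
    then have "w \<in> P L" unfolding P using w(2) y(2) yT G(4) by (auto intro!: bexI[of _ y])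
    then have "w \<in> span B1 \<inter> span (set B \<inter> P L)" using w(1) adapted by blast
    also have "\<dots> = span (B1 \<inter> (set B \<inter> P L))"
      by (rule span_Int_independent[OF iB]) (auto simp: B1_def)
    also have "B1 \<inter> (set B \<inter> P L) = E"
      using BT by (auto simp: B1_def E_def P ext G(4))
    finally have wE: "w \<in> span E" .
    have gw: "g w \<in> span A" using wE g.span_image Ag by auto
    then have "g w \<in> T'" using span_minimal[OF AT sT'] by auto
    then have "y - g w \<in> Z"
      using yT sT' dg[OF wE] w(2) y(2) by (auto simp: Z_def d.diff subspace_diff)
    then have "y - g w \<in> span (N \<inter> Z)" using ZN by auto
    then have "(y - g w) + g w \<in> span (A \<union> (N \<inter> Z))"
      using gw span_mono[of A "A \<union> (N \<inter> Z)"] span_mono[of "N \<inter> Z" "A \<union> (N \<inter> Z)"]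
      by (intro span_add) auto
    then have "y \<in> span (A \<union> (N \<inter> Z))" by simp
    moreover have "N1 \<inter> (A \<union> (N \<inter> Z)) = {}" using N1 N(1) by auto
    ultimately have "y = 0" using span_Int_disjoint[OF AN _ _ _ y(1), of "A \<union> (N \<inter> Z)"] N1(1) by blast
    then show ?thesis using y(2) by simp
  qed
  have iu: "independent (u ` B1)" using u.independent_injective_image[OF iB1 u_inj] .
  have id: "independent (d ` N1)" using d.independent_injective_image[OF iN1 d_inj] .
  have disj: "u ` B1 \<inter> d ` N1 = {}"
  proof -
    have "v = 0" if "v \<in> u ` B1" "v \<in> d ` N1" for v using meet[of v] that span_base by blast
    moreover have "0 \<notin> u ` B1" using iu dependent_zero by blast
    ultimately show ?thesis unfolding disjoint_iff by metis
  qed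
  show ?thesis
  proof (rule that[of f ns])
    show "basis_list T' (map f (filter ext B) @ ns)"
      unfolding basis_list_def independent_list_def setAN using distAN AN spanAN by simp
    show "G l \<subseteq> span (set (map f (filter ext B) @ ns) \<inter> G l)" for l
      unfolding setAN by (rule Gspan)
    have set_ud: "set (map u (filter (\<lambda>x. u x \<noteq> 0) B) @ map d (filter (\<lambda>y. d y \<noteq> 0) ns)) = u ` B1 \<union> d ` N1"
      unfolding B1_def N1_def by auto
    have "independent (u ` B1 \<union> d ` N1)" using independent_Un[OF iu id meet] .
    moreover have "distinct (map u (filter (\<lambda>x. u x \<noteq> 0) B) @ map d (filter (\<lambda>y. d y \<noteq> 0) ns))"
      using disj inj_on_subset[OF u_inj span_superset] inj_on_subset[OF d_inj span_superset] dB ns(2)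
      unfolding B1_def N1_def by (auto simp: distinct_map)
    ultimately show "independent_list (map u (filter (\<lambda>x. u x \<noteq> 0) B) @ map d (filter (\<lambda>y. d y \<noteq> 0) ns))"
      unfolding independent_list_def set_ud by simp
  qed (use f(2) in auto)
qed

end

section \<open>Zigzags\<close>

text \<open>A list is spread over consecutive degrees, its head in degree \<open>n\<close> and each further entry one
  degree lower; the result is a list of length at most one.\<close>

fun slot :: "int \<Rightarrow> 'c list \<Rightarrow> int \<Rightarrow> 'c list" where
  "slot n [] i = []"
| "slot n (x # xs) i = (if i = n then [x] else slot (n - 1) xs i)"

text \<open>Inside a thread \<open>d x\<close> is \<open>u\<close> of the next entry, so only the
  last entry can contribute a \<open>d\<close>-image of its own.\<close>

fun lowest :: "int \<Rightarrow> 'c list \<Rightarrow> int \<Rightarrow> 'c list" where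
  "lowest n [] i = []"
| "lowest n [x] i = (if i = n then [x] else [])"
| "lowest n (x # y # xs) i = lowest (n - 1) (y # xs) i"

lemma slot_above: "n < i \<Longrightarrow> slot n xs i = []"
  by (induction n xs i rule: slot.induct) auto

lemma lowest_above: "n < i \<Longrightarrow> lowest n xs i = []"
  by (induction n xs i rule: lowest.induct) auto

lemma slot_top: "xs \<noteq> [] \<Longrightarrow> slot n xs n = [hd xs]"
  by (cases xs) auto

lemma set_lowest_subset: "set (lowest n xs i) \<subseteq> set (slot n xs i)"
  by (induction n xs i rule: lowest.induct) (auto simp: lowest_above)

lemma lowest_Cons: "xs \<noteq> [] \<Longrightarrow> lowest (n + 1) (x # xs) i = lowest n xs i"
  by (cases xs) auto

lemma ex_slot: "x \<in> set xs \<Longrightarrow> \<exists>i. x \<in> set (slot n xs i)"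
proof (induction xs arbitrary: n)
  case (Cons y ys)
  show ?case
  proof (cases "x = y")
    case False
    then obtain i where i: "x \<in> set (slot (n - 1) ys i)" using Cons by auto
    then have "i \<noteq> n" using slot_above[of "n - 1" n ys] by auto
    then show ?thesis using i by (intro exI[of _ i]) simp
  qed (auto intro: exI[of _ n])
qed simp

definition level :: "(int \<times> 'c list) list \<Rightarrow> int \<Rightarrow> 'c list" where
  "level ths i = concat (map (\<lambda>th. slot (fst th) (snd th) i) ths)"

definition lowests :: "(int \<times> 'c list) list \<Rightarrow> int \<Rightarrow> 'c list" where
  "lowests ths i = concat (map (\<lambda>th. lowest (fst th) (snd th) i) ths)"

lemma level_simps [simp]:
  "level [] i = []" "level (th # ths) i = slot (fst th) (snd th) i @ level ths i"
  "level (ths @ ths') i = level ths i @ level ths' i"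
  by (auto simp: level_def split: prod.splits)

lemma lowests_simps [simp]:
  "lowests [] i = []" "lowests (th # ths) i = lowest (fst th) (snd th) i @ lowests ths i"
  "lowests (ths @ ths') i = lowests ths i @ lowests ths' i"
  by (auto simp: lowests_def split: prod.splits)

lemma set_lowests_subset: "set (lowests ths i) \<subseteq> set (level ths i)"
  by (induction ths) (use set_lowest_subset in fastforce)+

lemma level_above: "(\<And>m xs. (m, xs) \<in> set ths \<Longrightarrow> m \<le> n) \<Longrightarrow> n < i \<Longrightarrow> level ths i = []"
  unfolding level_def by (force intro!: slot_above)

lemma lowests_above: "(\<And>m xs. (m, xs) \<in> set ths \<Longrightarrow> m \<le> n) \<Longrightarrow> n < i \<Longrightarrow> lowests ths i = []"
  using level_above[of ths n i] set_lowests_subset[of ths i] by simp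

context linear_endo_pair
begin

text \<open>The condition \<open>u y \<noteq> 0\<close> makes every entry below the head give rise
  to a copy of F, so that H can occur only at the ends.\<close>

definition thread :: "'b list \<Rightarrow> bool" where
  "thread xs \<longleftrightarrow> xs \<noteq> [] \<and> successively (\<lambda>x y. d x = u y \<and> u y \<noteq> 0) xs"

text \<open>These are the basis vectors that the threads produce in
  \<open>ker u \<inter> ker d\<close>. A \<open>d\<close>-image inside a thread is already counted
  as the \<open>u\<close>-image of the entry below, hence \<open>lowests\<close> in the second
  part.\<close>

definition link_images :: "(int \<times> 'b list) list \<Rightarrow> int \<Rightarrow> 'b list" where
  "link_images ths k = map u (filter (\<lambda>x. u x \<noteq> 0) (level ths k)) @
     map d (filter (\<lambda>y. d y \<noteq> 0) (lowests ths (k + 1)))"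

definition flag :: "(nat \<Rightarrow> 'b set) \<Rightarrow> 'b set \<Rightarrow> bool" where
  "flag G T \<longleftrightarrow> (\<forall>l. subspace (G l)) \<and> (\<forall>l. G l \<subseteq> G (Suc l)) \<and> G 0 = {0} \<and>
     (\<exists>L. G L = T) \<and> (\<forall>l. G l \<subseteq> T)"

lemma basis_list_zero_space: "basis_list {0} vs \<longleftrightarrow> vs = []"
proof
  assume *: "basis_list {0} vs"
  then have "set vs \<subseteq> {0}" using span_superset[of "set vs"] by (simp add: basis_list_def)
  moreover have "0 \<notin> set vs" using * dependent_zero by (auto simp: basis_list_def independent_list_def)
  ultimately show "vs = []" by (cases vs) auto
qed (simp add: basis_list_def independent_list_def independent_empty)

text \<open>The relation \<open>u x = d y\<close> between \<open>T n\<close> and \<open>T (n + 1)\<close> pulls a flag on \<open>T (n + 1)\<close> back to a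
  flag on \<open>T n\<close>. A basis adapted to the latter can be transported along the relation to vectors that
  extend to a basis adapted to the former, hence the induction needs an arbitrary flag.\<close>

lemma threads_exist:
  fixes T :: "int \<Rightarrow> 'b set"
  assumes T: "\<And>i. subspace (T i)" "\<And>i. finite (T i)" and T0: "\<And>i. i \<le> i0 \<Longrightarrow> T i = {0}"
    and "flag G (T (i0 + int m))"
  shows "\<exists>ths. (\<forall>(k, xs) \<in> set ths. thread xs \<and> k \<le> i0 + int m) \<and>
    (\<forall>k \<le> i0 + int m. basis_list (T k) (level ths k)) \<and>
    (\<forall>k < i0 + int m. independent_list (link_images ths k)) \<and>
    (\<forall>l. G l \<subseteq> span (set (level ths (i0 + int m)) \<inter> G l))"
  using \<open>flag G (T (i0 + int m))\<close>
proof (induction m arbitrary: G)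
  case 0
  then have "G l \<subseteq> {0}" for l by (auto simp: flag_def T0)
  then show ?case
    by (intro exI[of _ "[]"])
      (auto simp: T0 basis_list_zero_space link_images_def independent_list_def independent_empty)
next
  case (Suc m)
  define n where "n = i0 + int m"
  have n1: "i0 + int (Suc m) = n + 1" by (simp add: n_def)
  obtain L where G: "\<And>l. subspace (G l)" "\<And>l. G l \<subseteq> G (Suc l)" "G 0 = {0}" "G L = T (n + 1)"
    "\<And>l. G l \<subseteq> T (n + 1)"
    using Suc.prems unfolding flag_def n1 by auto
  define P where "P l = {x \<in> T n. \<exists>y\<in>G l. u x = d y}" for l
  \<comment> \<open>The pulled-back sets \<open>P 0, ..., P L\<close> are shifted by one and framed:
    \<open>P 0\<close> is the kernel of \<open>u\<close> on \<open>T n\<close> and need not vanish,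
    and \<open>P L\<close> need not exhaust \<open>T n\<close>, whereas a flag runs from
    \<open>{0}\<close> to the whole space.\<close>
  define G' where "G' l = (case l of 0 \<Rightarrow> {0} | Suc k \<Rightarrow> if k \<le> L then P k else T n)" for l
  have sP: "subspace (P l)" for l
  proof (rule subspaceI)
    show "0 \<in> P l" using subspace_0[OF T(1)] subspace_0[OF G(1)] u.zero d.zero
      unfolding P_def by force
    show "x + y \<in> P l" if "x \<in> P l" "y \<in> P l" for x y
      using that subspace_add[OF T(1)] subspace_add[OF G(1)] unfolding P_def
      by simp (metis u.add d.add)
    show "scale c x \<in> P l" if "x \<in> P l" for c x
      using that subspace_scale[OF T(1)] subspace_scale[OF G(1)] unfolding P_def
      by simp (metis u.scale d.scale)
  qed
  have Pmono: "P l \<subseteq> P (Suc l)" for l unfolding P_def using G(2)[of l] by auto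
  have PT: "P l \<subseteq> T n" for l by (auto simp: P_def)
  have "flag G' (T n)"
    unfolding flag_def
  proof (intro conjI allI)
    show "subspace (G' l)" for l using sP T(1) by (auto simp: G'_def split: nat.splits)
    show "G' l \<subseteq> G' (Suc l)" for l
      using Pmono PT sP subspace_0 T(1) by (auto simp: G'_def split: nat.splits)
    show "\<exists>L. G' L = T n" by (intro exI[of _ "Suc (Suc L)"]) (simp add: G'_def)
    show "G' l \<subseteq> T n" for l using PT T(1) subspace_0 by (auto simp: G'_def split: nat.splits)
  qed (simp add: G'_def)
  then obtain ths where ths: "\<And>k xs. (k, xs) \<in> set ths \<Longrightarrow> thread xs \<and> k \<le> n"
    "\<And>k. k \<le> n \<Longrightarrow> basis_list (T k) (level ths k)"
    "\<And>k. k < n \<Longrightarrow> independent_list (link_images ths k)"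
    "\<And>l. G' l \<subseteq> span (set (level ths n) \<inter> G' l)"
    using Suc.IH[of G'] unfolding n_def[symmetric] by fast
  \<comment> \<open>Beyond \<open>L\<close> the flag \<open>G\<close>, and with it \<open>P\<close>,
    is constant, so the finitely many members kept in \<open>G'\<close> suffice.\<close>
  have adapted: "P l \<subseteq> span (set (level ths n) \<inter> P l)" for l
  proof -
    have "P l = P (min l L)"
    proof (cases "l \<le> L")
      case False
      then have "G L \<subseteq> G l" using lift_Suc_mono_le[of G, OF G(2)] by auto
      then have "G l = G L" using G(4,5) by auto
      then show ?thesis using False by (simp add: P_def min_def)
    qed (simp add: min_def)
    moreover have "P (min l L) = G' (Suc (min l L))" by (simp add: G'_def)
    ultimately show ?thesis using ths(4)[of "Suc (min l L)"] by simp
  qed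
  define ext where "ext x \<longleftrightarrow> u x \<noteq> 0 \<and> (\<exists>y\<in>T (n + 1). u x = d y)" for x
  obtain f ns where f: "\<And>x. ext x \<Longrightarrow> d (f x) = u x"
    "basis_list (T (n + 1)) (map f (filter ext (level ths n)) @ ns)"
    "\<And>l. G l \<subseteq> span (set (map f (filter ext (level ths n)) @ ns) \<inter> G l)"
    "independent_list (map u (filter (\<lambda>x. u x \<noteq> 0) (level ths n)) @ map d (filter (\<lambda>y. d y \<noteq> 0) ns))"
    by (rule extend_level[OF G T(2) ths(2)[OF order_refl] P_def adapted ext_def]) (rule that)
  \<comment> \<open>Threads whose head sits in degree \<open>n\<close> and has a partner get the
    lift put in front; the vectors \<open>ns\<close> start threads of their own.\<close>
  define grow where
    "grow th = (if fst th = n \<and> ext (hd (snd th)) then (n + 1, f (hd (snd th)) # snd th) else th)" for th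
  define new where "new = map (\<lambda>y. (n + 1, [y])) ns"
  have ne: "xs \<noteq> []" if "(k, xs) \<in> set ths" for k xs using ths(1)[OF that] by (simp add: thread_def)
  have le: "k \<le> n" if "(k, xs) \<in> set ths" for k xs using ths(1)[OF that] by simp
  have old_th: "slot (fst (grow th)) (snd (grow th)) k = slot (fst th) (snd th) k"
    "lowest (fst (grow th)) (snd (grow th)) k = lowest (fst th) (snd th) k"
    if "k \<le> n" "th \<in> set ths" for k th
    using that ne[of "fst th" "snd th"] by (auto simp: grow_def[of th] lowest_Cons)
  have old: "level (map grow ths) k = level ths k" "lowests (map grow ths) k = lowests ths k"
    if k: "k \<le> n" for k
    using old_th[OF k] by (simp_all add: level_def lowests_def o_def cong: map_cong)
  \<comment> \<open>Prepending does not move the last entry of a thread, so the lowest entries in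
    degree \<open>n + 1\<close> are exactly the new vectors \<open>ns\<close>.\<close>
  have bot: "lowests (map grow ths) (n + 1) = []"
    using ne le
  proof (induction ths)
    case (Cons th ths)
    have "lowests (map grow ths) (n + 1) = []" using Cons by auto
    moreover have "snd th \<noteq> []" "fst th \<le> n" using Cons(2,3)[of "fst th" "snd th"] by auto
    ultimately show ?case by (auto simp: grow_def[of th] lowest_Cons lowest_above)
  qed simp
  have top: "level (map grow ths) (n + 1) = map f (filter ext (level ths n))"
    using ne le
  proof (induction ths)
    case (Cons th ths)
    obtain k xs where th: "th = (k, xs)" by (cases th)
    have IH: "level (map grow ths) (n + 1) = map f (filter ext (level ths n))"
      using Cons by auto
    have xs: "xs \<noteq> []" "k \<le> n" using Cons(2,3) th by auto
    show ?case
    proof (cases "k = n")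
      case True
      then show ?thesis using IH xs by (auto simp: th grow_def[of "(n, xs)"] slot_top slot_above)
    next
      case False
      then have "slot k xs n = []" "slot k xs (n + 1) = []" using xs(2) by (auto intro: slot_above)
      then show ?thesis using IH False by (auto simp: th grow_def[of "(k, xs)"])
    qed
  qed simp
  have new: "level new k = (if k = n + 1 then ns else [])" "lowests new k = (if k = n + 1 then ns else [])" for k
    unfolding new_def by (induction ns) auto
  define ths' where "ths' = map grow ths @ new"
  have lev: "level ths' k = level ths k" if "k \<le> n" for k
    using that by (simp add: ths'_def old new)
  have levtop: "level ths' (n + 1) = map f (filter ext (level ths n)) @ ns"
    by (simp add: ths'_def top new)
  have links: "link_images ths' k = link_images ths k" if "k < n" for k
    using that by (simp add: link_images_def lev ths'_def old new)
  have linkstop: "link_images ths' n =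
      map u (filter (\<lambda>x. u x \<noteq> 0) (level ths n)) @ map d (filter (\<lambda>y. d y \<noteq> 0) ns)"
    by (simp add: link_images_def lev ths'_def old new bot)
  show ?case
    unfolding n1
  proof (intro exI[of _ ths'] conjI allI impI ballI)
    fix th assume "th \<in> set ths'"
    then consider th0 where "th0 \<in> set ths" "th = grow th0" | y where "th = (n + 1, [y])"
      unfolding ths'_def new_def by auto
    then show "case th of (k, xs) \<Rightarrow> thread xs \<and> k \<le> n + 1"
    proof cases
      case 1
      obtain k xs where th0: "th0 = (k, xs)" by (cases th0)
      then have "thread xs" "k \<le> n" using ths(1) 1 by auto
      then show ?thesis
        using f(1)[of "hd xs"] unfolding 1(2) th0 grow_def
        by (cases xs) (auto simp: thread_def ext_def)
    qed (simp add: thread_def)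
  next
    fix k assume "k \<le> n + 1"
    then show "basis_list (T k) (level ths' k)"
      using ths(2) lev levtop f(2) by (cases "k = n + 1") auto
  next
    fix k assume "k < n + 1"
    then show "independent_list (link_images ths' k)"
      using ths(3) links linkstop f(4) by (cases "k = n") auto
  next
    fix l show "G l \<subseteq> span (set (level ths' (n + 1)) \<inter> G l)" unfolding levtop by (rule f(3))
  qed
qed

end

section \<open>Generators of strips, and threads turned into strips\<close>

datatype 'c gen = GF 'c | GH 'c

primrec gval :: "'c gen \<Rightarrow> 'c" where
  "gval (GF x) = x"
| "gval (GH y) = y"

primrec is_GF :: "'c gen \<Rightarrow> bool" where
  "is_GF (GF x) = True"
| "is_GF (GH y) = False"

text \<open>\<open>a\<close> and \<open>b\<close> record an H at the top and at the bottom. Neither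
  gives \<open>A\<^sub>k\<^sub>-\<^sub>1\<close>, only the top one \<open>H(-k)\<close>, only the
  bottom one \<open>H(k)\<close>, and both give \<open>B\<^sub>k\<^sub>-\<^sub>1\<close>, or
  \<open>D(H)\<close> when \<open>k = 0\<close>.\<close>

definition strip_shape :: "'c gen list \<Rightarrow> bool" where
  "strip_shape gs \<longleftrightarrow> gs \<noteq> [] \<and> (\<exists>a b k. map is_GF gs =
     (if a then [False] else []) @ replicate k True @ (if b then [False] else []))"

context linear_endo_pair
begin

primrec gvecs :: "'b gen \<Rightarrow> 'b list" where
  "gvecs (GF x) = [x, u x]"
| "gvecs (GH y) = [y]"

text \<open>The vector spanning the image of the map \<open>mup\<close> of the copy of F or H: each
  of the maps \<open>u\<close>, \<open>p\<close> and the identity of H sends the generator of its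
  source there.\<close>

primrec gtarget :: "'b gen \<Rightarrow> 'b" where
  "gtarget (GF x) = u x"
| "gtarget (GH y) = y"

definition zigzag :: "'b gen list \<Rightarrow> bool" where
  "zigzag gs \<longleftrightarrow> strip_shape gs \<and> (\<forall>y. GH y \<in> set gs \<longrightarrow> u y = 0) \<and>
     successively (\<lambda>g g'. d (gval g) = gtarget g') gs \<and> d (gval (last gs)) = 0"

text \<open>Generator goes to generator here, whereas in a zigzag \<open>d\<close> of a generator
  would be \<open>u\<close> of a following F.\<close>

definition square :: "'b gen list \<Rightarrow> bool" where
  "square gs \<longleftrightarrow> (\<exists>x. gs = [GF x, GF (d x)] \<and> d (d x) = 0)"

text \<open>On a thread only the head can satisfy \<open>u x = 0\<close>, which gives an H at the
  top. A nonzero \<open>d\<close>-image of the last entry becomes the H at the bottom.\<close>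

definition gens :: "'b list \<Rightarrow> 'b gen list" where
  "gens xs = map (\<lambda>x. if u x = 0 then GH x else GF x) xs @
     (if d (last xs) \<noteq> 0 then [GH (d (last xs))] else [])"

lemma gens_Cons: "xs \<noteq> [] \<Longrightarrow> gens (x # xs) = (if u x = 0 then GH x else GF x) # gens xs"
  by (simp add: gens_def)

lemma zigzag_gens:
  assumes "thread xs" and 0: "\<And>x. x \<in> set xs \<Longrightarrow> u (d x) = 0 \<and> d (d x) = 0"
  shows "zigzag (gens xs)"
proof -
  obtain x ys where xs: "xs = x # ys" using assms(1) by (cases xs) (auto simp: thread_def)
  have uys: "u y \<noteq> 0" if "y \<in> set ys" for y
    using assms(1) that unfolding xs thread_def
    by (induction ys arbitrary: x) auto
  have "strip_shape (gens xs)"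
    unfolding strip_shape_def
  proof (intro conjI exI)
    have ys: "map (is_GF \<circ> (\<lambda>x. if u x = 0 then GH x else GF x)) ys = replicate (length ys) True"
      using uys by (intro replicate_eqI) (auto simp: o_def)
    show "map is_GF (gens xs) = (if u x = 0 then [False] else []) @
      replicate (length ys + (if u x = 0 then 0 else 1)) True @ (if d (last xs) \<noteq> 0 then [False] else [])"
      using ys by (simp add: gens_def xs)
  qed (simp add: gens_def xs)
  moreover have "successively (\<lambda>g g'. d (gval g) = gtarget g') (gens xs)"
    using assms(1)
  proof (induction xs)
    case (Cons x xs)
    show ?case
    proof (cases xs)
      case (Cons y zs)
      then have "thread xs" "d x = u y" "u y \<noteq> 0" using Cons.prems by (auto simp: thread_def)
      moreover obtain hs where hs: "gens xs = GF y # hs" using \<open>u y \<noteq> 0\<close> Cons by (simp add: gens_def)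
      ultimately have "successively (\<lambda>g g'. d (gval g) = gtarget g') (GF y # hs)" using Cons.IH by simp
      moreover have "gens (x # xs) = (if u x = 0 then GH x else GF x) # GF y # hs"
        using gens_Cons[of xs x] Cons hs by simp
      ultimately show ?thesis using \<open>d x = u y\<close> by simp
    qed (auto simp: gens_def)
  qed (simp add: thread_def)
  moreover have "u y = 0" if "GH y \<in> set (gens xs)" for y
    using that 0[of "last xs"] xs by (auto simp: gens_def split: if_splits)
  moreover have "d (gval (last (gens xs))) = 0"
    using 0[of "last xs"] xs by (auto simp: gens_def last_map)
  ultimately show ?thesis by (auto simp: zigzag_def)
qed

text \<open>Multisets, because the generators interleave \<open>x\<close> with \<open>u x\<close>.
  The index \<open>i + 1\<close> appears because the final H lies one degree below the entry it
  comes from.\<close>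

lemma slot_gens:
  "xs \<noteq> [] \<Longrightarrow> mset (concat (map gvecs (slot n (gens xs) i))) =
    mset (slot n xs i) + mset (map u (filter (\<lambda>x. u x \<noteq> 0) (slot n xs i))) +
    mset (map d (filter (\<lambda>y. d y \<noteq> 0) (lowest n xs (i + 1))))"
proof (induction n xs i rule: lowest.induct)
  case (2 n x i)
  then show ?case by (auto simp: gens_def)
next
  case (3 n x y xs i)
  then show ?case by (auto simp: gens_Cons lowest_above)
qed simp

lemma level_gens:
  "(\<And>th. th \<in> set ths \<Longrightarrow> snd th \<noteq> []) \<Longrightarrow>
   mset (concat (map gvecs (level (map (\<lambda>th. (fst th, gens (snd th))) ths) i))) =
    mset (level ths i) + mset (link_images ths i)"
proof (induction ths)
  case (Cons th ths)
  then show ?case using slot_gens[of "snd th" "fst th" i] by (simp add: link_images_def)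
qed (simp add: link_images_def)

lemma level_singletons:
  "distinct js \<Longrightarrow> level (concat (map (\<lambda>j. map (\<lambda>z. (j, [h z])) (zs j)) js)) i =
    (if i \<in> set js then map h (zs i) else [])"
proof (induction js)
  case (Cons j js)
  have "level (map (\<lambda>z. (j, [h z])) ws) i = (if i = j then map h ws else [])" for ws
    by (induction ws) auto
  then show ?case using Cons by auto
qed simp

lemma basis_list_append:
  assumes "basis_list S vs" "basis_list T ws" "subspace V" "S \<subseteq> V" "T \<subseteq> V"
    and "\<And>x. x \<in> S \<Longrightarrow> x \<in> T \<Longrightarrow> x = 0"
    and "\<And>x. x \<in> V \<Longrightarrow> \<exists>s\<in>S. \<exists>t\<in>T. x = s + t"
  shows "basis_list V (vs @ ws)"
proof -
  have s: "span (set vs) = S" "span (set ws) = T" and i: "independent (set vs)" "independent (set ws)"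
    and "distinct vs" "distinct ws"
    using assms(1,2) by (auto simp: basis_list_def independent_list_def)
  have "independent (set vs \<union> set ws)" using independent_Un[OF i] s assms(6) by auto
  moreover have "set vs \<inter> set ws = {}"
  proof -
    have "x = 0" if "x \<in> set vs" "x \<in> set ws" for x
      using assms(6)[of x] that s span_base by blast
    then show ?thesis using i(1) dependent_zero unfolding disjoint_iff by metis
  qed
  moreover have "span (set vs \<union> set ws) = V"
  proof
    show "span (set vs \<union> set ws) \<subseteq> V"
      using s span_superset assms(3-5) by (intro span_minimal) auto
    show "V \<subseteq> span (set vs \<union> set ws)" using assms(7) unfolding span_Un s by blast
  qed
  ultimately show ?thesis using \<open>distinct vs\<close> \<open>distinct ws\<close>
    by (auto simp: basis_list_def independent_list_def)
qed

lemma extend_independent_list: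
  assumes "independent_list vs" "set vs \<subseteq> T" "subspace T" "finite T"
  obtains ws where "basis_list T (vs @ ws)"
proof -
  obtain Y where Y: "set vs \<inter> Y = {}" "Y \<subseteq> T" "independent (set vs \<union> Y)" "span (set vs \<union> Y) = T"
    using extend_to_basis[of "set vs" T] assms by (auto simp: independent_list_def)
  have "finite Y" using Y(2) assms(4) finite_subset by auto
  then obtain ws where "set ws = Y" "distinct ws" using finite_distinct_list by auto
  then show ?thesis using that[of ws] Y assms(1) by (auto simp: basis_list_def independent_list_def)
qed

text \<open>Finiteness of the sets plays the part of finite dimension over the field with two
  elements, and it lets cardinality serve as an induction measure.\<close>

definition bicomplex :: "nat \<Rightarrow> (int \<Rightarrow> 'b set) \<Rightarrow> bool" where
  "bicomplex N V \<longleftrightarrow> (\<forall>i. subspace (V i) \<and> finite (V i) \<and> (int N < \<bar>i\<bar> \<longrightarrow> V i = {0}) \<and>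
     (\<forall>x \<in> V i. u x \<in> V i \<and> d x \<in> V (i - 1) \<and> u (u x) = 0 \<and> d (d x) = 0 \<and> u (d x) = d (u x)))"

lemma bicomplexD:
  assumes "bicomplex N V"
  shows "subspace (V i)" "finite (V i)" "int N < \<bar>i\<bar> \<Longrightarrow> V i = {0}"
    "x \<in> V i \<Longrightarrow> u x \<in> V i" "x \<in> V i \<Longrightarrow> d x \<in> V (i - 1)"
    "x \<in> V i \<Longrightarrow> u (u x) = 0" "x \<in> V i \<Longrightarrow> d (d x) = 0" "x \<in> V i \<Longrightarrow> u (d x) = d (u x)"
  using assms by (simp_all add: bicomplex_def)

text \<open>A basis of \<open>V i\<close> is assembled from three pieces: thread entries form a
  basis of a complement \<open>T i\<close> of \<open>K i\<close>, link images are independent in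
  \<open>K i\<close>, and the vectors completing them to a basis of \<open>K i\<close> are isolated
  copies of H.\<close>

lemma zigzag_decomposition:
  assumes "bicomplex N V" and ud: "\<And>i x. x \<in> V i \<Longrightarrow> u (d x) = 0"
  shows "\<exists>ss. (\<forall>s \<in> set ss. zigzag (snd s)) \<and> (\<forall>i. basis_list (V i) (concat (map gvecs (level ss i))))"
proof -
  note V = bicomplexD(1-3)[OF assms(1)] and Vud = bicomplexD(4-7)[OF assms(1)]
  have du: "d (u x) = 0" if "x \<in> V i" for i x using bicomplexD(8)[OF assms(1) that] ud[OF that] by simp
  define K where "K i = {x \<in> V i. u x = 0 \<and> d x = 0}" for i
  have sK: "subspace (K i)" for i
    using subspace_inter[OF V(1)[of i] subspace_inter[OF u.subspace_kernel d.subspace_kernel]]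
    by (simp add: K_def Collect_conj_eq)
  have KV: "K i \<subseteq> V i" for i by (auto simp: K_def)
  have "\<exists>T. subspace T \<and> T \<subseteq> V i \<and> (\<forall>x \<in> T. x \<in> K i \<longrightarrow> x = 0) \<and>
      (\<forall>x \<in> V i. \<exists>s\<in>T. \<exists>t\<in>K i. x = s + t)" for i
  proof -
    obtain X where X: "X \<subseteq> K i" "independent X" "span X = K i"
      using extend_to_basis[OF independent_empty empty_subsetI sK[of i]] by (metis Un_empty_left)
    obtain Y where Y: "X \<inter> Y = {}" "Y \<subseteq> V i" "independent (X \<union> Y)" "span (X \<union> Y) = V i"
      using extend_to_basis[OF X(2) subset_trans[OF X(1) KV] V(1)] by metis
    show ?thesis
    proof (intro exI[of _ "span Y"] conjI ballI impI)
      show "span Y \<subseteq> V i" using Y(2) V(1) by (rule span_minimal)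
      show "x = 0" if "x \<in> span Y" "x \<in> K i" for x
        using span_Int_disjoint[OF Y(3) _ _ Y(1)] that X(3) by auto
      show "\<exists>s\<in>span Y. \<exists>t\<in>K i. x = s + t" if "x \<in> V i" for x
        using that unfolding Y(4)[symmetric] span_Un X(3) using add.commute by blast
    qed (rule subspace_span)
  qed
  then obtain T where T: "\<And>i. subspace (T i)" "\<And>i. T i \<subseteq> V i" "\<And>i x. x \<in> T i \<Longrightarrow> x \<in> K i \<Longrightarrow> x = 0"
    "\<And>i x. x \<in> V i \<Longrightarrow> \<exists>s\<in>T i. \<exists>t\<in>K i. x = s + t"
    by metis
  have fT: "finite (T i)" for i using T(2) V(2) finite_subset by blast
  have T0: "T i = {0}" if "int N < \<bar>i\<bar>" for i
    using T(2)[of i] V(3)[OF that] subspace_0[OF T(1)[of i]] by auto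
  \<comment> \<open>\<open>N + 1\<close> is the first degree outside the support on either side. The
    induction thus starts at \<open>T (- M) = {0}\<close> and ends \<open>2 * N + 2\<close> degrees
    higher at \<open>T M = {0}\<close>, where the choice of flag is immaterial.\<close>
  define M where "M = int N + 1"
  have M: "- M + int (2 * N + 2) = M" by (simp add: M_def)
  have T0': "T i = {0}" if "i \<le> - M" for i using T0[of i] that by (simp add: M_def)
  have "flag (\<lambda>l. if l = 0 then {0} else T M) (T (- M + int (2 * N + 2)))"
    unfolding M flag_def using T(1) subspace_0 by (auto intro: exI[of _ 1])
  then obtain ths where ths: "\<And>k xs. (k, xs) \<in> set ths \<Longrightarrow> thread xs \<and> k \<le> M"
    "\<And>k. k \<le> M \<Longrightarrow> basis_list (T k) (level ths k)"
    "\<And>k. k < M \<Longrightarrow> independent_list (link_images ths k)"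
    using threads_exist[of T "- M" _ "2 * N + 2", OF T(1) fT T0'] unfolding M by fast
  have lev: "basis_list (T k) (level ths k)" for k
  proof (cases "k \<le> M")
    case False
    then have "level ths k = []" using level_above[of ths M k] ths(1) by force
    then show ?thesis using False T0[of k] by (simp add: basis_list_zero_space M_def)
  qed (rule ths(2))
  have levT: "x \<in> T k" if "x \<in> set (level ths k)" for x k
    using lev[of k] that span_base by (auto simp: basis_list_def)
  have link: "independent_list (link_images ths k)" for k
  proof (cases "k < M")
    case False
    have "level ths k = []" using lev[of k] T0[of k] False by (simp add: basis_list_zero_space M_def)
    moreover have "lowests ths (k + 1) = []" using lowests_above[of ths M "k + 1"] ths(1) False by force
    ultimately show ?thesis by (simp add: link_images_def independent_list_def independent_empty)
  qed (rule ths(3))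
  have linkK: "set (link_images ths k) \<subseteq> K k" for k
  proof -
    have "u x \<in> K k" if "x \<in> set (level ths k)" for x
      using levT[OF that] T(2) Vud[of x k] du[of x k] by (auto simp: K_def)
    moreover have "d x \<in> K k" if "x \<in> set (lowests ths (k + 1))" for x
      using levT[of x "k + 1"] that set_lowests_subset[of ths "k + 1"] T(2)[of "k + 1"]
        Vud[of x "k + 1"] ud[of x "k + 1"] by (auto simp: K_def)
    ultimately show ?thesis by (auto simp: link_images_def)
  qed
  have "\<exists>zs. basis_list (K k) (link_images ths k @ zs)" for k
    using extend_independent_list[OF link linkK sK] V(2) KV finite_subset by metis
  then obtain zs where zs: "\<And>k. basis_list (K k) (link_images ths k @ zs k)" by metis
  define ss where "ss = map (\<lambda>th. (fst th, gens (snd th))) ths @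
    concat (map (\<lambda>j. map (\<lambda>z. (j, [GH z])) (zs j)) [- M..M])"
  show ?thesis
  proof (intro exI[of _ ss] conjI ballI allI)
    fix s assume "s \<in> set ss"
    then consider k xs where "(k, xs) \<in> set ths" "snd s = gens xs" | j z where "z \<in> set (zs j)" "snd s = [GH z]"
      unfolding ss_def by auto
    then show "zigzag (snd s)"
    proof cases
      case 1
      have "u (d x) = 0 \<and> d (d x) = 0" if x: "x \<in> set xs" for x
      proof -
        obtain i where "x \<in> set (slot k xs i)" using ex_slot[OF x, of k] by blast
        then have "x \<in> set (level ths i)" using 1(1) by (force simp: level_def)
        then have "x \<in> V i" using levT T(2) by auto
        then show ?thesis using ud Vud by auto
      qed
      then show ?thesis using 1 ths(1) zigzag_gens by auto
    next
      case 2
      have "z \<in> span (set (link_images ths j @ zs j))" using 2(1) by (intro span_base) auto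
      then have z: "u z = 0" "d z = 0" using zs[of j] unfolding basis_list_def K_def by auto
      have "strip_shape [GH z]"
        unfolding strip_shape_def by (intro conjI exI[of _ True] exI[of _ False] exI[of _ 0]) auto
      then show ?thesis unfolding 2(2) zigzag_def using z by simp
    qed
  next
    fix i
    have ne: "snd th \<noteq> []" if "th \<in> set ths" for th
      using ths(1)[of "fst th" "snd th"] that by (simp add: thread_def)
    have "zs i = []" if "i \<notin> {- M..M}"
    proof -
      have "K i = {0}" using V(3)[of i] KV[of i] subspace_0[OF sK[of i]] that by (auto simp: M_def)
      then show ?thesis using zs[of i] by (simp add: basis_list_zero_space)
    qed
    then have "level ss i = level (map (\<lambda>th. (fst th, gens (snd th))) ths) i @ map GH (zs i)"
      unfolding ss_def level_simps(3) level_singletons[OF distinct_upto] by auto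
    then have "mset (concat (map gvecs (level ss i))) = mset (level ths i @ (link_images ths i @ zs i))"
      using level_gens[of ths i] ne by (simp add: o_def)
    moreover have "basis_list (V i) (level ths i @ (link_images ths i @ zs i))"
      by (rule basis_list_append[OF lev zs V(1) T(2) KV T(3,4)])
    ultimately show "basis_list (V i) (concat (map gvecs (level ss i)))"
      using basis_list_mset_cong by blast
  qed
qed

end

section \<open>Squares\<close>

context linear_endo_pair
begin

text \<open>The functionals are only triangular against \<open>e1\<close> and \<open>e2\<close>, as
  \<open>q e1\<close> is arbitrary; a vector is therefore reduced by \<open>e1\<close> first and by
  \<open>e2\<close> afterwards.\<close>

lemma basis_list_split2:
  assumes V: "subspace V" "e1 \<in> V" "e2 \<in> V"
    and p: "Vector_Spaces.linear scale (*) p" and q: "Vector_Spaces.linear scale (*) q"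
    and pq: "p e1 = 1" "p e2 = 0" "q e2 = 1"
    and B: "basis_list {z \<in> V. p z = 0 \<and> q z = 0} vs"
  shows "basis_list V (e1 # e2 # vs)"
proof -
  interpret p: Vector_Spaces.linear scale "(*)" p by (rule p)
  interpret q: Vector_Spaces.linear scale "(*)" q by (rule q)
  have sp: "span (set vs) = {z \<in> V. p z = 0 \<and> q z = 0}" and "distinct vs" "independent (set vs)"
    using B by (auto simp: basis_list_def independent_list_def)
  have e2: "e2 \<notin> span (set vs)" using sp pq by simp
  have e1: "e1 \<notin> span (insert e2 (set vs))"
    unfolding span_insert sp using pq by (simp add: p.diff p.scale)
  have "independent (insert e1 (insert e2 (set vs)))"
    using e1 e2 \<open>independent (set vs)\<close> by (simp add: independent_insertI)
  moreover have "distinct (e1 # e2 # vs)"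
    using \<open>distinct vs\<close> e1 e2 span_base[of e1 "insert e2 (set vs)"] span_base[of e2 "set vs"] by auto
  moreover have "span (insert e1 (insert e2 (set vs))) = V"
  proof (rule span_subspace[OF _ _ V(1)])
    show "insert e1 (insert e2 (set vs)) \<subseteq> V" using V sp span_superset[of "set vs"] by auto
    show "V \<subseteq> span (insert e1 (insert e2 (set vs)))"
    proof
      fix z assume z: "z \<in> V"
      define y where "y = z - scale (p z) e1"
      have y: "y \<in> V" "p y = 0" using z V pq by (auto simp: y_def subspace_diff subspace_scale p.diff p.scale)
      have "y - scale (q y) e2 \<in> span (set vs)"
        unfolding sp using y V pq by (auto simp: subspace_diff subspace_scale p.diff p.scale q.diff q.scale)
      then have "y \<in> span (insert e2 (set vs))" unfolding span_insert[of e2] by blast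
      then show "z \<in> span (insert e1 (insert e2 (set vs)))" unfolding span_insert[of e1] y_def by blast
    qed
  qed
  ultimately show ?thesis by (simp add: basis_list_def independent_list_def)
qed

text \<open>The exterior algebra on \<open>u\<close> and \<open>d\<close> is self-injective, so a free submodule splits off: a
  functional that is nonzero on its socle determines a complement.\<close>

lemma split_square:
  assumes V: "bicomplex N V" and x: "x \<in> V i" "u (d x) \<noteq> 0"
  obtains V' where "bicomplex N V'" "\<And>j. V' j \<subseteq> V j" "x \<notin> V' i"
    "\<And>j vs. basis_list (V' j) vs \<Longrightarrow> basis_list (V j) (concat (map gvecs (slot i [GF x, GF (d x)] j)) @ vs)"
proof -
  note Vs = bicomplexD[OF V]
  interpret func: vector_space_pair scale "(*)" by unfold_locales (auto simp: algebra_simps)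
  obtain f where f: "Vector_Spaces.linear scale (*) f" "f (u (d x)) = 1"
    using func.linear_independent_extend[of "{u (d x)}" "\<lambda>_. 1"] x(2) by auto
  interpret f: Vector_Spaces.linear scale "(*)" f by (rule f(1))
  have lin: "Vector_Spaces.linear scale (*) (\<lambda>z. f (u z))" "Vector_Spaces.linear scale (*) (\<lambda>z. f (d z))"
    "Vector_Spaces.linear scale (*) (\<lambda>z. f (u (d z)))"
    using Vector_Spaces.linear_compose[OF linear_u f(1)] Vector_Spaces.linear_compose[OF linear_d f(1)]
      Vector_Spaces.linear_compose[OF linear_d Vector_Spaces.linear_compose[OF linear_u f(1)]]
    by (simp_all add: o_def)
  \<comment> \<open>The largest subobject on whose part in degree \<open>i - 1\<close> the
    functional \<open>f\<close> vanishes: stability under \<open>u\<close> and \<open>d\<close> adds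
    the conditions on \<open>f (u z)\<close>, \<open>f (d z)\<close> and \<open>f (u (d z))\<close>.
    These pair triangularly with the basis of the square, since
    \<open>f (u (d x)) = 1\<close>.\<close>
  define V' where "V' j = (if j = i then {z \<in> V j. f (u (d z)) = 0 \<and> f (d z) = 0}
     else if j = i - 1 then {z \<in> V j. f (u z) = 0 \<and> f z = 0} else V j)" for j
  have sub: "V' j \<subseteq> V j" for j by (auto simp: V'_def)
  have "subspace (V' j)" for j
  proof -
    have "subspace {z \<in> V j. p z = 0 \<and> q z = 0}"
      if "Vector_Spaces.linear scale (*) p" "Vector_Spaces.linear scale (*) q" for p q
      using subspace_inter[OF Vs(1)[of j] subspace_inter[OF func.linear_subspace_kernel[OF that(1)]
            func.linear_subspace_kernel[OF that(2)]]]
      by (simp add: Collect_conj_eq)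
    from this[OF lin(3,2)] this[OF lin(1) f(1)] show ?thesis using Vs(1)[of j] by (cases "j = i"; cases "j = i - 1") (simp_all add: V'_def)
  qed
  moreover have "finite (V' j)" for j using sub Vs(2) finite_subset by blast
  moreover have "V' j = {0}" if "int N < \<bar>j\<bar>" for j
    using sub[of j] Vs(3)[OF that] subspace_0[OF \<open>subspace (V' j)\<close>] by auto
  moreover have "u z \<in> V' j" if z: "z \<in> V' j" for z j
  proof -
    have zV: "z \<in> V j" using z sub by blast
    have "d (u z) = u (d z)" "u (u z) = 0" "u (u (d z)) = 0"
      using Vs(6,8)[OF zV] Vs(6)[OF Vs(5)[OF zV]] by auto
    then show ?thesis using z Vs(4)[OF zV] by (simp add: V'_def split: if_splits)
  qed
  moreover have "d z \<in> V' (j - 1)" if z: "z \<in> V' j" for z j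
  proof -
    have zV: "z \<in> V j" using z sub by blast
    then show ?thesis
      using z Vs(5)[OF zV] Vs(7)[OF zV] by (auto simp: V'_def split: if_splits)
  qed
  ultimately have "bicomplex N V'"
    using Vs(6-8) sub unfolding bicomplex_def by blast
  moreover have "x \<notin> V' i" using f(2) by (simp add: V'_def)
  moreover have "basis_list (V j) (concat (map gvecs (slot i [GF x, GF (d x)] j)) @ vs)"
    if vs: "basis_list (V' j) vs" for j vs
  proof -
    have dx: "d x \<in> V (i - 1)" "u x \<in> V i" "u (d x) \<in> V (i - 1)" using Vs(4,5)[OF x(1)] Vs(4) by auto
    have x0: "u (d (u x)) = 0" "d (u x) = u (d x)" "u (u (d x)) = 0"
      using Vs(6,8)[OF x(1)] Vs(6)[OF dx(1)] by auto
    consider "j = i" | "j = i - 1" | "j \<noteq> i" "j \<noteq> i - 1" by blast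
    then show ?thesis
    proof cases
      case 1
      then have "basis_list (V i) (x # u x # vs)"
        using vs x0 f(2) by (intro basis_list_split2[OF Vs(1) x(1) dx(2) lin(3) lin(2)]) (auto simp: V'_def)
      then show ?thesis using 1 by simp
    next
      case 2
      then have "basis_list (V (i - 1)) (d x # u (d x) # vs)"
        using vs x0 f(2) by (intro basis_list_split2[OF Vs(1) dx(1,3) lin(1) f(1)]) (auto simp: V'_def)
      then show ?thesis using 2 by simp
    next
      case 3
      then show ?thesis using vs by (simp add: V'_def)
    qed
  qed
  ultimately show ?thesis using that sub by blast
qed

text \<open>Squares are split off until \<open>u d = 0\<close>. The number of vectors in degrees
  \<open>- N\<close> to \<open>N\<close> decreases each time, because the generator \<open>x\<close>
  of the square does not survive in the complement.\<close>

theorem bicomplex_decomposition: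
  assumes "bicomplex N V"
  shows "\<exists>ss. (\<forall>s \<in> set ss. zigzag (snd s) \<or> square (snd s)) \<and>
    (\<forall>i. basis_list (V i) (concat (map gvecs (level ss i))))"
  using assms
proof (induction "\<Sum>j = - int N..int N. card (V j)" arbitrary: V rule: less_induct)
  case less
  note Vs = bicomplexD[OF less.prems]
  show ?case
  proof (cases "\<exists>i. \<exists>x\<in>V i. u (d x) \<noteq> 0")
    case False
    then have "\<exists>ss. (\<forall>s \<in> set ss. zigzag (snd s)) \<and>
        (\<forall>i. basis_list (V i) (concat (map gvecs (level ss i))))"
      by (intro zigzag_decomposition[OF less.prems]) blast
    then show ?thesis by blast
  next
    case True
    then obtain i x where x: "x \<in> V i" "u (d x) \<noteq> 0" by auto
    obtain V' where V': "bicomplex N V'" "\<And>j. V' j \<subseteq> V j" "x \<notin> V' i"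
      "\<And>j vs. basis_list (V' j) vs \<Longrightarrow>
        basis_list (V j) (concat (map gvecs (slot i [GF x, GF (d x)] j)) @ vs)"
      by (rule split_square[OF less.prems x]) (rule that)
    have "i \<in> {- int N..int N}"
    proof (rule ccontr)
      assume "i \<notin> {- int N..int N}"
      then have "x = 0" using Vs(3)[of i] x(1) by auto
      then show False using x(2) by simp
    qed
    moreover have "card (V' i) < card (V i)"
      using V'(2,3) x(1) Vs(2) by (intro psubset_card_mono) auto
    moreover have "card (V' j) \<le> card (V j)" for j using V'(2) Vs(2) by (intro card_mono)
    ultimately have "(\<Sum>j = - int N..int N. card (V' j)) < (\<Sum>j = - int N..int N. card (V j))"
      by (intro sum_strict_mono_ex1) auto
    from less.hyps[OF this V'(1)] obtain ss where
      ss: "\<forall>s \<in> set ss. zigzag (snd s) \<or> square (snd s)"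
        "\<And>i. basis_list (V' i) (concat (map gvecs (level ss i)))"
      by blast
    have "square [GF x, GF (d x)]" using Vs(7)[OF x(1)] by (simp add: square_def)
    then show ?thesis
      using ss(1) V'(4)[OF ss(2)] by (intro exI[of _ "(i, [GF x, GF (d x)]) # ss"]) auto
  qed
qed

text \<open>Used to pass from \<open>x, u x\<close> to \<open>x, x + u x\<close>, which in
  characteristic 2 is \<open>x, t x\<close>: the former suits the linear algebra, the latter is the
  image of the coordinate basis of F.\<close>

lemma basis_list_add:
  assumes "basis_list V (x # y # vs)"
  shows "basis_list V (x # (x + y) # vs)"
proof -
  have i: "independent (insert x (insert y (set vs)))" and dist: "distinct (x # y # vs)"
    and sp: "span (insert x (insert y (set vs))) = V"
    using assms by (auto simp: basis_list_def independent_list_def)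
  have y: "y \<notin> span (insert x (set vs))"
    using i dist unfolding insert_commute[of x y] by (auto simp: independent_insert split: if_splits)
  have ix: "independent (insert x (set vs))" using i by (rule independent_mono) auto
  have xy: "x + y \<notin> span (insert x (set vs))"
    using y span_add_eq[of x "insert x (set vs)" y] span_base[of x "insert x (set vs)"] by simp
  have "independent (insert (x + y) (insert x (set vs)))" using xy ix by (rule independent_insertI)
  moreover have "distinct (x # (x + y) # vs)"
    using dist xy span_base[of "x + y" "insert x (set vs)"] by auto
  moreover have "span (insert x (insert (x + y) (set vs))) = span (insert x (insert y (set vs)))"
  proof -
    let ?A = "insert x (insert y (set vs))" and ?B = "insert x (insert (x + y) (set vs))"
    have "(x + y) - x \<in> span ?B" by (intro span_diff span_base) auto
    then have "y \<in> span ?B" by simp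
    moreover have "x + y \<in> span ?A" by (intro span_add span_base) auto
    ultimately show ?thesis unfolding span_eq using span_base[of _ ?A] span_base[of _ ?B] by auto
  qed
  ultimately show ?thesis using sp by (simp add: basis_list_def independent_list_def insert_commute)
qed

primrec gcols :: "'b gen \<Rightarrow> 'b list" where
  "gcols (GF x) = [x, x + u x]"
| "gcols (GH y) = [y]"

lemma basis_list_gcols:
  "basis_list V (vs @ concat (map gvecs gs)) \<Longrightarrow> basis_list V (vs @ concat (map gcols gs))"
proof (induction gs arbitrary: vs)
  case (Cons g gs)
  show ?case
  proof (cases g)
    case (GF x)
    have "basis_list V (x # u x # vs @ concat (map gvecs gs))"
      using Cons.prems by (subst basis_list_mset_cong[where ws = "vs @ concat (map gvecs (g # gs))"])
        (simp_all add: GF)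
    then have "basis_list V (x # (x + u x) # vs @ concat (map gvecs gs))" by (rule basis_list_add)
    then have "basis_list V ((vs @ gcols g) @ concat (map gvecs gs))"
      by (subst basis_list_mset_cong[where ws = "x # (x + u x) # vs @ concat (map gvecs gs)"])
        (simp_all add: GF)
    then show ?thesis using Cons.IH[of "vs @ gcols g"] by simp
  next
    case (GH y)
    then show ?thesis using Cons.IH[of "vs @ [y]"] Cons.prems by simp
  qed
qed simp

end

section \<open>Modules determined by their part at the free orbit\<close>

text \<open>A block row, written through \<open>four_block_mat\<close> with lower blocks of height
  zero so that \<open>mult_four_block_mat\<close> computes its product with a
  \<open>diag_block_mat\<close>.\<close>

fun hcat_mat :: "nat \<Rightarrow> 'a::zero mat list \<Rightarrow> 'a mat" where
  "hcat_mat n [] = 0\<^sub>m n 0"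
| "hcat_mat n (A # As) = four_block_mat A (hcat_mat n As)
     (0\<^sub>m 0 (dim_col A)) (0\<^sub>m 0 (dim_col (hcat_mat n As)))"

lemma hcat_mat_carrier:
  "(\<And>A. A \<in> set As \<Longrightarrow> dim_row A = n) \<Longrightarrow> hcat_mat n As \<in> carrier_mat n (sum_list (map dim_col As))"
  by (induction As) auto

lemma cols_hcat_mat:
  "(\<And>A. A \<in> set As \<Longrightarrow> dim_row A = n) \<Longrightarrow> cols (hcat_mat n As) = concat (map cols As)"
proof (induction As)
  case (Cons A As)
  define B where "B = hcat_mat n As"
  have B: "B \<in> carrier_mat n (dim_col B)" using hcat_mat_carrier[of As n] Cons.prems by (auto simp: B_def)
  have A: "A \<in> carrier_mat n (dim_col A)" using Cons.prems by auto
  have *: "cols (four_block_mat A B (0\<^sub>m 0 (dim_col A)) (0\<^sub>m 0 (dim_col B))) = cols A @ cols B"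
  proof (rule nth_equalityI)
    fix j assume j: "j < length (cols (four_block_mat A B (0\<^sub>m 0 (dim_col A)) (0\<^sub>m 0 (dim_col B))))"
    note c = col_four_block_mat[OF A B zero_carrier_mat[of 0] zero_carrier_mat[of 0]]
    show "cols (four_block_mat A B (0\<^sub>m 0 (dim_col A)) (0\<^sub>m 0 (dim_col B))) ! j = (cols A @ cols B) ! j"
      using c(1)[of j] c(2)[of j] j carrier_matD(1)[OF A] carrier_matD(1)[OF B] by (intro eq_vecI) (auto simp: nth_append)
  qed simp
  then show ?case using Cons by (simp add: B_def)
qed (simp add: cols_def)

text \<open>One statement for all squares that a map out of a direct sum must satisfy:
  \<open>p x\<close> is \<open>mt\<close>, \<open>mup\<close>, \<open>mdn\<close> or the
  differential of a summand, and \<open>G\<close> the corresponding matrix of the target.\<close>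

lemma hcat_mat_mult_diag:
  fixes G :: "'a::comm_ring_1 mat"
  assumes G: "G \<in> carrier_mat n m"
    and "\<And>x. x \<in> set xs \<Longrightarrow> a x \<in> carrier_mat n (dim_row (p x)) \<and> b x \<in> carrier_mat m (dim_col (p x)) \<and> a x * p x = G * b x"
  shows "hcat_mat n (map a xs) * diag_block_mat (map p xs) = G * hcat_mat m (map b xs)"
  using assms(2)
proof (induction xs)
  case Nil
  then show ?case using G by (intro eq_matI) auto
next
  case (Cons x xs)
  define A where "A = hcat_mat n (map a xs)"
  define B where "B = hcat_mat m (map b xs)"
  define P where "P = diag_block_mat (map p xs)"
  have A: "A \<in> carrier_mat n (dim_row P)"
  proof -
    have "map dim_col (map a xs) = map dim_row (map p xs)" using Cons.prems by auto
    moreover have "hcat_mat n (map a xs) \<in> carrier_mat n (sum_list (map dim_col (map a xs)))"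
      by (rule hcat_mat_carrier) (use Cons.prems in auto)
    ultimately show ?thesis unfolding A_def P_def dim_diag_block_mat by metis
  qed
  have B: "B \<in> carrier_mat m (dim_col P)"
  proof -
    have "map dim_col (map b xs) = map dim_col (map p xs)" using Cons.prems by auto
    moreover have "hcat_mat m (map b xs) \<in> carrier_mat m (sum_list (map dim_col (map b xs)))"
      by (rule hcat_mat_carrier) (use Cons.prems in auto)
    ultimately show ?thesis unfolding B_def P_def dim_diag_block_mat by metis
  qed
  have x: "a x \<in> carrier_mat n (dim_row (p x))" "b x \<in> carrier_mat m (dim_col (p x))" "a x * p x = G * b x"
    using Cons.prems by auto
  have IH: "A * P = G * B" using Cons unfolding A_def B_def P_def by auto
  have L: "four_block_mat (a x) A (0\<^sub>m 0 (dim_row (p x))) (0\<^sub>m 0 (dim_row P)) *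
    four_block_mat (p x) (0\<^sub>m (dim_row (p x)) (dim_col P)) (0\<^sub>m (dim_row P) (dim_col (p x))) P
    = four_block_mat (G * b x) (G * B) (0\<^sub>m 0 (dim_col (p x))) (0\<^sub>m 0 (dim_col P))"
    unfolding x(3)[symmetric] IH[symmetric] using x(1,2) A B
    by (subst mult_four_block_mat[of _ n "dim_row (p x)" _ "dim_row P" _ 0 _ _ "dim_col (p x)" _ "dim_col P"])
      (auto intro!: cong_four_block_mat)
  have "four_block_mat G (0\<^sub>m n 0) (0\<^sub>m 0 m) (0\<^sub>m 0 0) = G"
    using G by (intro eq_matI) auto
  then have "G * four_block_mat (b x) B (0\<^sub>m 0 (dim_col (p x))) (0\<^sub>m 0 (dim_col P)) =
    four_block_mat G (0\<^sub>m n 0) (0\<^sub>m 0 m) (0\<^sub>m 0 0) * four_block_mat (b x) B (0\<^sub>m 0 (dim_col (p x))) (0\<^sub>m 0 (dim_col P))"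
    by simp
  also have "\<dots> = four_block_mat (G * b x) (G * B) (0\<^sub>m 0 (dim_col (p x))) (0\<^sub>m 0 (dim_col P))"
    using x(2) B G
    by (subst mult_four_block_mat[of _ n m _ 0 _ 0 _ _ "dim_col (p x)" _ "dim_col P"])
      (auto intro!: cong_four_block_mat)
  finally show ?case using L x(1,2) A B by (simp add: Let_def A_def[symmetric] B_def[symmetric] P_def[symmetric])
qed

lemma vec_eq_if_minus_zero:
  fixes v w :: "'a::comm_ring_1 vec"
  assumes "v \<in> carrier_vec n" "w \<in> carrier_vec n" "v - w = 0\<^sub>v n"
  shows "v = w"
proof (rule eq_vecI)
  fix i assume i: "i < dim_vec w"
  then have "(v - w) $ i = 0" using assms by simp
  then show "v $ i = w $ i" using i by simp
qed (use assms in auto)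

lemma mat_left_cancel:
  fixes A :: "'a::comm_ring_1 mat"
  assumes A: "A \<in> carrier_mat n m" and X: "X \<in> carrier_mat m k" and Y: "Y \<in> carrier_mat m k"
    and inj: "\<And>w. w \<in> carrier_vec m \<Longrightarrow> A *\<^sub>v w = 0\<^sub>v n \<Longrightarrow> w = 0\<^sub>v m" and eq: "A * X = A * Y"
  shows "X = Y"
proof (rule mat_col_eqI)
  fix j assume j: "j < dim_col Y"
  have "A *\<^sub>v col X j = A *\<^sub>v col Y j"
    using col_mult2[OF A X] col_mult2[OF A Y] eq j Y by auto
  then have "A *\<^sub>v (col X j - col Y j) = 0\<^sub>v n"
    using A X Y j by (simp add: mult_minus_distrib_mat_vec[of A n m] carrier_vecI)
  then have d: "col X j - col Y j = 0\<^sub>v m" using X Y j by (intro inj) (auto simp: carrier_vecI)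
  show "col X j = col Y j"
    by (rule vec_eq_if_minus_zero[OF _ _ d]) (use X Y in auto)
qed (use X Y in auto)

text \<open>Preimages of the unit vectors are the columns of a right inverse, and left cancellation
  makes it two-sided; no dimensions have to be compared.\<close>

lemma mat_bijective_inverse:
  fixes A :: "'a::comm_ring_1 mat"
  assumes A: "A \<in> carrier_mat n m"
    and inj: "\<And>w. w \<in> carrier_vec m \<Longrightarrow> A *\<^sub>v w = 0\<^sub>v n \<Longrightarrow> w = 0\<^sub>v m"
    and surj: "\<And>v. v \<in> carrier_vec n \<Longrightarrow> \<exists>w \<in> carrier_vec m. A *\<^sub>v w = v"
  obtains B where "B \<in> carrier_mat m n" "A * B = 1\<^sub>m n" "B * A = 1\<^sub>m m"
proof -
  have "\<exists>w. w \<in> carrier_vec m \<and> A *\<^sub>v w = unit_vec n j" for j using surj[of "unit_vec n j"] by auto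
  then obtain b where b: "\<And>j. b j \<in> carrier_vec m" "\<And>j. A *\<^sub>v b j = unit_vec n j" by metis
  define B where "B = mat_of_cols m (map b [0..<n])"
  have B: "B \<in> carrier_mat m n" by (simp add: B_def carrier_matI)
  have AB: "A * B = 1\<^sub>m n"
  proof (rule mat_col_eqI)
    fix j assume "j < dim_col (1\<^sub>m n :: 'a mat)"
    then have "j < n" by simp
    then have "col B j = b j" using b(1) by (simp add: B_def)
    then show "col (A * B) j = col (1\<^sub>m n) j" using col_mult2[OF A B \<open>j < n\<close>] b(2) \<open>j < n\<close> by simp
  qed (use A B in auto)
  have "A * (B * A) = (A * B) * A" using A B by simp
  then have "A * (B * A) = A * 1\<^sub>m m" using A AB by simp
  then have "B * A = 1\<^sub>m m"
    using mat_left_cancel[OF A mult_carrier_mat[OF B A] one_carrier_mat inj] by simp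
  then show ?thesis using that B AB by blast
qed

text \<open>Inverses of intertwining maps intertwine; this serves the structure maps of a module as
  well as the differentials of a complex.\<close>

lemma mat_inverse_commute:
  fixes A :: "'a::comm_ring_1 mat"
  assumes c: "A \<in> carrier_mat n m" "B \<in> carrier_mat m n" "A' \<in> carrier_mat n' m'" "B' \<in> carrier_mat m' n'"
    "X \<in> carrier_mat m m'" "Y \<in> carrier_mat n n'"
    and inv: "B * A = 1\<^sub>m m" "A' * B' = 1\<^sub>m n'" and eq: "A * X = Y * A'"
  shows "X * B' = B * Y"
proof -
  have BY: "B * Y \<in> carrier_mat m n'" and YA: "Y * A' \<in> carrier_mat n m'" using c by auto
  have "B * (A * X) = (B * A) * X" using assoc_mult_mat[OF c(2,1,5)] by simp
  then have "X = B * (Y * A')" using eq inv(1) c(5) by simp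
  also have "\<dots> = (B * Y) * A'" using assoc_mult_mat[OF c(2,6,3)] by simp
  finally have "X * B' = (B * Y) * (A' * B')" using assoc_mult_mat[OF BY c(3,4)] by simp
  then show ?thesis using inv(2) right_mult_one_mat[OF BY] by simp
qed

lemma diag_mult_append_vec:
  fixes A B :: "'a::comm_ring_1 mat"
  assumes "A \<in> carrier_mat r c" "B \<in> carrier_mat r' c'" "v \<in> carrier_vec c" "w \<in> carrier_vec c'"
  shows "four_block_mat A (0\<^sub>m r c') (0\<^sub>m r' c) B *\<^sub>v (v @\<^sub>v w) = (A *\<^sub>v v) @\<^sub>v (B *\<^sub>v w)"
proof -
  have z: "0\<^sub>m a b *\<^sub>v x = (0\<^sub>v a :: 'a vec)" if "x \<in> carrier_vec b" for a b x
    using that by (intro eq_vecI) (auto simp: scalar_prod_def)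
  show ?thesis
    using assms by (subst four_block_mat_mult_vec[of _ r c _ c' _ r']) (auto simp: z)
qed

text \<open>The map \<open>p\<^sup>*\<close> identifies \<open>M\<^sub>\<bullet>\<close> with the fixed points of \<open>t\<close>. On such modules everything is
  determined by the part at \<open>\<Theta>\<close>.\<close>

definition fixed_zmod :: "zmod \<Rightarrow> bool" where
  "fixed_zmod M \<longleftrightarrow>
     (\<forall>v \<in> carrier_vec (mdT M). mt M *\<^sub>v v = v \<longrightarrow> (\<exists>w \<in> carrier_vec (mdB M). mup M *\<^sub>v w = v)) \<and>
     (\<forall>w \<in> carrier_vec (mdB M). mup M *\<^sub>v w = 0\<^sub>v (mdT M) \<longrightarrow> w = 0\<^sub>v (mdB M))"

lemma is_zmodD:
  assumes "is_zmod M"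
  shows "mt M \<in> carrier_mat (mdT M) (mdT M)" "mup M \<in> carrier_mat (mdT M) (mdB M)"
    "mdn M \<in> carrier_mat (mdB M) (mdT M)" "mt M * mup M = mup M" "mdn M * mt M = mdn M"
    "mt M * mt M = 1\<^sub>m (mdT M)" "mup M * mdn M = 1\<^sub>m (mdT M) + mt M"
    "mdn M * mup M = 0\<^sub>m (mdB M) (mdB M)"
  using assms by (auto simp: is_zmod_def)

lemma is_zhomD:
  assumes "is_zhom M N f"
  shows "hT f \<in> carrier_mat (mdT N) (mdT M)" "hB f \<in> carrier_mat (mdB N) (mdB M)"
    "hT f * mt M = mt N * hT f" "hT f * mup M = mup N * hB f" "hB f * mdn M = mdn N * hT f"
  using assms by (auto simp: is_zhom_def)

lemma zsum_carrier:
  assumes "\<forall>L \<in> set Ms. is_zmod L"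
  shows "mt (zsum Ms) \<in> carrier_mat (mdT (zsum Ms)) (mdT (zsum Ms))"
    "mup (zsum Ms) \<in> carrier_mat (mdT (zsum Ms)) (mdB (zsum Ms))"
    "mdn (zsum Ms) \<in> carrier_mat (mdB (zsum Ms)) (mdT (zsum Ms))"
proof -
  have "sum_list (map (dim_row \<circ> mt) Ms) = sum_list (map mdT Ms)"
    "sum_list (map (dim_col \<circ> mt) Ms) = sum_list (map mdT Ms)"
    "sum_list (map (dim_row \<circ> mup) Ms) = sum_list (map mdT Ms)"
    "sum_list (map (dim_col \<circ> mup) Ms) = sum_list (map mdB Ms)"
    "sum_list (map (dim_row \<circ> mdn) Ms) = sum_list (map mdB Ms)"
    "sum_list (map (dim_col \<circ> mdn) Ms) = sum_list (map mdT Ms)"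
    using carrier_matD[OF is_zmodD(1)[OF bspec[OF assms]]] carrier_matD[OF is_zmodD(2)[OF bspec[OF assms]]]
      carrier_matD[OF is_zmodD(3)[OF bspec[OF assms]]]
    by (auto intro!: arg_cong[where f = sum_list])
  then show "mt (zsum Ms) \<in> carrier_mat (mdT (zsum Ms)) (mdT (zsum Ms))"
    "mup (zsum Ms) \<in> carrier_mat (mdT (zsum Ms)) (mdB (zsum Ms))"
    "mdn (zsum Ms) \<in> carrier_mat (mdB (zsum Ms)) (mdT (zsum Ms))"
    by (auto simp: zsum_def dim_diag_block_mat intro!: carrier_matI)
qed

lemma zsum_Cons:
  assumes "is_zmod M" "\<forall>L \<in> set Ms. is_zmod L"
  shows "mdT (zsum (M # Ms)) = mdT M + mdT (zsum Ms)" "mdB (zsum (M # Ms)) = mdB M + mdB (zsum Ms)"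
    "mt (zsum (M # Ms)) = four_block_mat (mt M) (0\<^sub>m (mdT M) (mdT (zsum Ms))) (0\<^sub>m (mdT (zsum Ms)) (mdT M)) (mt (zsum Ms))"
    "mup (zsum (M # Ms)) = four_block_mat (mup M) (0\<^sub>m (mdT M) (mdB (zsum Ms))) (0\<^sub>m (mdT (zsum Ms)) (mdB M)) (mup (zsum Ms))"
  using is_zmodD(1,2)[OF assms(1)] zsum_carrier[OF assms(2)] by (auto simp: zsum_def Let_def)

lemma fixed_zmod_zsum:
  "(\<And>M. M \<in> set Ms \<Longrightarrow> is_zmod M \<and> fixed_zmod M) \<Longrightarrow> fixed_zmod (zsum Ms)"
proof (induction Ms)
  case Nil
  show ?case unfolding fixed_zmod_def zsum_def by (auto intro!: bexI[of _ "0\<^sub>v 0"])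
next
  case (Cons M Ms)
  define S where "S = zsum Ms"
  have M: "is_zmod M" "fixed_zmod M" and S: "fixed_zmod S" using Cons by (auto simp: S_def)
  have Ms: "\<forall>L \<in> set Ms. is_zmod L" using Cons.prems by auto
  note zs = zsum_Cons[OF M(1) Ms, folded S_def] and zc = zsum_carrier[OF Ms, folded S_def]
  note Mc = is_zmodD(1,2)[OF M(1)]
  have split: "\<exists>v1 v2. v = v1 @\<^sub>v v2 \<and> v1 \<in> carrier_vec a \<and> v2 \<in> carrier_vec b" if "v \<in> carrier_vec (a + b)" for v :: "bit vec" and a b
    using that vec_first_last_append[OF that] vec_first_carrier vec_last_carrier by metis
  show ?case
    unfolding fixed_zmod_def zs(1,2,3,4)
  proof (intro conjI ballI impI)
    fix v :: "bit vec" assume v: "v \<in> carrier_vec (mdT M + mdT S)"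
      "four_block_mat (mt M) (0\<^sub>m (mdT M) (mdT S)) (0\<^sub>m (mdT S) (mdT M)) (mt S) *\<^sub>v v = v"
    obtain v1 v2 where vv: "v = v1 @\<^sub>v v2" "v1 \<in> carrier_vec (mdT M)" "v2 \<in> carrier_vec (mdT S)"
      using split[OF v(1)] by auto
    have "(mt M *\<^sub>v v1) @\<^sub>v (mt S *\<^sub>v v2) = v1 @\<^sub>v v2"
      using v(2) diag_mult_append_vec[OF Mc(1) zc(1) vv(2,3)] vv(1) by simp
    then have "mt M *\<^sub>v v1 = v1" "mt S *\<^sub>v v2 = v2"
      using vv Mc(1) append_vec_eq[of "mt M *\<^sub>v v1" "mdT M" v1] by auto
    then obtain w1 w2 where w: "w1 \<in> carrier_vec (mdB M)" "w2 \<in> carrier_vec (mdB S)"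
      "mup M *\<^sub>v w1 = v1" "mup S *\<^sub>v w2 = v2"
      using M(2) S vv unfolding fixed_zmod_def by metis
    show "\<exists>w \<in> carrier_vec (mdB M + mdB S).
        four_block_mat (mup M) (0\<^sub>m (mdT M) (mdB S)) (0\<^sub>m (mdT S) (mdB M)) (mup S) *\<^sub>v w = v"
      using w vv(1) diag_mult_append_vec[OF Mc(2) zc(2) w(1,2)] by (intro bexI[of _ "w1 @\<^sub>v w2"]) auto
  next
    fix w :: "bit vec" assume w: "w \<in> carrier_vec (mdB M + mdB S)"
      "four_block_mat (mup M) (0\<^sub>m (mdT M) (mdB S)) (0\<^sub>m (mdT S) (mdB M)) (mup S) *\<^sub>v w = 0\<^sub>v (mdT M + mdT S)"
    obtain w1 w2 where ww: "w = w1 @\<^sub>v w2" "w1 \<in> carrier_vec (mdB M)" "w2 \<in> carrier_vec (mdB S)"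
      using split[OF w(1)] by auto
    have z: "0\<^sub>v (a + b) = (0\<^sub>v a @\<^sub>v 0\<^sub>v b :: bit vec)" for a b by (intro eq_vecI) auto
    have "(mup M *\<^sub>v w1) @\<^sub>v (mup S *\<^sub>v w2) = 0\<^sub>v (mdT M) @\<^sub>v 0\<^sub>v (mdT S)"
      using w(2) diag_mult_append_vec[OF Mc(2) zc(2) ww(2,3)] ww(1) z by simp
    then have "mup M *\<^sub>v w1 = 0\<^sub>v (mdT M)" "mup S *\<^sub>v w2 = 0\<^sub>v (mdT S)"
      using ww Mc(2) append_vec_eq[of "mup M *\<^sub>v w1" "mdT M" "0\<^sub>v (mdT M)"] by auto
    then show "w = 0\<^sub>v (mdB M + mdB S)" using M(2) S ww z unfolding fixed_zmod_def by metis
  qed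
qed

text \<open>A fixed vector of \<open>M\<close> is pushed to \<open>N\<close>, lifted through
  \<open>mup N\<close> there, and the lift is brought back by \<open>hB g\<close>.\<close>

lemma fixed_zmod_iso:
  assumes "zmod_isomorphic M N" "is_zmod M" "fixed_zmod N"
    and N: "mt N \<in> carrier_mat (mdT N) (mdT N)" "mup N \<in> carrier_mat (mdT N) (mdB N)"
  shows "fixed_zmod M"
proof -
  obtain f g where f: "is_zhom M N f" and g: "is_zhom N M g" and gf: "zcomp g f = zid M"
    using assms(1) by (auto simp: zmod_isomorphic_def is_ziso_def)
  have gfT: "hT g * hT f = 1\<^sub>m (mdT M)" and gfB: "hB g * hB f = 1\<^sub>m (mdB M)"
    using gf by (auto simp: zcomp_def zid_def)
  note c = is_zmodD(1,2)[OF assms(2)] N is_zhomD(1,2)[OF f] is_zhomD(1,2)[OF g]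
  show ?thesis
    unfolding fixed_zmod_def
  proof (intro conjI ballI impI)
    fix v assume v: "v \<in> carrier_vec (mdT M)" "mt M *\<^sub>v v = v"
    have "mt N *\<^sub>v (hT f *\<^sub>v v) = (mt N * hT f) *\<^sub>v v" using c v by (simp add: assoc_mult_mat_vec[of _ _ "mdT N"])
    also have "\<dots> = hT f *\<^sub>v (mt M *\<^sub>v v)"
      unfolding is_zhomD(3)[OF f, symmetric] using c v(1) by (simp add: assoc_mult_mat_vec[of _ _ "mdT M"])
    finally have "mt N *\<^sub>v (hT f *\<^sub>v v) = hT f *\<^sub>v v" using v(2) by simp
    moreover have "hT f *\<^sub>v v \<in> carrier_vec (mdT N)" using c v by simp
    ultimately obtain w where w: "w \<in> carrier_vec (mdB N)" "mup N *\<^sub>v w = hT f *\<^sub>v v"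
      using assms(3) unfolding fixed_zmod_def by metis
    have "mup M *\<^sub>v (hB g *\<^sub>v w) = (mup M * hB g) *\<^sub>v w" using c w by (simp add: assoc_mult_mat_vec[of _ _ "mdB M"])
    also have "\<dots> = hT g *\<^sub>v (mup N *\<^sub>v w)"
      unfolding is_zhomD(4)[OF g, symmetric] using c w(1) by (simp add: assoc_mult_mat_vec[of _ _ "mdT N"])
    also have "\<dots> = (hT g * hT f) *\<^sub>v v" unfolding w(2) using c v by (simp add: assoc_mult_mat_vec[of _ _ "mdT N"])
    finally have "mup M *\<^sub>v (hB g *\<^sub>v w) = v" using gfT v(1) by simp
    then show "\<exists>w \<in> carrier_vec (mdB M). mup M *\<^sub>v w = v" using c w by (intro bexI[of _ "hB g *\<^sub>v w"]) auto
  next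
    fix w assume w: "w \<in> carrier_vec (mdB M)" "mup M *\<^sub>v w = 0\<^sub>v (mdT M)"
    have "mup N *\<^sub>v (hB f *\<^sub>v w) = (mup N * hB f) *\<^sub>v w" using c w by (simp add: assoc_mult_mat_vec[of _ _ "mdB N"])
    also have "\<dots> = hT f *\<^sub>v (mup M *\<^sub>v w)"
      unfolding is_zhomD(4)[OF f, symmetric] using c w(1) by (simp add: assoc_mult_mat_vec[of _ _ "mdT M"])
    also have "\<dots> = 0\<^sub>v (mdT N)" unfolding w(2) using c by (intro eq_vecI) auto
    finally have "hB f *\<^sub>v w = 0\<^sub>v (mdB N)" using assms(3) c w(1) unfolding fixed_zmod_def by auto
    then have "(hB g * hB f) *\<^sub>v w = hB g *\<^sub>v 0\<^sub>v (mdB N)" using c w(1) by (simp add: assoc_mult_mat_vec[of _ _ "mdB N"])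
    also have "\<dots> = 0\<^sub>v (mdB M)" using c by (intro eq_vecI) auto
    finally show "w = 0\<^sub>v (mdB M)" using gfB w(1) by simp
  qed
qed

text \<open>Injectivity of \<open>mup N\<close> makes \<open>hB\<close> a consequence of
  \<open>hT\<close>, so diagrams of modules need checking at \<open>\<Theta>\<close> only.\<close>

lemma zhom_eqI:
  assumes "is_zhom M N f" "is_zhom M N g" "is_zmod N" "fixed_zmod N" "hT f = hT g"
  shows "f = g"
proof -
  have "mup N * hB f = mup N * hB g"
    using is_zhomD(4)[OF assms(1)] is_zhomD(4)[OF assms(2)] assms(5) by simp
  then have "hB f = hB g"
    using mat_left_cancel[OF is_zmodD(2)[OF assms(3)] is_zhomD(2)[OF assms(1)] is_zhomD(2)[OF assms(2)]]
      assms(4) unfolding fixed_zmod_def by blast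
  then show ?thesis using assms(5) by simp
qed

lemma zhom_zcomp:
  assumes f: "is_zhom L M f" and g: "is_zhom M N g" and L: "is_zmod L" and M: "is_zmod M" and N: "is_zmod N"
  shows "is_zhom L N (zcomp g f)"
proof -
  note c = is_zhomD(1,2)[OF f] is_zhomD(1,2)[OF g] is_zmodD(1-3)[OF L] is_zmodD(1-3)[OF M] is_zmodD(1-3)[OF N]
  have eq: "(G' * F') * X = Z * (G * F)"
    if "F' * X = Y * F" "G' * Y = Z * G" "F' \<in> carrier_mat b' a'" "F \<in> carrier_mat b a" "X \<in> carrier_mat a' a"
      "Y \<in> carrier_mat b' b" "G' \<in> carrier_mat c' b'" "G \<in> carrier_mat c b" "Z \<in> carrier_mat c' c"
    for F' X Y F G' G Z :: "bit mat" and a a' b b' c c'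
  proof -
    have "(G' * F') * X = G' * (F' * X)" by (rule assoc_mult_mat[OF that(7,3,5)])
    also have "\<dots> = (G' * Y) * F" unfolding that(1) by (rule assoc_mult_mat[OF that(7,6,4), symmetric])
    also have "\<dots> = Z * (G * F)" unfolding that(2) by (rule assoc_mult_mat[OF that(9,8,4)])
    finally show ?thesis .
  qed
  show ?thesis
    unfolding is_zhom_def zcomp_def
    using eq[OF is_zhomD(3)[OF f] is_zhomD(3)[OF g]] eq[OF is_zhomD(4)[OF f] is_zhomD(4)[OF g]]
      eq[OF is_zhomD(5)[OF f] is_zhomD(5)[OF g]] c by simp
qed

text \<open>A map that is bijective at \<open>\<Theta>\<close> is bijective on fixed vectors, which
  are the groups at \<open>\<bullet>\<close>. Of \<open>M\<close> only matrix sizes are asked, as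
  \<open>zsum_carrier\<close> supplies them for direct sums.\<close>

lemma zisoI:
  assumes f: "is_zhom M N f"
    and Mc: "mt M \<in> carrier_mat (mdT M) (mdT M)" "mup M \<in> carrier_mat (mdT M) (mdB M)"
      "mdn M \<in> carrier_mat (mdB M) (mdT M)"
    and N: "is_zmod N" and fixd: "fixed_zmod M" "fixed_zmod N"
    and inj: "\<And>w. w \<in> carrier_vec (mdT M) \<Longrightarrow> hT f *\<^sub>v w = 0\<^sub>v (mdT N) \<Longrightarrow> w = 0\<^sub>v (mdT M)"
    and surj: "\<And>v. v \<in> carrier_vec (mdT N) \<Longrightarrow> \<exists>w \<in> carrier_vec (mdT M). hT f *\<^sub>v w = v"
  shows "is_ziso M N f"
proof -
  note fc = is_zhomD(1,2)[OF f] and Nc = is_zmodD(1-3)[OF N]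
  obtain G where G: "G \<in> carrier_mat (mdT M) (mdT N)" "hT f * G = 1\<^sub>m (mdT N)" "G * hT f = 1\<^sub>m (mdT M)"
    using mat_bijective_inverse[OF fc(1) inj surj] by blast
  have up: "mup N *\<^sub>v (hB f *\<^sub>v w) = hT f *\<^sub>v (mup M *\<^sub>v w)" if "w \<in> carrier_vec (mdB M)" for w
    using that fc Mc Nc assoc_mult_mat_vec[OF Nc(2) fc(2) that] assoc_mult_mat_vec[OF fc(1) Mc(2) that]
      is_zhomD(4)[OF f] by simp
  have t: "mt N *\<^sub>v (hT f *\<^sub>v v) = hT f *\<^sub>v (mt M *\<^sub>v v)" if "v \<in> carrier_vec (mdT M)" for v
    using that fc Mc Nc assoc_mult_mat_vec[OF Nc(1) fc(1) that] assoc_mult_mat_vec[OF fc(1) Mc(1) that]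
      is_zhomD(3)[OF f] by simp
  have injB: "w = 0\<^sub>v (mdB M)" if w: "w \<in> carrier_vec (mdB M)" "hB f *\<^sub>v w = 0\<^sub>v (mdB N)" for w
  proof -
    have "mup N *\<^sub>v 0\<^sub>v (mdB N) = 0\<^sub>v (mdT N)" using Nc(2) by (intro eq_vecI) auto
    then have "hT f *\<^sub>v (mup M *\<^sub>v w) = 0\<^sub>v (mdT N)" using up[OF w(1)] w(2) by simp
    then have "mup M *\<^sub>v w = 0\<^sub>v (mdT M)" using inj mult_mat_vec_carrier[OF Mc(2) w(1)] by blast
    then show ?thesis using fixd(1) w(1) unfolding fixed_zmod_def by blast
  qed
  \<comment> \<open>The preimage \<open>x\<close> of \<open>mup N *\<^sub>v v\<close> is fixed
    because \<open>hT f\<close> is injective; hence \<open>x\<close> comes from some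
    \<open>w\<close> at \<open>\<bullet>\<close>, and injectivity of \<open>mup N\<close> identifies
    the image of \<open>w\<close> with \<open>v\<close>.\<close>
  have surjB: "\<exists>w \<in> carrier_vec (mdB M). hB f *\<^sub>v w = v" if v: "v \<in> carrier_vec (mdB N)" for v
  proof -
    have upv: "mup N *\<^sub>v v \<in> carrier_vec (mdT N)" using Nc(2) v by simp
    then obtain x where x: "x \<in> carrier_vec (mdT M)" "hT f *\<^sub>v x = mup N *\<^sub>v v" using surj by blast
    have fx: "hT f *\<^sub>v (mt M *\<^sub>v x) = hT f *\<^sub>v x"
      using t[OF x(1)] x(2) assoc_mult_mat_vec[OF Nc(1,2) v] is_zmodD(4)[OF N] by simp
    have tx: "mt M *\<^sub>v x \<in> carrier_vec (mdT M)" using Mc(1) x(1) by simp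
    have Gf: "G *\<^sub>v (hT f *\<^sub>v y) = y" if "y \<in> carrier_vec (mdT M)" for y
      using assoc_mult_mat_vec[OF G(1) fc(1) that] G(3) that by simp
    have "mt M *\<^sub>v x = x" using Gf[OF tx] Gf[OF x(1)] fx by simp
    then obtain w where w: "w \<in> carrier_vec (mdB M)" "mup M *\<^sub>v w = x"
      using fixd(1) x(1) unfolding fixed_zmod_def by blast
    have hw: "hB f *\<^sub>v w \<in> carrier_vec (mdB N)" using fc(2) w(1) by simp
    have "mup N *\<^sub>v (hB f *\<^sub>v w - v) = 0\<^sub>v (mdT N)"
      using up[OF w(1)] w(2) x(2) mult_minus_distrib_mat_vec[OF Nc(2) hw v] upv by simp
    then have z: "hB f *\<^sub>v w - v = 0\<^sub>v (mdB N)" using fixd(2) hw v unfolding fixed_zmod_def by simp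
    have "hB f *\<^sub>v w = v" by (rule vec_eq_if_minus_zero[OF hw v z])
    then show ?thesis using w(1) by blast
  qed
  obtain H where H: "H \<in> carrier_mat (mdB M) (mdB N)" "hB f * H = 1\<^sub>m (mdB N)" "H * hB f = 1\<^sub>m (mdB M)"
    using mat_bijective_inverse[OF fc(2) injB surjB] by blast
  let ?g = "\<lparr>hT = G, hB = H\<rparr>"
  have "is_zhom N M ?g"
    unfolding is_zhom_def
    using mat_inverse_commute[OF fc(1) G(1) fc(1) G(1) Mc(1) Nc(1) G(3,2) is_zhomD(3)[OF f]]
      mat_inverse_commute[OF fc(1) G(1) fc(2) H(1) Mc(2) Nc(2) G(3) H(2) is_zhomD(4)[OF f]]
      mat_inverse_commute[OF fc(2) H(1) fc(1) G(1) Mc(3) Nc(3) H(3) G(2) is_zhomD(5)[OF f]]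
      G(1) H(1) by simp
  then show ?thesis
    unfolding is_ziso_def using f G H by (intro conjI exI[of _ ?g]) (auto simp: zcomp_def zid_def)
qed

text \<open>The isomorphism is constructed from the sum of strips to \<open>C\<close>, while the
  theorem wants one out of \<open>C\<close>.\<close>

lemma chain_iso_sym:
  assumes C: "\<And>i. is_zhom (cobj C i) (cobj C (i - 1)) (cdif C i)"
    and D: "\<And>i. hT (cdif D i) \<in> carrier_mat (mdT (cobj D (i - 1))) (mdT (cobj D i))"
      "\<And>i. hB (cdif D i) \<in> carrier_mat (mdB (cobj D (i - 1))) (mdB (cobj D i))"
    and f: "is_chain_map D C f" and iso: "\<And>i. is_ziso (cobj D i) (cobj C i) (f i)"
  shows "cx_isomorphic C D"
proof -
  have "\<exists>g. is_zhom (cobj C i) (cobj D i) g \<and> zcomp g (f i) = zid (cobj D i) \<and> zcomp (f i) g = zid (cobj C i)" for i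
    using iso[of i] by (auto simp: is_ziso_def)
  then obtain g where g: "\<And>i. is_zhom (cobj C i) (cobj D i) (g i)" "\<And>i. zcomp (g i) (f i) = zid (cobj D i)"
    "\<And>i. zcomp (f i) (g i) = zid (cobj C i)" by metis
  have f': "is_zhom (cobj D i) (cobj C i) (f i)" "zcomp (f (i - 1)) (cdif D i) = zcomp (cdif C i) (f i)" for i
    using f by (auto simp: is_chain_map_def)
  have inv: "hT (g i) * hT (f i) = 1\<^sub>m (mdT (cobj D i))" "hB (g i) * hB (f i) = 1\<^sub>m (mdB (cobj D i))"
    "hT (f i) * hT (g i) = 1\<^sub>m (mdT (cobj C i))" "hB (f i) * hB (g i) = 1\<^sub>m (mdB (cobj C i))" for i
    using g(2)[of i] g(3)[of i] by (auto simp: zcomp_def zid_def)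
  have "zcomp (g (i - 1)) (cdif C i) = zcomp (cdif D i) (g i)" for i
  proof -
    have "hT (f (i - 1)) * hT (cdif D i) = hT (cdif C i) * hT (f i)"
      "hB (f (i - 1)) * hB (cdif D i) = hB (cdif C i) * hB (f i)"
      using f'(2)[of i] by (auto simp: zcomp_def)
    from mat_inverse_commute[OF is_zhomD(1)[OF f'(1)] is_zhomD(1)[OF g(1)] is_zhomD(1)[OF f'(1)]
        is_zhomD(1)[OF g(1)] D(1) is_zhomD(1)[OF C] inv(1,3) this(1)]
      mat_inverse_commute[OF is_zhomD(2)[OF f'(1)] is_zhomD(2)[OF g(1)] is_zhomD(2)[OF f'(1)]
        is_zhomD(2)[OF g(1)] D(2) is_zhomD(2)[OF C] inv(2,4) this(2)]
    show ?thesis by (simp add: zcomp_def)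
  qed
  then have "is_chain_map C D g" using g(1) by (simp add: is_chain_map_def)
  moreover have "is_ziso (cobj C i) (cobj D i) (g i)" for i
    unfolding is_ziso_def using g f'(1) by blast
  ultimately show ?thesis by (auto simp: cx_isomorphic_def)
qed

section \<open>Direct sums of complexes and maps out of them\<close>

definition pre_cx :: "cx \<Rightarrow> bool" where
  "pre_cx Y \<longleftrightarrow> (\<forall>i. is_zmod (cobj Y i) \<and> is_zhom (cobj Y i) (cobj Y (i - 1)) (cdif Y i))"

definition zhcat :: "zmod \<Rightarrow> zhom list \<Rightarrow> zhom" where
  "zhcat N fs = \<lparr>hT = hcat_mat (mdT N) (map hT fs), hB = hcat_mat (mdB N) (map hB fs)\<rparr>"

lemma zhcat_hom:
  assumes h: "\<And>x. x \<in> set xs \<Longrightarrow> is_zmod (M x) \<and> is_zhom (M x) N (f x)" and N: "is_zmod N"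
  shows "is_zhom (zsum (map M xs)) N (zhcat N (map f xs))"
proof -
  note Nc = is_zmodD(1-3)[OF N]
  have c: "mt (M x) \<in> carrier_mat (mdT (M x)) (mdT (M x))" "mup (M x) \<in> carrier_mat (mdT (M x)) (mdB (M x))"
    "mdn (M x) \<in> carrier_mat (mdB (M x)) (mdT (M x))"
    "hT (f x) \<in> carrier_mat (mdT N) (mdT (M x))" "hB (f x) \<in> carrier_mat (mdB N) (mdB (M x))"
    "hT (f x) * mt (M x) = mt N * hT (f x)" "hT (f x) * mup (M x) = mup N * hB (f x)"
    "hB (f x) * mdn (M x) = mdn N * hT (f x)"
    if "x \<in> set xs" for x
    using is_zmodD[of "M x"] is_zhomD[of "M x" N "f x"] h[OF that] by auto
  have "map dim_col (map (hT \<circ> f) xs) = map (mdT \<circ> M) xs" "map dim_col (map (hB \<circ> f) xs) = map (mdB \<circ> M) xs"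
    using carrier_matD(2)[OF c(4)] carrier_matD(2)[OF c(5)] by auto
  moreover have "hcat_mat (mdT N) (map (hT \<circ> f) xs) \<in> carrier_mat (mdT N) (sum_list (map dim_col (map (hT \<circ> f) xs)))"
    by (rule hcat_mat_carrier) (use carrier_matD(1)[OF c(4)] in auto)
  moreover have "hcat_mat (mdB N) (map (hB \<circ> f) xs) \<in> carrier_mat (mdB N) (sum_list (map dim_col (map (hB \<circ> f) xs)))"
    by (rule hcat_mat_carrier) (use carrier_matD(1)[OF c(5)] in auto)
  ultimately have car: "hcat_mat (mdT N) (map (hT \<circ> f) xs) \<in> carrier_mat (mdT N) (sum_list (map (mdT \<circ> M) xs))"
    "hcat_mat (mdB N) (map (hB \<circ> f) xs) \<in> carrier_mat (mdB N) (sum_list (map (mdB \<circ> M) xs))"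
    by metis+
  have "hcat_mat (mdT N) (map (hT \<circ> f) xs) * diag_block_mat (map (mt \<circ> M) xs) = mt N * hcat_mat (mdT N) (map (hT \<circ> f) xs)"
    by (rule hcat_mat_mult_diag[OF Nc(1)]) (use c(4-8) carrier_matD[OF c(1)] carrier_matD[OF c(2)] carrier_matD[OF c(3)] in auto)
  moreover have "hcat_mat (mdT N) (map (hT \<circ> f) xs) * diag_block_mat (map (mup \<circ> M) xs) = mup N * hcat_mat (mdB N) (map (hB \<circ> f) xs)"
    by (rule hcat_mat_mult_diag[OF Nc(2)]) (use c(4-8) carrier_matD[OF c(1)] carrier_matD[OF c(2)] carrier_matD[OF c(3)] in auto)
  moreover have "hcat_mat (mdB N) (map (hB \<circ> f) xs) * diag_block_mat (map (mdn \<circ> M) xs) = mdn N * hcat_mat (mdT N) (map (hT \<circ> f) xs)"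
    by (rule hcat_mat_mult_diag[OF Nc(3)]) (use c(4-8) carrier_matD[OF c(1)] carrier_matD[OF c(2)] carrier_matD[OF c(3)] in auto)
  ultimately show ?thesis using car by (simp add: is_zhom_def zhcat_def zsum_def)
qed

lemma pre_cxD:
  assumes "pre_cx Y"
  shows "is_zmod (cobj Y i)" "is_zhom (cobj Y i) (cobj Y (i - 1)) (cdif Y i)"
  using assms by (auto simp: pre_cx_def)

lemma zhcat_chain_map:
  assumes C: "pre_cx C" and h: "\<And>x. x \<in> set xs \<Longrightarrow> pre_cx (Y x) \<and> is_chain_map (Y x) C (f x)"
  shows "is_chain_map (cx_sum (map Y xs)) C (\<lambda>i. zhcat (cobj C i) (map (\<lambda>x. f x i) xs))"
  unfolding is_chain_map_def
proof (intro allI conjI)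
  fix i
  have hom: "is_zhom (cobj (Y x) i) (cobj C i) (f x i)"
    and com: "zcomp (f x (i - 1)) (cdif (Y x) i) = zcomp (cdif C i) (f x i)" if "x \<in> set xs" for x i
    using h[OF that] by (auto simp: is_chain_map_def)
  have pre: "is_zhom (cobj (Y x) i) (cobj (Y x) (i - 1)) (cdif (Y x) i)" "is_zmod (cobj (Y x) i)" if "x \<in> set xs" for x i
    using h[OF that] pre_cxD by auto
  have "is_zhom (zsum (map (\<lambda>x. cobj (Y x) i) xs)) (cobj C i) (zhcat (cobj C i) (map (\<lambda>x. f x i) xs))"
    by (rule zhcat_hom) (use hom pre pre_cxD(1)[OF C] in auto)
  then show "is_zhom (cobj (cx_sum (map Y xs)) i) (cobj C i) (zhcat (cobj C i) (map (\<lambda>x. f x i) xs))"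
    by (simp add: cx_sum_def o_def)
  have "hcat_mat (mdT (cobj C (i - 1))) (map (\<lambda>x. hT (f x (i - 1))) xs) * diag_block_mat (map (\<lambda>x. hT (cdif (Y x) i)) xs) =
    hT (cdif C i) * hcat_mat (mdT (cobj C i)) (map (\<lambda>x. hT (f x i)) xs)"
  proof (rule hcat_mat_mult_diag[OF is_zhomD(1)[OF pre_cxD(2)[OF C]]])
    fix x assume x: "x \<in> set xs"
    show "hT (f x (i - 1)) \<in> carrier_mat (mdT (cobj C (i - 1))) (dim_row (hT (cdif (Y x) i))) \<and>
      hT (f x i) \<in> carrier_mat (mdT (cobj C i)) (dim_col (hT (cdif (Y x) i))) \<and>
      hT (f x (i - 1)) * hT (cdif (Y x) i) = hT (cdif C i) * hT (f x i)"
      using is_zhomD(1)[OF hom[OF x]] is_zhomD(1)[OF pre(1)[OF x, of i]] com[OF x, of i] by (auto simp: zcomp_def)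
  qed
  moreover have "hcat_mat (mdB (cobj C (i - 1))) (map (\<lambda>x. hB (f x (i - 1))) xs) * diag_block_mat (map (\<lambda>x. hB (cdif (Y x) i)) xs) =
    hB (cdif C i) * hcat_mat (mdB (cobj C i)) (map (\<lambda>x. hB (f x i)) xs)"
  proof (rule hcat_mat_mult_diag[OF is_zhomD(2)[OF pre_cxD(2)[OF C]]])
    fix x assume x: "x \<in> set xs"
    show "hB (f x (i - 1)) \<in> carrier_mat (mdB (cobj C (i - 1))) (dim_row (hB (cdif (Y x) i))) \<and>
      hB (f x i) \<in> carrier_mat (mdB (cobj C i)) (dim_col (hB (cdif (Y x) i))) \<and>
      hB (f x (i - 1)) * hB (cdif (Y x) i) = hB (cdif C i) * hB (f x i)"
      using is_zhomD(2)[OF hom[OF x]] is_zhomD(2)[OF pre(1)[OF x, of i]] com[OF x, of i] by (auto simp: zcomp_def)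
  qed
  ultimately show "zcomp (zhcat (cobj C (i - 1)) (map (\<lambda>x. f x (i - 1)) xs)) (cdif (cx_sum (map Y xs)) i) =
      zcomp (cdif C i) (zhcat (cobj C i) (map (\<lambda>x. f x i) xs))"
    by (simp add: zcomp_def zhcat_def cx_sum_def zhsum_def o_def)
qed

text \<open>The hypothesis \<open>bij\<close> says that in every degree the columns of the component
  maps at \<open>\<Theta>\<close>, taken together, form a basis; \<open>zisoI\<close> extends this
  to the groups at \<open>\<bullet>\<close>.\<close>

lemma cx_isomorphic_sumI:
  assumes C: "pre_cx C" "\<And>i. fixed_zmod (cobj C i)"
    and h: "\<And>x. x \<in> set xs \<Longrightarrow> pre_cx (Y x) \<and> (\<forall>i. fixed_zmod (cobj (Y x) i)) \<and> is_chain_map (Y x) C (f x)"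
    and bij: "\<And>i v. v \<in> carrier_vec (mdT (cobj C i)) \<Longrightarrow>
      \<exists>!w. w \<in> carrier_vec (length (concat (map (\<lambda>x. cols (hT (f x i))) xs))) \<and>
        mat_of_cols (mdT (cobj C i)) (concat (map (\<lambda>x. cols (hT (f x i))) xs)) *\<^sub>v w = v"
  shows "cx_isomorphic C (cx_sum (map Y xs))"
proof (rule chain_iso_sym)
  define D where "D = cx_sum (map Y xs)"
  define F where "F i = zhcat (cobj C i) (map (\<lambda>x. f x i) xs)" for i
  have D: "cobj D i = zsum (map (\<lambda>x. cobj (Y x) i) xs)" "cdif D i = zhsum (map (\<lambda>x. cdif (Y x) i) xs)" for i
    by (simp_all add: D_def cx_sum_def o_def)
  have pre: "is_zhom (cobj (Y x) i) (cobj (Y x) (i - 1)) (cdif (Y x) i)" "is_zmod (cobj (Y x) i)" if "x \<in> set xs" for x i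
    using h[OF that] pre_cxD by auto
  show "is_zhom (cobj C i) (cobj C (i - 1)) (cdif C i)" for i by (rule pre_cxD(2)[OF C(1)])
  have "map (\<lambda>x. dim_row (hT (cdif (Y x) i))) xs = map (\<lambda>x. mdT (cobj (Y x) (i - 1))) xs"
    "map (\<lambda>x. dim_col (hT (cdif (Y x) i))) xs = map (\<lambda>x. mdT (cobj (Y x) i)) xs"
    "map (\<lambda>x. dim_row (hB (cdif (Y x) i))) xs = map (\<lambda>x. mdB (cobj (Y x) (i - 1))) xs"
    "map (\<lambda>x. dim_col (hB (cdif (Y x) i))) xs = map (\<lambda>x. mdB (cobj (Y x) i)) xs" for i
    using carrier_matD[OF is_zhomD(1)[OF pre(1)]] carrier_matD[OF is_zhomD(2)[OF pre(1)]] by auto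
  note dims = this[THEN arg_cong[where f = sum_list]]
  show "hT (cdif (cx_sum (map Y xs)) i) \<in> carrier_mat (mdT (cobj (cx_sum (map Y xs)) (i - 1))) (mdT (cobj (cx_sum (map Y xs)) i))"
    "hB (cdif (cx_sum (map Y xs)) i) \<in> carrier_mat (mdB (cobj (cx_sum (map Y xs)) (i - 1))) (mdB (cobj (cx_sum (map Y xs)) i))" for i
    unfolding D_def[symmetric] D using dims
    by (auto intro!: carrier_matI simp: zhsum_def zsum_def dim_diag_block_mat o_def)
  have chain: "is_chain_map D C F"
    unfolding D_def F_def by (rule zhcat_chain_map[OF C(1)]) (use h in auto)
  then show "is_chain_map (cx_sum (map Y xs)) C F" by (simp add: D_def)
  have FD: "is_zhom (cobj D i) (cobj C i) (F i)" for i using chain by (simp add: is_chain_map_def)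
  show "is_ziso (cobj (cx_sum (map Y xs)) i) (cobj C i) (F i)" for i
    unfolding D_def[symmetric]
  proof (rule zisoI[OF FD])
    let ?n = "mdT (cobj C i)" and ?vs = "concat (map (\<lambda>x. cols (hT (f x i))) xs)"
    have "\<forall>L \<in> set (map (\<lambda>x. cobj (Y x) i) xs). is_zmod L" using pre(2) by auto
    from zsum_carrier[OF this]
    show "mt (cobj D i) \<in> carrier_mat (mdT (cobj D i)) (mdT (cobj D i))"
      "mup (cobj D i) \<in> carrier_mat (mdT (cobj D i)) (mdB (cobj D i))"
      "mdn (cobj D i) \<in> carrier_mat (mdB (cobj D i)) (mdT (cobj D i))"
      unfolding D .
    show "is_zmod (cobj C i)" by (rule pre_cxD(1)[OF C(1)])
    show "fixed_zmod (cobj D i)" unfolding D by (rule fixed_zmod_zsum) (use h pre(2) in auto)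
    have row: "dim_row (hT (f x i)) = ?n" if "x \<in> set xs" for x
      using h[OF that] is_zhomD(1)[of "cobj (Y x) i" "cobj C i" "f x i"] by (auto simp: is_chain_map_def)
    have "cols (hT (F i)) = concat (map cols (map (\<lambda>x. hT (f x i)) xs))"
      unfolding F_def zhcat_def zhom.select_convs map_map o_def
      by (subst cols_hcat_mat) (auto simp: row o_def)
    then have cols: "cols (hT (F i)) = ?vs" by (simp add: o_def)
    have FT: "hT (F i) = mat_of_cols ?n ?vs"
      using mat_of_cols_cols[of "hT (F i)"] is_zhomD(1)[OF FD[of i]] cols by simp
    have len: "mdT (cobj D i) = length ?vs"
      using carrier_matD(2)[OF is_zhomD(1)[OF FD[of i]]] cols_length[of "hT (F i)"] cols by simp
    show "w = 0\<^sub>v (mdT (cobj D i))" if w: "w \<in> carrier_vec (mdT (cobj D i))" "hT (F i) *\<^sub>v w = 0\<^sub>v ?n" for w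
    proof -
      have "hT (F i) *\<^sub>v 0\<^sub>v (mdT (cobj D i)) = 0\<^sub>v ?n"
        using is_zhomD(1)[OF FD[of i]] by (intro eq_vecI) auto
      then show ?thesis using w bij[of "0\<^sub>v ?n" i] zero_carrier_vec unfolding FT len by blast
    qed
    show "\<exists>w \<in> carrier_vec (mdT (cobj D i)). hT (F i) *\<^sub>v w = v" if "v \<in> carrier_vec ?n" for v
      using bij[OF that] unfolding FT len by blast
  qed (rule C(2))
qed

section \<open>Maps out of strips\<close>

lemma mat_mult_mat_of_cols:
  assumes "A \<in> carrier_mat r n" "set vs \<subseteq> carrier_vec n"
  shows "A * mat_of_cols n vs = mat_of_cols r (map ((*\<^sub>v) A) vs)"
proof (rule mat_col_eqI)
  fix j assume "j < dim_col (mat_of_cols r (map ((*\<^sub>v) A) vs))"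
  then have j: "j < length vs" by simp
  then have vj: "vs ! j \<in> carrier_vec n" using assms(2) by auto
  have c: "mat_of_cols n vs \<in> carrier_mat n (length vs)" by simp
  show "col (A * mat_of_cols n vs) j = col (mat_of_cols r (map ((*\<^sub>v) A) vs)) j"
    using col_mult2[OF assms(1) c j] j vj assms(1) by simp
qed (use assms in auto)

text \<open>The right factors are the matrices of F, of H and of \<open>u\<close> and
  \<open>p\<close>; several coincide, for instance \<open>mup\<close> of F with \<open>p\<close>
  from H to F at \<open>\<Theta>\<close>, and \<open>mdn\<close> of F with \<open>p\<close> from F
  to H.\<close>

lemma cols_mult_bit:
  fixes x y :: "bit vec"
  assumes "x \<in> carrier_vec n" "y \<in> carrier_vec n"
  shows "mat_of_cols n [x, y] * mat_of_rows_list 2 [[0, 1], [1, 0]] = mat_of_cols n [y, x]"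
    "mat_of_cols n [x, y] * mat_of_rows_list 1 [[1], [1]] = mat_of_cols n [x + y]"
    "mat_of_cols n [x, y] * mat_of_rows_list 2 [[1, 1], [1, 1]] = mat_of_cols n [x + y, x + y]"
    "mat_of_cols n [x] * mat_of_rows_list 2 [[1, 1]] = mat_of_cols n [x, x]"
    "mat_of_cols n [x] * mat_of_rows_list 1 [[1]] = mat_of_cols n [x]"
    "mat_of_cols n [x] * mat_of_rows_list 1 [[0]] = mat_of_cols n [0\<^sub>v n]"
  using assms
  by (auto intro!: eq_matI simp: mat_of_cols_index mat_of_rows_list_def scalar_prod_def numeral_2_eq_2 less_Suc_eq)

lemma is_zmod_basic: "is_zmod modF" "is_zmod modH" "is_zmod (zsum [])"
  unfolding is_zmod_def modF_def modH_def zsum_def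
  by (auto intro!: eq_matI simp: mat_of_rows_list_def scalar_prod_def numeral_2_eq_2 less_Suc_eq)

lemma double_column_mult:
  "mat_of_rows_list 1 [[1], [1]] *\<^sub>v vec 1 (\<lambda>_. a) = vec 2 (\<lambda>_. a :: 'a::comm_ring_1)"
  by (intro eq_vecI) (auto simp: mat_of_rows_list_def scalar_prod_def numeral_2_eq_2 less_Suc_eq)

lemma fixed_zmod_basic: "fixed_zmod modF" "fixed_zmod modH" "fixed_zmod (zsum [])"
proof -
  show "fixed_zmod modF"
    unfolding fixed_zmod_def
  proof (intro conjI ballI impI)
    fix v :: "bit vec" assume v: "v \<in> carrier_vec (mdT modF)" "mt modF *\<^sub>v v = v"
    have "(mt modF *\<^sub>v v) $ 0 = v $ 1"
      using v(1) by (simp add: modF_def mat_of_rows_list_def scalar_prod_def numeral_2_eq_2)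
    then have "v $ 0 = v $ 1" using v(2) by simp
    then have "mup modF *\<^sub>v vec 1 (\<lambda>_. v $ 0) = v"
      using v(1) double_column_mult[of "v $ 0"]
      by (intro eq_vecI) (auto simp: modF_def numeral_2_eq_2 less_Suc_eq)
    then show "\<exists>w \<in> carrier_vec (mdB modF). mup modF *\<^sub>v w = v"
      by (intro bexI[of _ "vec 1 (\<lambda>_. v $ 0)"]) (auto simp: modF_def)
  next
    fix w :: "bit vec" assume w: "w \<in> carrier_vec (mdB modF)" "mup modF *\<^sub>v w = 0\<^sub>v (mdT modF)"
    have "w = vec 1 (\<lambda>_. w $ 0)" using w(1) by (intro eq_vecI) (auto simp: modF_def)
    then have "mup modF *\<^sub>v w = vec 2 (\<lambda>_. w $ 0)" using double_column_mult[of "w $ 0"] by (simp add: modF_def)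
    then have "(mup modF *\<^sub>v w) $ 0 = w $ 0" by simp
    then have "w $ 0 = 0" using w(2) by (simp add: modF_def)
    then show "w = 0\<^sub>v (mdB modF)" using w(1) by (intro eq_vecI) (auto simp: modF_def)
  qed
  have "mup modH = 1\<^sub>m 1" by (intro eq_matI) (auto simp: modH_def mat_of_rows_list_def)
  then show "fixed_zmod modH" by (auto simp: fixed_zmod_def modH_def)
  show "fixed_zmod (zsum [])" by (rule fixed_zmod_zsum) simp
qed

lemma basic_homs: "is_zhom modF modH pFH" "is_zhom modH modF pHF" "is_zhom modF modF uFF"
  unfolding is_zhom_def modF_def modH_def pFH_def pHF_def uFF_def
  by (auto intro!: eq_matI simp: mat_of_rows_list_def scalar_prod_def numeral_2_eq_2 less_Suc_eq)

lemma zhom_zid: "is_zmod M \<Longrightarrow> is_zhom M M (zid M)"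
  using is_zmodD(1-3)[of M] by (auto simp: is_zhom_def zid_def)

lemma zhom_zzero:
  assumes "is_zmod M" "is_zmod N" shows "is_zhom M N (zzero M N)"
  using is_zmodD[OF assms(1)] is_zmodD[OF assms(2)] by (simp add: is_zhom_def zzero_def)

text \<open>F is free on one generator at \<open>\<Theta>\<close>; this is the map taking that
  generator to \<open>x\<close>. The group of F at \<open>\<bullet>\<close> is spanned by the image
  of the generator under \<open>mdn\<close>, which dictates \<open>hB\<close>.\<close>

definition homF :: "zmod \<Rightarrow> bit vec \<Rightarrow> zhom" where
  "homF M x = \<lparr>hT = mat_of_cols (mdT M) [x, mt M *\<^sub>v x], hB = mat_of_cols (mdB M) [mdn M *\<^sub>v x]\<rparr>"

text \<open>The map out of H given by a fixed vector \<open>y\<close>. On a module satisfying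
  \<open>fixed_zmod\<close> the chosen \<open>w\<close> exists and is unique.\<close>

definition homH :: "zmod \<Rightarrow> bit vec \<Rightarrow> zhom" where
  "homH M y = \<lparr>hT = mat_of_cols (mdT M) [y],
     hB = mat_of_cols (mdB M) [SOME w. w \<in> carrier_vec (mdB M) \<and> mup M *\<^sub>v w = y]\<rparr>"

lemma homF_hom:
  assumes M: "is_zmod M" and x: "x \<in> carrier_vec (mdT M)"
  shows "is_zhom modF M (homF M x)"
proof -
  note c = is_zmodD(1-3)[OF M]
  have tx: "mt M *\<^sub>v x \<in> carrier_vec (mdT M)" and nx: "mdn M *\<^sub>v x \<in> carrier_vec (mdB M)" using c x by auto
  have tt: "mt M *\<^sub>v (mt M *\<^sub>v x) = x"
    using assoc_mult_mat_vec[OF c(1) c(1) x] is_zmodD(6)[OF M] x by simp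
  have un: "mup M *\<^sub>v (mdn M *\<^sub>v x) = x + mt M *\<^sub>v x"
    using assoc_mult_mat_vec[OF c(2,3) x] is_zmodD(7)[OF M] x add_mult_distrib_mat_vec[OF one_carrier_mat c(1) x] by simp
  have nt: "mdn M *\<^sub>v (mt M *\<^sub>v x) = mdn M *\<^sub>v x"
    using assoc_mult_mat_vec[OF c(3,1) x] is_zmodD(5)[OF M] by simp
  have F: "mdT modF = 2" "mdB modF = 1" "mt modF = mat_of_rows_list 2 [[0, 1], [1, 0]]"
    "mup modF = mat_of_rows_list 1 [[1], [1]]" "mdn modF = mat_of_rows_list 2 [[1, 1]]"
    by (simp_all add: modF_def)
  have "mt M * mat_of_cols (mdT M) [x, mt M *\<^sub>v x] = mat_of_cols (mdT M) [mt M *\<^sub>v x, x]"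
    using mat_mult_mat_of_cols[OF c(1), of "[x, mt M *\<^sub>v x]"] x tx tt by simp
  moreover have "mup M * mat_of_cols (mdB M) [mdn M *\<^sub>v x] = mat_of_cols (mdT M) [x + mt M *\<^sub>v x]"
    using mat_mult_mat_of_cols[OF c(2), of "[mdn M *\<^sub>v x]"] nx un by simp
  moreover have "mdn M * mat_of_cols (mdT M) [x, mt M *\<^sub>v x] = mat_of_cols (mdB M) [mdn M *\<^sub>v x, mdn M *\<^sub>v x]"
    using mat_mult_mat_of_cols[OF c(3), of "[x, mt M *\<^sub>v x]"] x tx nt by simp
  ultimately show ?thesis
    unfolding is_zhom_def F homF_def
    using cols_mult_bit[OF x tx] cols_mult_bit(4)[OF nx nx] by (simp add: carrier_matI)
qed

lemma homH_hom:
  assumes M: "is_zmod M" "fixed_zmod M" and y: "y \<in> carrier_vec (mdT M)" "mt M *\<^sub>v y = y"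
  shows "is_zhom modH M (homH M y)"
proof -
  note c = is_zmodD(1-3)[OF M(1)]
  define w where "w = (SOME w. w \<in> carrier_vec (mdB M) \<and> mup M *\<^sub>v w = y)"
  have "\<exists>w. w \<in> carrier_vec (mdB M) \<and> mup M *\<^sub>v w = y" using M(2) y unfolding fixed_zmod_def by blast
  then have w: "w \<in> carrier_vec (mdB M)" "mup M *\<^sub>v w = y" unfolding w_def using someI_ex[of "\<lambda>w. w \<in> carrier_vec (mdB M) \<and> mup M *\<^sub>v w = y"] by auto
  \<comment> \<open>\<open>y = mup M *\<^sub>v w\<close>, and the composite of \<open>mup\<close>
    with \<open>mdn\<close> vanishes.\<close>
  have ny: "mdn M *\<^sub>v y = 0\<^sub>v (mdB M)"
  proof -
    have "mdn M *\<^sub>v y = 0\<^sub>m (mdB M) (mdB M) *\<^sub>v w"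
      using assoc_mult_mat_vec[OF c(3,2) w(1)] w(2) is_zmodD(8)[OF M(1)] by simp
    also have "\<dots> = 0\<^sub>v (mdB M)" using w(1) by (intro eq_vecI) auto
    finally show ?thesis .
  qed
  have H: "mdT modH = 1" "mdB modH = 1" "mt modH = mat_of_rows_list 1 [[1]]"
    "mup modH = mat_of_rows_list 1 [[1]]" "mdn modH = mat_of_rows_list 1 [[0]]"
    by (simp_all add: modH_def)
  have "mt M * mat_of_cols (mdT M) [y] = mat_of_cols (mdT M) [y]"
    using mat_mult_mat_of_cols[OF c(1), of "[y]"] y by simp
  moreover have "mup M * mat_of_cols (mdB M) [w] = mat_of_cols (mdT M) [y]"
    using mat_mult_mat_of_cols[OF c(2), of "[w]"] w by simp
  moreover have "mdn M * mat_of_cols (mdT M) [y] = mat_of_cols (mdB M) [0\<^sub>v (mdB M)]"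
    using mat_mult_mat_of_cols[OF c(3), of "[y]"] y ny by simp
  ultimately show ?thesis
    unfolding is_zhom_def H homH_def w_def[symmetric]
    using cols_mult_bit(5,6)[OF y(1) y(1)] cols_mult_bit(5,6)[OF w(1) w(1)] by (simp add: carrier_matI)
qed

primrec gmod :: "'c gen \<Rightarrow> zmod" where
  "gmod (GF x) = modF"
| "gmod (GH y) = modH"

primrec ghom :: "zmod \<Rightarrow> bit vec gen \<Rightarrow> zhom" where
  "ghom M (GF x) = homF M x"
| "ghom M (GH y) = homH M y"

text \<open>The last clause is met only by \<open>D(H)\<close>, the strip with two copies of H and
  no F between them.\<close>

fun glink :: "'c gen \<Rightarrow> 'd gen \<Rightarrow> zhom" where
  "glink (GF x) (GF y) = uFF"
| "glink (GF x) (GH y) = pFH"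
| "glink (GH x) (GF y) = pHF"
| "glink (GH x) (GH y) = zid modH"

definition gen_in :: "zmod \<Rightarrow> bit vec gen \<Rightarrow> bool" where
  "gen_in M g \<longleftrightarrow> gval g \<in> carrier_vec (mdT M) \<and> (\<not> is_GF g \<longrightarrow> mt M *\<^sub>v gval g = gval g)"

primrec gend :: "zmod \<Rightarrow> bit vec gen \<Rightarrow> bit vec" where
  "gend M (GF x) = x + mt M *\<^sub>v x"
| "gend M (GH y) = y"

lemma gmod_basic: "is_zmod (gmod g)" "fixed_zmod (gmod g)"
  using is_zmod_basic fixed_zmod_basic by (cases g; simp)+

lemma glink_hom: "is_zhom (gmod g) (gmod g') (glink g g')"
  using basic_homs zhom_zid[OF is_zmod_basic(2)] by (cases g; cases g') auto

lemma ghom_hom: "is_zmod M \<Longrightarrow> fixed_zmod M \<Longrightarrow> gen_in M g \<Longrightarrow> is_zhom (gmod g) M (ghom M g)"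
  using homF_hom homH_hom by (cases g) (auto simp: gen_in_def)

lemma zhom_mt_commute:
  assumes "is_zmod M" "is_zmod N" "is_zhom M N D" "x \<in> carrier_vec (mdT M)"
  shows "hT D *\<^sub>v (mt M *\<^sub>v x) = mt N *\<^sub>v (hT D *\<^sub>v x)"
  using assoc_mult_mat_vec[OF is_zhomD(1)[OF assms(3)] is_zmodD(1)[OF assms(1)]]
    assoc_mult_mat_vec[OF is_zmodD(1)[OF assms(2)] is_zhomD(1)[OF assms(3)]] is_zhomD(3)[OF assms(3)] assms(4)
  by simp

context
  fixes M N :: zmod and D :: zhom
  assumes M: "is_zmod M" "fixed_zmod M" and N: "is_zmod N" "fixed_zmod N" and D: "is_zhom M N D"
begin

lemma hT_comp_homF:
  assumes "x \<in> carrier_vec (mdT M)"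
  shows "hT (zcomp D (homF M x)) = mat_of_cols (mdT N) [hT D *\<^sub>v x, mt N *\<^sub>v (hT D *\<^sub>v x)]"
  using mat_mult_mat_of_cols[OF is_zhomD(1)[OF D], of "[x, mt M *\<^sub>v x]"] assms zhom_mt_commute[OF M(1) N(1) D assms] is_zmodD(1)[OF M(1)]
  by (simp add: zcomp_def homF_def)

lemma hT_comp_homH:
  assumes "y \<in> carrier_vec (mdT M)"
  shows "hT (zcomp D (homH M y)) = mat_of_cols (mdT N) [hT D *\<^sub>v y]"
  using mat_mult_mat_of_cols[OF is_zhomD(1)[OF D], of "[y]"] assms by (simp add: zcomp_def homH_def)

text \<open>Both composites land in a module satisfying \<open>fixed_zmod\<close>, so their matrices
  at \<open>\<Theta>\<close> decide. The assumption matches the image of the generator; when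
  \<open>g\<close> is an F, the second column matches because \<open>gend N g'\<close> is fixed by
  \<open>t\<close>.\<close>

lemma glink_commute:
  assumes g: "gen_in M g" and g': "gen_in N g'" and Dg: "hT D *\<^sub>v gval g = gend N g'"
  shows "zcomp (ghom N g') (glink g g') = zcomp D (ghom M g)"
proof (rule zhom_eqI[OF _ _ N])
  show "is_zhom (gmod g) N (zcomp (ghom N g') (glink g g'))"
    by (rule zhom_zcomp[OF glink_hom ghom_hom[OF N g'] gmod_basic(1) gmod_basic(1) N(1)])
  show "is_zhom (gmod g) N (zcomp D (ghom M g))"
    by (rule zhom_zcomp[OF ghom_hom[OF M g] D gmod_basic(1) M(1) N(1)])
  have tN: "mt N \<in> carrier_mat (mdT N) (mdT N)" by (rule is_zmodD(1)[OF N(1)])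
  have fixd: "mt N *\<^sub>v (x + mt N *\<^sub>v x) = x + mt N *\<^sub>v x" if x: "x \<in> carrier_vec (mdT N)" for x
  proof -
    have tx: "mt N *\<^sub>v x \<in> carrier_vec (mdT N)" using tN x by simp
    have "mt N *\<^sub>v (mt N *\<^sub>v x) = x" using assoc_mult_mat_vec[OF tN tN x] is_zmodD(6)[OF N(1)] x by simp
    then show ?thesis using mult_add_distrib_mat_vec[OF tN x tx] comm_add_vec[OF x tx] by simp
  qed
  show "hT (zcomp (ghom N g') (glink g g')) = hT (zcomp D (ghom M g))"
  proof (cases g; cases g')
    fix x x' assume [simp]: "g = GF x" "g' = GF x'"
    have x: "x \<in> carrier_vec (mdT M)" "x' \<in> carrier_vec (mdT N)" using g g' by (auto simp: gen_in_def)
    have tx': "mt N *\<^sub>v x' \<in> carrier_vec (mdT N)" using tN x by simp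
    show ?thesis using hT_comp_homF[OF x(1)] Dg fixd[OF x(2)] cols_mult_bit(3)[OF x(2) tx']
      by (simp add: zcomp_def homF_def uFF_def)
  next
    fix x y assume [simp]: "g = GF x" "g' = GH y"
    have x: "x \<in> carrier_vec (mdT M)" "y \<in> carrier_vec (mdT N)" "mt N *\<^sub>v y = y" using g g' by (auto simp: gen_in_def)
    show ?thesis using hT_comp_homF[OF x(1)] Dg x(3) cols_mult_bit(4)[OF x(2) x(2)]
      by (simp add: zcomp_def homH_def pFH_def)
  next
    fix y x assume [simp]: "g = GH y" "g' = GF x"
    have x: "y \<in> carrier_vec (mdT M)" "x \<in> carrier_vec (mdT N)" using g g' by (auto simp: gen_in_def)
    have tx: "mt N *\<^sub>v x \<in> carrier_vec (mdT N)" using tN x by simp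
    show ?thesis using hT_comp_homH[OF x(1)] Dg cols_mult_bit(2)[OF x(2) tx]
      by (simp add: zcomp_def homF_def pHF_def)
  next
    fix y z assume [simp]: "g = GH y" "g' = GH z"
    have x: "y \<in> carrier_vec (mdT M)" "z \<in> carrier_vec (mdT N)" using g g' by (auto simp: gen_in_def)
    show ?thesis using hT_comp_homH[OF x(1)] Dg
      by (simp add: zcomp_def homH_def zid_def modH_def)
  qed
qed

text \<open>The counterpart of \<open>glink_commute\<close> for \<open>D(F)\<close>, whose
  differential is an identity and not one of the links.\<close>

lemma square_commute:
  assumes x: "x \<in> carrier_vec (mdT M)"
  shows "zcomp (homF N (hT D *\<^sub>v x)) (zid modF) = zcomp D (homF M x)"
proof (rule zhom_eqI[OF _ _ N])
  have Dx: "hT D *\<^sub>v x \<in> carrier_vec (mdT N)" using is_zhomD(1)[OF D] x by simp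
  show "is_zhom modF N (zcomp (homF N (hT D *\<^sub>v x)) (zid modF))"
    by (rule zhom_zcomp[OF zhom_zid homF_hom[OF N(1) Dx]]) (use is_zmod_basic N in auto)
  show "is_zhom modF N (zcomp D (homF M x))"
    by (rule zhom_zcomp[OF homF_hom[OF M(1) x] D]) (use is_zmod_basic M N in auto)
  show "hT (zcomp (homF N (hT D *\<^sub>v x)) (zid modF)) = hT (zcomp D (homF M x))"
    unfolding hT_comp_homF[OF x] by (simp add: zcomp_def homF_def zid_def modF_def)
qed

lemma glast_commute:
  assumes g: "gen_in M g" and Dg: "hT D *\<^sub>v gval g = 0\<^sub>v (mdT N)"
  shows "zcomp D (ghom M g) = zzero (gmod g) N"
proof (rule zhom_eqI[OF _ _ N])
  show "is_zhom (gmod g) N (zcomp D (ghom M g))"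
    by (rule zhom_zcomp[OF ghom_hom[OF M g] D gmod_basic(1) M(1) N(1)])
  show "is_zhom (gmod g) N (zzero (gmod g) N)" by (rule zhom_zzero[OF gmod_basic(1) N(1)])
  have x: "gval g \<in> carrier_vec (mdT M)" using g by (simp add: gen_in_def)
  have t0: "mt N *\<^sub>v 0\<^sub>v (mdT N) = 0\<^sub>v (mdT N)" using is_zmodD(1)[OF N(1)] by (intro eq_vecI) auto
  show "hT (zcomp D (ghom M g)) = hT (zzero (gmod g) N)"
  proof (cases g)
    case (GF y)
    then show ?thesis using hT_comp_homF[of y] x Dg t0
      by (auto intro!: eq_matI simp: zzero_def modF_def mat_of_cols_index numeral_2_eq_2 less_Suc_eq)
  next
    case (GH y)
    then show ?thesis using hT_comp_homH[of y] x Dg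
      by (auto intro!: eq_matI simp: zzero_def modH_def mat_of_cols_index)
  qed
qed

end

section \<open>Strips as complexes and their chain maps\<close>

lemma slot_nth: "slot n xs i = (if n - int (length xs) < i \<and> i \<le> n then [xs ! nat (n - i)] else [])"
proof (induction xs arbitrary: n)
  case (Cons x xs)
  have "nat (n - i) = Suc (nat (n - 1 - i))" if "i < n" using that by simp
  then show ?case using Cons[of "n - 1"] by auto
qed simp

text \<open>The entries are families over all degrees since their target \<open>cobj C i\<close>
  varies; each is evaluated only in the degree of its slot. Outside the strip the source is the zero
  module.\<close>

definition strand_map :: "cx \<Rightarrow> int \<Rightarrow> (int \<Rightarrow> zhom) list \<Rightarrow> int \<Rightarrow> zhom" where
  "strand_map C n \<phi>s i = (case slot n \<phi>s i of [] \<Rightarrow> zzero (zsum []) (cobj C i) | \<phi> # _ \<Rightarrow> \<phi> i)"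

lemma strip_pre_cx:
  assumes len: "length Ms = Suc (length fs)"
    and M: "\<And>M. M \<in> set Ms \<Longrightarrow> is_zmod M \<and> fixed_zmod M"
    and f: "\<And>j. j < length fs \<Longrightarrow> is_zhom (Ms ! j) (Ms ! Suc j) (fs ! j)"
  shows "pre_cx (strip n Ms fs)" "fixed_zmod (cobj (strip n Ms fs) i)"
proof -
  have obj: "is_zmod (strip_obj n Ms i) \<and> fixed_zmod (strip_obj n Ms i)" for i
    using M is_zmod_basic(3) fixed_zmod_basic(3) by (auto simp: strip_obj_def)
  then show "fixed_zmod (cobj (strip n Ms fs) i)" by (simp add: strip_def)
  have "is_zhom (strip_obj n Ms i) (strip_obj n Ms (i - 1)) (cdif (strip n Ms fs) i)" for i
  proof (cases "n - int (length Ms) + 1 < i \<and> i \<le> n")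
    case True
    then have "nat (n - (i - 1)) = Suc (nat (n - i))" "nat (n - i) < length fs" using len by auto
    then show ?thesis using f[of "nat (n - i)"] True by (auto simp: strip_def strip_obj_def)
  next
    case False
    then show ?thesis using zhom_zzero obj by (auto simp: strip_def)
  qed
  then show "pre_cx (strip n Ms fs)" using obj by (simp add: pre_cx_def strip_def)
qed

lemma strip_chain_map:
  assumes C: "pre_cx C" and len: "length Ms = Suc (length fs)" "length \<phi>s = length Ms"
    and h: "\<And>j. j < length Ms \<Longrightarrow> is_zhom (Ms ! j) (cobj C (n - int j)) ((\<phi>s ! j) (n - int j))"
    and com: "\<And>j. j < length fs \<Longrightarrow> zcomp ((\<phi>s ! Suc j) (n - int j - 1)) (fs ! j) =
      zcomp (cdif C (n - int j)) ((\<phi>s ! j) (n - int j))"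
    and last: "zcomp (cdif C (n - int (length fs))) ((\<phi>s ! length fs) (n - int (length fs))) =
      zzero (Ms ! length fs) (cobj C (n - int (length fs) - 1))"
  shows "is_chain_map (strip n Ms fs) C (strand_map C n \<phi>s)"
  unfolding is_chain_map_def
proof (intro allI conjI)
  fix i
  have z0: "zsum [] = \<lparr>mdT = 0, mdB = 0, mt = 0\<^sub>m 0 0, mup = 0\<^sub>m 0 0, mdn = 0\<^sub>m 0 0\<rparr>"
    by (simp add: zsum_def)
  note zm = pre_cxD(1)[OF C] and dc = is_zhomD(1,2)[OF pre_cxD(2)[OF C]]
  have inr: "n - int (length Ms) < i \<Longrightarrow> i \<le> n \<Longrightarrow> nat (n - i) < length Ms \<and> n - int (nat (n - i)) = i" for i by auto
  show "is_zhom (cobj (strip n Ms fs) i) (cobj C i) (strand_map C n \<phi>s i)"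
  proof (cases "n - int (length Ms) < i \<and> i \<le> n")
    case True
    then show ?thesis using h[of "nat (n - i)"] inr[of i] len
      by (simp add: strip_def strip_obj_def strand_map_def slot_nth)
  next
    case False
    then show ?thesis using zhom_zzero[OF is_zmod_basic(3) zm, of i] len
      by (auto simp: strip_def strip_obj_def strand_map_def slot_nth)
  qed
  show "zcomp (strand_map C n \<phi>s (i - 1)) (cdif (strip n Ms fs) i) = zcomp (cdif C i) (strand_map C n \<phi>s i)"
  proof -
    \<comment> \<open>As \<open>fs\<close> is one shorter than \<open>Ms\<close>,
      \<open>n - length fs\<close> is the lowest degree of the strip. Its differential ends there,
      so the differential of \<open>C\<close> must kill the image, which is the hypothesis
      \<open>last\<close>.\<close>
    consider "n < i" | "i \<le> n - int (length Ms)" | "i = n - int (length fs)" | "n - int (length Ms) + 1 < i" "i \<le> n"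
      using len by linarith
    then show ?thesis
    proof cases
      case 1
      have sm: "strand_map C n \<phi>s i = zzero (zsum []) (cobj C i)" and ob: "strip_obj n Ms i = zsum []"
        using 1 by (auto simp: strand_map_def slot_nth strip_obj_def)
      have "hT (strand_map C n \<phi>s (i - 1)) \<in> carrier_mat (mdT (cobj C (i - 1))) (mdT (strip_obj n Ms (i - 1))) \<and>
        hB (strand_map C n \<phi>s (i - 1)) \<in> carrier_mat (mdB (cobj C (i - 1))) (mdB (strip_obj n Ms (i - 1)))"
      proof (cases "i - 1 = n")
        case True
        then show ?thesis using h[of 0] len is_zhomD(1,2) by (simp add: strand_map_def slot_nth strip_obj_def)
      next
        case False
        then show ?thesis using 1 by (simp add: strand_map_def slot_nth strip_obj_def zzero_def)
      qed
      then show ?thesis using 1 dc[of i] unfolding sm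
        by (auto simp: zcomp_def strip_def ob zzero_def z0 intro!: eq_matI)
    next
      case 2
      have sm: "strand_map C n \<phi>s i = zzero (zsum []) (cobj C i)" "strand_map C n \<phi>s (i - 1) = zzero (zsum []) (cobj C (i - 1))"
        and ob: "strip_obj n Ms i = zsum []" "strip_obj n Ms (i - 1) = zsum []"
        using 2 len by (auto simp: strand_map_def slot_nth strip_obj_def)
      show ?thesis using 2 dc[of i] unfolding sm
        by (auto simp: zcomp_def strip_def ob zzero_def z0 intro!: eq_matI)
    next
      case 3
      have sm: "strand_map C n \<phi>s i = (\<phi>s ! length fs) i" "strand_map C n \<phi>s (i - 1) = zzero (zsum []) (cobj C (i - 1))"
        and ob: "strip_obj n Ms i = Ms ! length fs" "strip_obj n Ms (i - 1) = zsum []"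
        using 3 len by (auto simp: strand_map_def slot_nth strip_obj_def)
      have dif: "cdif (strip n Ms fs) i = zzero (Ms ! length fs) (zsum [])"
        using 3 len by (simp add: strip_def ob[symmetric])
      have "zcomp (cdif C i) ((\<phi>s ! length fs) i) = zzero (Ms ! length fs) (cobj C (i - 1))"
        using last 3 by simp
      then show ?thesis unfolding sm dif
        by (auto simp: zcomp_def zzero_def z0 scalar_prod_def intro!: eq_matI)
    next
      case 4
      define j where "j = nat (n - i)"
      have j: "j < length fs" "n - int j = i" "nat (n - (i - 1)) = Suc j" using 4 len by (auto simp: j_def)
      have sm: "strand_map C n \<phi>s i = (\<phi>s ! j) i" "strand_map C n \<phi>s (i - 1) = (\<phi>s ! Suc j) (i - 1)"
        using 4 len j by (auto simp: strand_map_def slot_nth j_def)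
      have "cdif (strip n Ms fs) i = fs ! j" using 4 by (simp add: strip_def j_def)
      then show ?thesis using com[OF j(1)] unfolding sm j(2) by simp
    qed
  qed
qed

lemma cx_shift_strip: "cx_shift s (strip n Ms fs) = strip (n + s) Ms fs"
  by (auto simp: cx_shift_def strip_def strip_obj_def fun_eq_iff algebra_simps)

lemma strip_shape_basic:
  assumes "strip_shape gs"
  shows "\<exists>s X. basic_cx X \<and> cx_shift s X = strip n (map gmod gs) (map2 glink gs (tl gs))"
proof -
  \<comment> \<open>Modules and links depend only on the constructors, so both lists are computed
    from the list of Booleans in \<open>strip_shape\<close>.\<close>
  define m where "m b = (if b then modF else modH)" for b
  define l where "l b b' = (if b then if b' then uFF else pFH else if b' then pHF else zid modH)" for b b'
  obtain a b k where ne: "gs \<noteq> []" and sh: "map is_GF gs =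
     (if a then [False] else []) @ replicate k True @ (if b then [False] else [])" (is "_ = ?bs")
    using assms by (auto simp: strip_shape_def)
  have gm: "gmod g = m (is_GF g)" for g :: "'a gen" by (cases g) (auto simp: m_def)
  have gl: "glink g g' = l (is_GF g) (is_GF g')" for g g' :: "'a gen" by (cases g; cases g') (auto simp: l_def)
  have Ms: "map gmod gs = map m ?bs" unfolding sh[symmetric] by (simp add: gm)
  have "map2 l ?bs (tl ?bs) = map2 glink gs (tl gs)"
    unfolding sh[symmetric] map_tl[symmetric] by (simp add: zip_map_map gl o_def case_prod_beta)
  note fs = this[symmetric]
  have mr: "map m (replicate k True) = replicate k modF" for k by (simp add: m_def)
  have l0: "l False True = pHF" by (simp add: l_def)
  have lr: "map2 l (replicate (Suc k) True @ [False]) (replicate k True @ [False]) = replicate k uFF @ [pFH]" for k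
  proof -
    have "replicate (Suc k) True @ [False] = replicate k True @ [True, False]" by (simp add: replicate_append_same)
    then show ?thesis by (simp add: l_def)
  qed
  have lr': "map2 l (replicate (Suc k) True) (replicate k True) = replicate k uFF" for k
    by (simp add: l_def zip_replicate del: replicate.simps)
  \<comment> \<open>It suffices to recognise the strip at one top degree. The cases below use the
    degree in which each definition puts its first module: \<open>k'\<close> for \<open>A\<close>,
    \<open>k\<close> for \<open>H(-k)\<close>, 0 for \<open>H(k)\<close> and \<open>B\<close>, and 1
    for \<open>D(H)\<close>.\<close>
  have *: "\<exists>s X. basic_cx X \<and> cx_shift s X = strip n Ms fs" if "basic_cx (strip i Ms fs)" for i Ms fs
    using that by (intro exI[of _ "n - i"] exI[of _ "strip i Ms fs"]) (simp add: cx_shift_strip)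
  show ?thesis
  proof (cases a; cases b)
    assume ab: "\<not> a" "\<not> b"
    then obtain k' where k: "k = Suc k'" using sh ne by (cases k) auto
    have "strip (int k') (map gmod gs) (map2 glink gs (tl gs)) = cxA k'"
      unfolding Ms fs using ab lr'[of k'] mr[of "Suc k'"] by (simp add: k cxA_def del: zip_replicate)
    then show ?thesis by (intro *[of "int k'"]) (auto simp: basic_cx_def)
  next
    assume ab: "a" "\<not> b"
    have "strip (int k) (map gmod gs) (map2 glink gs (tl gs)) = cxH (- int k)"
    proof (cases k)
      case 0
      then show ?thesis unfolding Ms fs using ab by (simp add: cxH_def m_def)
    next
      case (Suc k')
      then show ?thesis unfolding Ms fs using ab lr'[of k'] by (simp add: cxH_def m_def l0 nat_add_distrib add.commute del: zip_replicate)
    qed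
    then show ?thesis by (intro *[of "int k"]) (auto simp: basic_cx_def)
  next
    assume ab: "\<not> a" "b"
    have "strip 0 (map gmod gs) (map2 glink gs (tl gs)) = cxH (int k)"
    proof (cases k)
      case 0
      then show ?thesis unfolding Ms fs using ab by (simp add: cxH_def m_def)
    next
      case (Suc k')
      then show ?thesis unfolding Ms fs using ab lr[of k'] by (simp add: cxH_def m_def nat_add_distrib)
    qed
    then show ?thesis by (intro *[of 0]) (auto simp: basic_cx_def)
  next
    assume ab: "a" "b"
    show ?thesis
    proof (cases k)
      case 0
      have "strip 1 (map gmod gs) (map2 glink gs (tl gs)) = cxD modH"
        unfolding Ms fs using ab 0 by (simp add: cxD_def m_def l_def)
      then show ?thesis by (intro *[of 1]) (auto simp: basic_cx_def)
    next
      case (Suc k')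
      have "strip 0 (map gmod gs) (map2 glink gs (tl gs)) = cxB k'"
        unfolding Ms fs using ab lr[of k'] Suc by (simp add: cxB_def m_def l0)
      then show ?thesis by (intro *[of 0]) (auto simp: basic_cx_def)
    qed
  qed
qed

section \<open>The complex as a pair of commuting operators\<close>

lemma (in linear_endo_pair) basis_list_coordinates:
  assumes "basis_list T vs" "x \<in> T"
  shows "\<exists>!w. w \<in> carrier_vec (length vs) \<and> (\<Sum>l<length vs. scale (w $ l) (vs ! l)) = x"
proof -
  have vs: "distinct vs" "independent (set vs)" "span (set vs) = T"
    using assms(1) by (auto simp: basis_list_def independent_list_def)
  have bij: "bij_betw ((!) vs) {..<length vs} (set vs)" using bij_betw_nth[OF vs(1) refl refl] .
  have re: "(\<Sum>l<length vs. scale (c (vs ! l)) (vs ! l)) = (\<Sum>b\<in>set vs. scale (c b) b)" for c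
    using sum.reindex_bij_betw[OF bij, of "\<lambda>b. scale (c b) b"] .
  obtain c where c: "x = (\<Sum>b\<in>set vs. scale (c b) b)"
    using assms(2) vs(3) span_finite[of "set vs"] by auto
  show ?thesis
  proof (rule ex1I[of _ "vec (length vs) (\<lambda>l. c (vs ! l))"])
    show "vec (length vs) (\<lambda>l. c (vs ! l)) \<in> carrier_vec (length vs) \<and>
      (\<Sum>l<length vs. scale (vec (length vs) (\<lambda>l. c (vs ! l)) $ l) (vs ! l)) = x"
      using re[of c] c by simp
    fix w assume w: "w \<in> carrier_vec (length vs) \<and> (\<Sum>l<length vs. scale (w $ l) (vs ! l)) = x"
    define e where "e b = w $ inv_into {..<length vs} ((!) vs) b - c b" for b
    have ide: "e (vs ! l) = w $ l - c (vs ! l)" if "l < length vs" for l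
      using bij that by (simp add: e_def bij_betw_def)
    have "(\<Sum>b\<in>set vs. scale (e b) b) = (\<Sum>l<length vs. scale (w $ l - c (vs ! l)) (vs ! l))"
      unfolding re[symmetric] by (rule sum.cong) (simp_all add: ide)
    also have "\<dots> = 0" using w c re[of c] by (simp add: scale_left_diff_distrib sum_subtractf)
    finally have "e b = 0" if "b \<in> set vs" for b
      using vs(2) that dependent_finite[of "set vs"] by auto
    then have "w $ l = c (vs ! l)" if "l < length vs" for l using ide[OF that] that by simp
    then show "w = vec (length vs) (\<lambda>l. c (vs ! l))" using w by (intro eq_vecI) auto
  qed
qed

lemma slot_map: "slot n (map h xs) i = map h (slot n xs i)"
  by (induction xs arbitrary: n) auto

lemma gmod_map_gen [simp]: "gmod (map_gen h g) = gmod g"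
  by (cases g) auto

lemma glink_map_gen [simp]: "glink (map_gen h g) (map_gen h' g') = glink g g'"
  by (cases g; cases g') auto

lemma finite_carrier_vec_bit: "finite (carrier_vec n :: bit vec set)"
proof -
  have "(UNIV :: bit set) = {0, 1}" using bit_not_zero_iff by blast
  then have "finite (UNIV :: bit set)" by (metis finite.emptyI finite_insert)
  then have "finite {xs :: bit list. length xs = n}" using finite_lists_length_eq[of UNIV n] by simp
  moreover have "carrier_vec n \<subseteq> vec_of_list ` {xs :: bit list. length xs = n}"
    by (auto intro!: image_eqI[of _ _ "list_of_vec _"] simp: vec_list)
  ultimately show ?thesis using finite_surj by blast
qed

lemma bit_vec_add_self: "(x :: bit vec) \<in> carrier_vec n \<Longrightarrow> y \<in> carrier_vec n \<Longrightarrow> x + (x + y) = y"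
  by (intro eq_vecI) auto

text \<open>The type \<open>bit vec\<close> contains vectors of all lengths and so has no common
  zero, whereas the locale needs an abelian group type; functions into \<open>bit\<close> provide
  one.\<close>

definition fscale :: "bit \<Rightarrow> ('p \<Rightarrow> bit) \<Rightarrow> 'p \<Rightarrow> bit" where
  "fscale c f = (\<lambda>p. c * f p)"

lemma vector_space_fscale: "vector_space fscale"
  by unfold_locales (auto simp: fscale_def fun_eq_iff algebra_simps)

lemma sum_fun_apply: "(\<Sum>l\<in>A. f l) p = (\<Sum>l\<in>A. f l p :: bit)"
  by (induction A rule: infinite_finite_induct) auto

text \<open>All the groups \<open>C\<^sub>i\<close> evaluated at \<open>\<Theta>\<close> are placed in one vector space, the coordinate
  \<open>(i, k)\<close> being the \<open>k\<close>-th coordinate in degree \<open>i\<close>.\<close>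

definition ret :: "cx \<Rightarrow> int \<Rightarrow> (int \<times> nat \<Rightarrow> bit) \<Rightarrow> bit vec" where
  "ret C i f = vec (mdT (cobj C i)) (\<lambda>k. f (i, k))"

definition emb :: "cx \<Rightarrow> int \<Rightarrow> bit vec \<Rightarrow> int \<times> nat \<Rightarrow> bit" where
  "emb C i v = (\<lambda>(j, k). if j = i \<and> k < mdT (cobj C i) then v $ k else 0)"

definition glue :: "cx \<Rightarrow> (int \<Rightarrow> bit vec) \<Rightarrow> int \<times> nat \<Rightarrow> bit" where
  "glue C w = (\<lambda>(j, k). if k < mdT (cobj C j) then w j $ k else 0)"

definition theta_u :: "cx \<Rightarrow> (int \<times> nat \<Rightarrow> bit) \<Rightarrow> int \<times> nat \<Rightarrow> bit" where
  "theta_u C f = glue C (\<lambda>j. (1\<^sub>m (mdT (cobj C j)) + mt (cobj C j)) *\<^sub>v ret C j f)"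

definition theta_d :: "cx \<Rightarrow> (int \<times> nat \<Rightarrow> bit) \<Rightarrow> int \<times> nat \<Rightarrow> bit" where
  "theta_d C f = glue C (\<lambda>j. hT (cdif C (j + 1)) *\<^sub>v ret C (j + 1) f)"

definition theta_V :: "cx \<Rightarrow> int \<Rightarrow> (int \<times> nat \<Rightarrow> bit) set" where
  "theta_V C i = emb C i ` carrier_vec (mdT (cobj C i))"

lemma ret_carrier [simp]: "ret C i f \<in> carrier_vec (mdT (cobj C i))"
  by (simp add: ret_def)

lemma ret_emb: "v \<in> carrier_vec (mdT (cobj C i)) \<Longrightarrow> ret C j (emb C i v) = (if j = i then v else 0\<^sub>v (mdT (cobj C j)))"
  by (intro eq_vecI) (auto simp: ret_def emb_def)

lemma ret_glue: "w i \<in> carrier_vec (mdT (cobj C i)) \<Longrightarrow> ret C i (glue C w) = w i"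
  by (intro eq_vecI) (auto simp: ret_def glue_def)

lemma ret_add: "ret C i (f + g) = ret C i f + ret C i g"
  by (intro eq_vecI) (auto simp: ret_def)

lemma ret_fscale: "ret C i (fscale c f) = c \<cdot>\<^sub>v ret C i f"
  by (intro eq_vecI) (auto simp: ret_def fscale_def)

lemma emb_add: "v \<in> carrier_vec (mdT (cobj C i)) \<Longrightarrow> w \<in> carrier_vec (mdT (cobj C i)) \<Longrightarrow>
    emb C i v + emb C i w = emb C i (v + w)"
  by (auto simp: emb_def fun_eq_iff)

lemma emb_fscale: "v \<in> carrier_vec (mdT (cobj C i)) \<Longrightarrow> fscale c (emb C i v) = emb C i (c \<cdot>\<^sub>v v)"
  by (auto simp: emb_def fscale_def fun_eq_iff)

lemma emb_zero: "emb C i (0\<^sub>v (mdT (cobj C i))) = 0"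
  by (auto simp: emb_def fun_eq_iff)

lemma glue_single:
  assumes "\<And>j. j \<noteq> i \<Longrightarrow> w j = 0\<^sub>v (mdT (cobj C j))"
  shows "glue C w = emb C i (w i)"
proof (rule ext, clarify)
  fix j k
  show "glue C w (j, k) = emb C i (w i) (j, k)"
    by (cases "j = i") (auto simp: glue_def emb_def assms)
qed

lemma mult_mat_vec_zero: "A \<in> carrier_mat r c \<Longrightarrow> A *\<^sub>v 0\<^sub>v c = (0\<^sub>v r :: bit vec)"
  by (intro eq_vecI) auto

context
  fixes C :: cx
  assumes C: "pre_cx C"
begin

lemma mt_C: "mt (cobj C i) \<in> carrier_mat (mdT (cobj C i)) (mdT (cobj C i))"
  by (rule is_zmodD(1)[OF pre_cxD(1)[OF C]])

lemma dif_C: "hT (cdif C i) \<in> carrier_mat (mdT (cobj C (i - 1))) (mdT (cobj C i))"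
  by (rule is_zhomD(1)[OF pre_cxD(2)[OF C]])

lemma dif_C': "hT (cdif C (i + 1)) \<in> carrier_mat (mdT (cobj C i)) (mdT (cobj C (i + 1)))"
  using dif_C[of "i + 1"] by simp

lemma one_mt_mult:
  "v \<in> carrier_vec (mdT (cobj C i)) \<Longrightarrow>
    (1\<^sub>m (mdT (cobj C i)) + mt (cobj C i)) *\<^sub>v v = v + mt (cobj C i) *\<^sub>v v"
  using add_mult_distrib_mat_vec[OF one_carrier_mat mt_C] by simp

lemma ret_u: "ret C i (theta_u C f) = ret C i f + mt (cobj C i) *\<^sub>v ret C i f"
  unfolding theta_u_def using mt_C[of i] by (subst ret_glue) (auto simp: one_mt_mult)

lemma ret_d: "ret C (i - 1) (theta_d C f) = hT (cdif C i) *\<^sub>v ret C i f"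
  unfolding theta_d_def using mult_mat_vec_carrier[OF dif_C[of i] ret_carrier] by (subst ret_glue) auto

lemma u_emb:
  assumes "v \<in> carrier_vec (mdT (cobj C i))"
  shows "theta_u C (emb C i v) = emb C i (v + mt (cobj C i) *\<^sub>v v)"
  unfolding theta_u_def using assms mt_C one_mt_mult[OF assms]
  by (subst glue_single[of i]) (auto simp: ret_emb mult_mat_vec_zero)

lemma d_emb:
  assumes "v \<in> carrier_vec (mdT (cobj C i))"
  shows "theta_d C (emb C i v) = emb C (i - 1) (hT (cdif C i) *\<^sub>v v)"
  unfolding theta_d_def using assms dif_C'
  by (subst glue_single[of "i - 1"]) (auto simp: ret_emb mult_mat_vec_zero)

lemma linear_theta:
  "Vector_Spaces.linear fscale fscale (theta_d C)" "Vector_Spaces.linear fscale fscale (theta_u C)"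
proof -
  have *: "Vector_Spaces.linear fscale fscale (\<lambda>f. glue C (\<lambda>j. A j *\<^sub>v ret C (h j) f))"
    if A: "\<And>j. A j \<in> carrier_mat (mdT (cobj C j)) (mdT (cobj C (h j)))" for A h
    unfolding Vector_Spaces.linear_iff
  proof (intro conjI allI)
    fix f g :: "int \<times> nat \<Rightarrow> bit" and c
    show "glue C (\<lambda>j. A j *\<^sub>v ret C (h j) (f + g)) =
      glue C (\<lambda>j. A j *\<^sub>v ret C (h j) f) + glue C (\<lambda>j. A j *\<^sub>v ret C (h j) g)"
      using carrier_matD(1)[OF A]
      by (auto simp: fun_eq_iff glue_def ret_add mult_add_distrib_mat_vec[OF A ret_carrier ret_carrier]
          simp del: index_mult_mat_vec)
    show "glue C (\<lambda>j. A j *\<^sub>v ret C (h j) (fscale c f)) = fscale c (glue C (\<lambda>j. A j *\<^sub>v ret C (h j) f))"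
      unfolding ret_fscale mult_mat_vec[OF A ret_carrier] using carrier_matD(1)[OF A]
      by (auto simp: fun_eq_iff glue_def fscale_def simp del: index_mult_mat_vec)
  qed (rule vector_space_fscale)+
  show "Vector_Spaces.linear fscale fscale (theta_d C)"
    unfolding theta_d_def[abs_def] by (rule *) (rule dif_C')
  show "Vector_Spaces.linear fscale fscale (theta_u C)"
    unfolding theta_u_def[abs_def] using mt_C by (intro *) auto
qed

interpretation P: linear_endo_pair fscale "theta_d C" "theta_u C"
  using vector_space_fscale linear_theta by (intro linear_endo_pair.intro linear_endo_pair_axioms.intro)

text \<open>\<open>1 + t\<close> squares to zero because \<open>t\<close> squares to 1 in
  characteristic 2, and it commutes with \<open>d\<close> because the differentials are module
  maps.\<close>

lemma bicomplex_theta: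
  assumes "is_cx C" "\<And>i. int N < \<bar>i\<bar> \<Longrightarrow> mdT (cobj C i) = 0"
  shows "P.bicomplex N (theta_V C)"
  unfolding P.bicomplex_def
proof (intro allI conjI impI ballI)
  fix i
  let ?n = "mdT (cobj C i)"
  show "P.subspace (theta_V C i)"
  proof (rule P.subspaceI)
    show "0 \<in> theta_V C i" unfolding theta_V_def using emb_zero[of C i] by (metis imageI zero_carrier_vec)
    show "x + y \<in> theta_V C i" if "x \<in> theta_V C i" "y \<in> theta_V C i" for x y
      using that by (auto simp: theta_V_def emb_add)
    show "fscale c x \<in> theta_V C i" if "x \<in> theta_V C i" for x c
      using that by (auto simp: theta_V_def emb_fscale)
  qed
  show "finite (theta_V C i)" unfolding theta_V_def using finite_carrier_vec_bit by (rule finite_imageI)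
  show "theta_V C i = {0}" if "int N < \<bar>i\<bar>"
    using assms(2)[OF that] by (auto simp: theta_V_def emb_def fun_eq_iff image_iff intro: zero_carrier_vec)
  fix x assume "x \<in> theta_V C i"
  then obtain v where v: "v \<in> carrier_vec ?n" and x: "x = emb C i v" by (auto simp: theta_V_def)
  note t = mt_C[of i] and Dc = dif_C[of i] and Dc2 = dif_C[of "i - 1"]
  have tv: "mt (cobj C i) *\<^sub>v v \<in> carrier_vec ?n" using t v by simp
  have Dv: "hT (cdif C i) *\<^sub>v v \<in> carrier_vec (mdT (cobj C (i - 1)))" using Dc v by simp
  have uv: "v + mt (cobj C i) *\<^sub>v v \<in> carrier_vec ?n" using v tv by simp
  show "theta_u C x \<in> theta_V C i" unfolding x u_emb[OF v] theta_V_def using uv by simp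
  show "theta_d C x \<in> theta_V C (i - 1)" unfolding x d_emb[OF v] theta_V_def using Dv by simp
  show "theta_u C (theta_u C x) = 0"
  proof -
    have "mt (cobj C i) *\<^sub>v (mt (cobj C i) *\<^sub>v v) = v"
      using assoc_mult_mat_vec[OF t t v] is_zmodD(6)[OF pre_cxD(1)[OF C]] v by simp
    then have "mt (cobj C i) *\<^sub>v (v + mt (cobj C i) *\<^sub>v v) = mt (cobj C i) *\<^sub>v v + v"
      using mult_add_distrib_mat_vec[OF t v tv] by simp
    then have "(v + mt (cobj C i) *\<^sub>v v) + mt (cobj C i) *\<^sub>v (v + mt (cobj C i) *\<^sub>v v) = 0\<^sub>v ?n"
      using v tv by (intro eq_vecI) (auto simp: algebra_simps simp del: index_mult_mat_vec)
    then show ?thesis unfolding x u_emb[OF v] u_emb[OF uv] by (simp add: emb_zero)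
  qed
  show "theta_d C (theta_d C x) = 0"
  proof -
    have "zcomp (cdif C (i - 1)) (cdif C i) = zzero (cobj C i) (cobj C (i - 2))"
      using assms(1) by (simp add: is_cx_def)
    then have "hT (cdif C (i - 1)) * hT (cdif C i) = 0\<^sub>m (mdT (cobj C (i - 1 - 1))) ?n"
      by (simp add: zcomp_def zzero_def)
    moreover have "0\<^sub>m r ?n *\<^sub>v v = 0\<^sub>v r" for r using v by (intro eq_vecI) auto
    ultimately have "hT (cdif C (i - 1)) *\<^sub>v (hT (cdif C i) *\<^sub>v v) = 0\<^sub>v (mdT (cobj C (i - 1 - 1)))"
      using assoc_mult_mat_vec[OF Dc2 Dc v] by simp
    then show ?thesis unfolding x d_emb[OF v] d_emb[OF Dv] by (simp add: emb_zero del: diff_diff_eq)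
  qed
  show "theta_u C (theta_d C x) = theta_d C (theta_u C x)"
  proof -
    have "hT (cdif C i) *\<^sub>v (mt (cobj C i) *\<^sub>v v) = mt (cobj C (i - 1)) *\<^sub>v (hT (cdif C i) *\<^sub>v v)"
      by (rule zhom_mt_commute[OF pre_cxD(1)[OF C] pre_cxD(1)[OF C] pre_cxD(2)[OF C] v])
    then show ?thesis
      unfolding x d_emb[OF v] u_emb[OF v] u_emb[OF Dv] d_emb[OF uv] mult_add_distrib_mat_vec[OF Dc v tv] by simp
  qed
qed

text \<open>The second column of \<open>homF\<close> is \<open>t x = x + u x\<close>, the second
  vector in \<open>gcols\<close>; this is where the abstract basis meets the matrices.\<close>

lemma cols_strand_map:
  "cols (hT (strand_map C n (map (\<lambda>g i. ghom (cobj C i) (map_gen (ret C i) g)) gs) i)) =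
    map (ret C i) (concat (map P.gcols (slot n gs i)))"
proof (cases "slot n gs i")
  case Nil
  then show ?thesis by (simp add: strand_map_def slot_map zzero_def zsum_def cols_def)
next
  case (Cons g gs')
  then have s: "slot n gs i = [g]" by (auto simp: slot_nth split: if_splits)
  have tx: "mt (cobj C i) *\<^sub>v ret C i x \<in> carrier_vec (mdT (cobj C i))" for x using mt_C[of i] by simp
  show ?thesis
    unfolding strand_map_def slot_map s using tx
    by (cases g) (auto simp: homF_def homH_def ret_add ret_u bit_vec_add_self[OF ret_carrier tx])
qed

text \<open>The combinatorial conditions in \<open>zigzag\<close> and \<open>square\<close> are
  exactly the commutation conditions for mapping the corresponding strip to \<open>C\<close> by its
  generators.\<close>

lemma strand_hom:
  assumes fixd: "\<And>i. fixed_zmod (cobj C i)" and gs: "P.zigzag gs \<or> P.square gs"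
  shows "\<exists>s X. basic_cx X \<and> pre_cx (cx_shift s X) \<and> (\<forall>i. fixed_zmod (cobj (cx_shift s X) i)) \<and>
    is_chain_map (cx_shift s X) C (strand_map C n (map (\<lambda>g i. ghom (cobj C i) (map_gen (ret C i) g)) gs))"
proof -
  note zm = pre_cxD(1)[OF C]
  let ?g = "\<lambda>i. map_gen (ret C i)"
  have gval: "gval (?g i g) = ret C i (gval g)" for i g by (cases g) auto
  have gmodM: "is_zmod M \<and> fixed_zmod M" if "M \<in> set (map gmod gs)" for M using that gmod_basic by auto
  have ret0: "ret C i 0 = 0\<^sub>v (mdT (cobj C i))" for i by (intro eq_vecI) (auto simp: ret_def)
  \<comment> \<open>In characteristic 2, \<open>u y = 0\<close> means \<open>t y = y\<close>, as a
    map out of H requires.\<close>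
  have gen_in: "gen_in (cobj C i) (?g i g)" if "g \<in> set gs" for i g
  proof (cases g)
    case (GH y)
    have "theta_u C y = 0" using gs that GH by (auto simp: P.zigzag_def P.square_def)
    then have "ret C i y + mt (cobj C i) *\<^sub>v ret C i y = 0\<^sub>v (mdT (cobj C i))" using ret_u[of i y] ret0 by simp
    then have "ret C i y + (ret C i y + mt (cobj C i) *\<^sub>v ret C i y) = ret C i y" by simp
    moreover have "ret C i y + (ret C i y + mt (cobj C i) *\<^sub>v ret C i y) = mt (cobj C i) *\<^sub>v ret C i y"
      using bit_vec_add_self[OF ret_carrier mult_mat_vec_carrier[OF mt_C ret_carrier]] .
    ultimately show ?thesis using GH by (simp add: gen_in_def)
  qed (simp add: gen_in_def)
  have nth_in: "gs ! j \<in> set gs" if "j < length gs" for j using that by simp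
  have hom: "is_zhom (gmod g) (cobj C i) (ghom (cobj C i) (?g i g))" if "g \<in> set gs" for i g
    using ghom_hom[OF zm fixd gen_in[OF that]] by simp
  let ?phis = "map (\<lambda>g i. ghom (cobj C i) (?g i g)) gs"
  have lastc: "zcomp (cdif C i) (ghom (cobj C i) (?g i g)) = zzero (gmod g) (cobj C (i - 1))"
    if "g \<in> set gs" "theta_d C (gval g) = 0" for i g
    using glast_commute[OF zm fixd zm fixd pre_cxD(2)[OF C] gen_in[OF that(1)]] that(2) ret_d[of i "gval g"] ret0
    by (simp add: gval)
  show ?thesis
  proof (cases "P.zigzag gs")
    case True
    then have sh: "strip_shape gs" and suc: "successively (\<lambda>g g'. theta_d C (gval g) = P.gtarget g') gs"
      and lst: "theta_d C (gval (last gs)) = 0" by (auto simp: P.zigzag_def)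
    have ne: "gs \<noteq> []" using sh by (simp add: strip_shape_def)
    let ?fs = "map2 glink gs (tl gs)"
    have len: "length (map gmod gs) = Suc (length ?fs)" "length gs = Suc (length ?fs)" using ne by (cases gs; simp)+
    have fs: "?fs ! j = glink (gs ! j) (gs ! Suc j)" if "j < length ?fs" for j
      using that by (simp add: nth_tl)
    obtain s X where X: "basic_cx X" "cx_shift s X = strip n (map gmod gs) ?fs" using strip_shape_basic[OF sh] by blast
    have "is_zhom (map gmod gs ! j) (map gmod gs ! Suc j) (?fs ! j)" if "j < length ?fs" for j
      using that len(2) fs[OF that] glink_hom[of "gs ! j" "gs ! Suc j"] by (simp del: length_map)
    note pre = strip_pre_cx[OF len(1) gmodM this]
    have "is_chain_map (strip n (map gmod gs) ?fs) C (strand_map C n ?phis)"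
    proof (rule strip_chain_map[OF C len(1)])
      show "is_zhom (map gmod gs ! j) (cobj C (n - int j)) ((?phis ! j) (n - int j))" if "j < length (map gmod gs)" for j
        using hom[OF nth_in] that by simp
      show "zcomp ((?phis ! Suc j) (n - int j - 1)) (?fs ! j) = zcomp (cdif C (n - int j)) ((?phis ! j) (n - int j))"
        if j: "j < length ?fs" for j
      proof -
        have jl: "j < length gs" "Suc j < length gs" using j len(2) by linarith+
        have "theta_d C (gval (gs ! j)) = P.gtarget (gs ! Suc j)"
          using suc jl by (simp add: successively_conv_nth)
        moreover have "ret C i (P.gtarget g) = gend (cobj C i) (?g i g)" for i g by (cases g) (auto simp: ret_u)
        ultimately have "hT (cdif C (n - int j)) *\<^sub>v gval (?g (n - int j) (gs ! j)) =
            gend (cobj C (n - int j - 1)) (?g (n - int j - 1) (gs ! Suc j))"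
          using ret_d[of "n - int j" "gval (gs ! j)"] by (simp add: gval)
        from glink_commute[OF zm fixd zm fixd pre_cxD(2)[OF C] gen_in[OF nth_in[OF jl(1)]] gen_in[OF nth_in[OF jl(2)]] this]
        show ?thesis using jl fs[OF j] by simp
      qed
      show "zcomp (cdif C (n - int (length ?fs))) ((?phis ! length ?fs) (n - int (length ?fs))) =
        zzero (map gmod gs ! length ?fs) (cobj C (n - int (length ?fs) - 1))"
      proof -
        define m where "m = length ?fs"
        have m: "m < length gs" "gs ! m = last gs" using len(2) ne last_conv_nth[OF ne] by (simp_all add: m_def)
        show ?thesis unfolding m_def[symmetric] using lastc[of "last gs"] lst m last_in_set[OF ne] by simp
      qed
    qed simp
    then show ?thesis using X pre by (intro exI[of _ s] exI[of _ X]) simp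
  next
    case False
    then obtain x where gx: "gs = [GF x, GF (theta_d C x)]" and ddx: "theta_d C (theta_d C x) = 0"
      using gs by (auto simp: P.square_def)
    \<comment> \<open>The top of \<open>cxD\<close> lies in degree 1, hence the shift by
      \<open>n - 1\<close>.\<close>
    have X: "cx_shift (n - 1) (cxD modF) = strip n [modF, modF] [zid modF]" by (simp add: cxD_def cx_shift_strip)
    have pre: "pre_cx (strip n [modF, modF] [zid modF])" by (rule strip_pre_cx) (use is_zmod_basic fixed_zmod_basic zhom_zid in auto)
    have prefix: "fixed_zmod (cobj (strip n [modF, modF] [zid modF]) i)" for i
      by (rule strip_pre_cx) (use is_zmod_basic fixed_zmod_basic zhom_zid in auto)
    have "is_chain_map (strip n [modF, modF] [zid modF]) C (strand_map C n ?phis)"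
    proof (rule strip_chain_map[OF C])
      show "is_zhom ([modF, modF] ! j) (cobj C (n - int j)) ((?phis ! j) (n - int j))" if "j < length [modF, modF]" for j
        using hom[OF nth_in[of j]] that by (auto simp: gx less_Suc_eq)
      show "zcomp ((?phis ! Suc j) (n - int j - 1)) ([zid modF] ! j) = zcomp (cdif C (n - int j)) ((?phis ! j) (n - int j))"
        if "j < length [zid modF]" for j
        using that square_commute[OF zm fixd zm fixd pre_cxD(2)[OF C] ret_carrier, of n x] ret_d[of n x] by (simp add: gx)
      show "zcomp (cdif C (n - int (length [zid modF]))) ((?phis ! length [zid modF]) (n - int (length [zid modF]))) =
        zzero ([modF, modF] ! length [zid modF]) (cobj C (n - int (length [zid modF]) - 1))"
        using lastc[of "GF (theta_d C x)" "n - 1"] ddx by (simp add: gx)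
    qed (simp_all add: gx)
    then show ?thesis using X pre prefix by (intro exI[of _ "n - 1"] exI[of _ "cxD modF"]) (simp add: basic_cx_def)
  qed
qed

text \<open>\<open>emb\<close> turns the matrix product into a linear combination of basis vectors,
  so unique coordinates in the function space become unique solvability of the matrix
  equation.\<close>

lemma basis_list_bijective:
  assumes B: "P.basis_list (theta_V C i) vs" and v: "v \<in> carrier_vec (mdT (cobj C i))"
  shows "\<exists>!w. w \<in> carrier_vec (length vs) \<and> mat_of_cols (mdT (cobj C i)) (map (ret C i) vs) *\<^sub>v w = v"
proof -
  let ?n = "mdT (cobj C i)" let ?A = "mat_of_cols ?n (map (ret C i) vs)"
  have vsV: "x \<in> theta_V C i" if "x \<in> set vs" for x
    using B that P.span_base by (auto simp: P.basis_list_def)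
  have emb: "emb C i (?A *\<^sub>v w) = (\<Sum>l<length vs. fscale (w $ l) (vs ! l))" if w: "w \<in> carrier_vec (length vs)" for w
  proof (rule ext, clarify)
    fix j k
    show "emb C i (?A *\<^sub>v w) (j, k) = (\<Sum>l<length vs. fscale (w $ l) (vs ! l)) (j, k)"
    proof (cases "j = i \<and> k < ?n")
      case True
      then have "emb C i (?A *\<^sub>v w) (j, k) = (\<Sum>l<length vs. (vs ! l) (i, k) * w $ l)"
        using w by (auto simp: emb_def scalar_prod_def mat_of_cols_index ret_def lessThan_atLeast0 intro!: sum.cong)
      then show ?thesis using conjunct1[OF True] by (simp only: sum_fun_apply fscale_def mult.commute)
    next
      case False
      have "(vs ! l) (j, k) = 0" if "l < length vs" for l
        using vsV[of "vs ! l"] that False by (auto simp: theta_V_def emb_def)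
      then show ?thesis using False by (auto simp: sum_fun_apply fscale_def emb_def)
    qed
  qed
  have "?A *\<^sub>v w = v \<longleftrightarrow> (\<Sum>l<length vs. fscale (w $ l) (vs ! l)) = emb C i v" if w: "w \<in> carrier_vec (length vs)" for w
  proof -
    have "?A *\<^sub>v w \<in> carrier_vec ?n" using mult_mat_vec_carrier[of ?A ?n "length vs" w] w by (simp add: carrier_matI)
    then show ?thesis using emb[OF w] ret_emb[of _ C i i] v by metis
  qed
  moreover have "\<exists>!w. w \<in> carrier_vec (length vs) \<and> (\<Sum>l<length vs. fscale (w $ l) (vs ! l)) = emb C i v"
    using P.basis_list_coordinates[OF B] v by (simp add: theta_V_def)
  ultimately show ?thesis by (metis (no_types, lifting))
qed

lemma cx_decomposition:
  assumes "is_cx C" and bd: "\<And>i. int N < \<bar>i\<bar> \<Longrightarrow> mdT (cobj C i) = 0" and fixd: "\<And>i. fixed_zmod (cobj C i)"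
  shows "\<exists>Xs :: (int \<times> cx) list. (\<forall>(s, X) \<in> set Xs. basic_cx X) \<and>
           cx_isomorphic C (cx_sum (map (\<lambda>(s, X). cx_shift s X) Xs))"
proof -
  obtain ss where ss: "\<And>s. s \<in> set ss \<Longrightarrow> P.zigzag (snd s) \<or> P.square (snd s)"
    "\<And>i. P.basis_list (theta_V C i) (concat (map P.gvecs (level ss i)))"
    using P.bicomplex_decomposition[OF bicomplex_theta[OF assms(1) bd]] by blast
  have B: "P.basis_list (theta_V C i) (concat (map P.gcols (level ss i)))" for i
    using P.basis_list_gcols[of _ "[]"] ss(2)[of i] by simp
  define f where "f s = strand_map C (fst s) (map (\<lambda>g i. ghom (cobj C i) (map_gen (ret C i) g)) (snd s))" for s
  have "\<forall>s \<in> set ss. \<exists>p. basic_cx (snd p) \<and> pre_cx (cx_shift (fst p) (snd p)) \<and>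
      (\<forall>i. fixed_zmod (cobj (cx_shift (fst p) (snd p)) i)) \<and> is_chain_map (cx_shift (fst p) (snd p)) C (f s)"
    using strand_hom[OF fixd ss(1)] unfolding f_def by fastforce
  from bchoice[OF this] obtain p where p: "\<forall>s \<in> set ss. basic_cx (snd (p s)) \<and> pre_cx (cx_shift (fst (p s)) (snd (p s))) \<and>
      (\<forall>i. fixed_zmod (cobj (cx_shift (fst (p s)) (snd (p s))) i)) \<and> is_chain_map (cx_shift (fst (p s)) (snd (p s))) C (f s)"
    by blast
  have cols: "concat (map (\<lambda>s. cols (hT (f s i))) ss) = map (ret C i) (concat (map P.gcols (level ss i)))" for i
    unfolding f_def cols_strand_map level_def by (induction ss) auto
  have "cx_isomorphic C (cx_sum (map (\<lambda>s. cx_shift (fst (p s)) (snd (p s))) ss))"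
  proof (rule cx_isomorphic_sumI[OF C fixd, where f = f])
    fix i and v :: "bit vec" assume v: "v \<in> carrier_vec (mdT (cobj C i))"
    show "\<exists>!w. w \<in> carrier_vec (length (concat (map (\<lambda>s. cols (hT (f s i))) ss))) \<and>
        mat_of_cols (mdT (cobj C i)) (concat (map (\<lambda>s. cols (hT (f s i))) ss)) *\<^sub>v w = v"
      unfolding cols using basis_list_bijective[OF B v] by (simp only: length_map)
  qed (use p in auto)
  then show ?thesis
    using p by (intro exI[of _ "map p ss"]) (auto simp: case_prod_beta o_def)
qed

end

theorem theorem4p5:
  fixes C :: cx
  assumes "is_cx C"
    and "bounded_cx C"
    and "\<forall>i. \<exists>a b. zmod_isomorphic (cobj C i) (zsum (replicate a modF @ replicate b modH))"
  shows "\<exists>Xs :: (int \<times> cx) list. (\<forall>(s, X) \<in> set Xs. basic_cx X) \<and>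
           cx_isomorphic C (cx_sum (map (\<lambda>(s, X). cx_shift s X) Xs))"
proof -
  have C: "pre_cx C" using assms(1) by (simp add: is_cx_def pre_cx_def)
  obtain N :: nat where N: "\<And>i. int N < \<bar>i\<bar> \<Longrightarrow> mdT (cobj C i) = 0"
    using assms(2) unfolding bounded_cx_def by blast
  \<comment> \<open>This is how the hypothesis on sums of F and H enters: both have the property,
    and it passes to direct sums and along isomorphisms.\<close>
  have "fixed_zmod (cobj C i)" for i
  proof -
    obtain a b where iso: "zmod_isomorphic (cobj C i) (zsum (replicate a modF @ replicate b modH))" using assms(3) by blast
    have "\<forall>L \<in> set (replicate a modF @ replicate b modH). is_zmod L" using is_zmod_basic by auto
    from zsum_carrier(1,2)[OF this] show ?thesis
      using fixed_zmod_iso[OF iso pre_cxD(1)[OF C]] fixed_zmod_zsum[of "replicate a modF @ replicate b modH"]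
        is_zmod_basic fixed_zmod_basic by auto
  qed
  then show ?thesis using cx_decomposition[OF C assms(1) N] by blast
qed

end
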